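(* Let $U=\mathbb{R}^m$, let $D\subseteq\mathbb{R}^q$ be a convex set with $0\in D$, let $r>0$, and consider the time-delay system $$\dot x(t)=f(x_t,u(t),d(t)),\qquad y(t)=h(x_t)+\xi(t),\qquad x(t)\in\mathbb{R}^n,\ u(t)\in U,\ d(t)\in D,\ y(t),\xi(t)\in\mathbb{R}^k. \qquad ( * )$$ Suppose the following. (1) The mappings $f:C^0([-r,0];\mathbb{R}^n)\times U\times D\to\mathbb{R}^n$ and $h:C^0([-r,0];\mathbb{R}^n)\to\mathbb{R}^k$ are continuous, $f(0,0,0)=0$, $h(0)=0$, $f$ and $h$ map bounded sets to bounded sets, and for every bounded $S\subset C^0([-r,0];\mathbb{R}^n)\times U\times D$ there is a constant $L_S\ge 0$ such that $(x(0)-\bar x(0))^T(f(x,u,d)-f(\bar x,u,d))\le L_S\|x-\bar x\|^2$ for all $(x,u,d)\in S$, $(\bar x,u,d)\in S$. (2) For every $x_0\in C^0([-r,0];\mathbb{R}^n)$, $u\in L^\infty_{loc}(\mathbb{R}_+;U)$, $d\in L^\infty_{loc}(\mathbb{R}_+;D)$ the solution of $( * )$ with initial condition $x_0$ corresponding to inputs $u,d$ exists for all $t\ge 0$. (3) There exists a continuous mapping $R:C^0([-r,0];\mathbb{R}^n)\times U\times D\to\mathbb{R}^k$ such that for every $x_0\in C^0([-r,0];\mathbb{R}^n)$, $u\in L^\infty_{loc}(\mathbb{R}_+;U)$, $d\in L^\infty_{loc}(\mathbb{R}_+;D)$ the unique solution $x$ of $( * )$ satisfies $\frac{d}{dt}(h(x_t))=R(x_t,u(t),d(t))$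 for almost every $t\ge 0$. Moreover, there exist a constant $L\ge 0$ and $\kappa\in K$ such that $|R(\bar x,u,0)-R(x,u,d)|\le L\|\bar x-x\|+\kappa(|d|)$ for all $x,\bar x\in C^0([-r,0];\mathbb{R}^n)$, $(u,d)\in U\times D$. (4) There exist a function $\bar\kappa\in K$, constants $\bar\sigma,M>0$, a functional $\tilde k:C^0([-r,0];\mathbb{R}^n)\to\mathbb{R}^m$ with $\tilde k(0)=0$ and a constant $\bar L>0$ such that $|\tilde k(\bar x)-\tilde k(x)|+|f(\bar x,\bar u,0)-f(x,u,0)|\le\bar L\|\bar x-x\|+\bar L|\bar u-u|$ and $|f(x,u,d)-f(x,u,0)|\le\bar\kappa(|d|)$ for all $x,\bar x\in C^0([-r,0];\mathbb{R}^n)$, $\bar u,u\in\mathbb{R}^m$, $d\in D$, and such that for every $x_0\in C^0([-r,0];\mathbb{R}^n)$ the solution of $\dot x(t)=f(x_t,u(t),0)$, $u(t)=\tilde k(x_t)$ with initial condition $x_0$ exists for all $t\ge0$ and satisfies $\|x_t\|\le M\exp(-\bar\sigma t)\|x_0\|$ for all $t\ge0$. (5) The system $\dot z(t)=F(z_t,y(t),u(t))$, $\hat x_t=\Psi(z_t)$, with $z(t)\in\mathbb{R}^l$, is a Robust Exponential Observer (REO) for $( * )$, with associated constants $\gamma,\sigma>0$ and functions $g\in K$, $a\in K_\infty$ (see context). (6) For every bounded $S\subset C^0([-r,0];\mathbb{R}^l)\times U$ there exists a constant $L_S\ge 0$ such that $|R(\Psi(z),u,0)-R(\Psi(\bar z),u,0)|\le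 L_S\|z-\bar z\|$ for all $(z,u)\in S$, $(\bar z,u)\in S$. Then there exist constants $\bar\delta,\omega,\hat\gamma>0$ and functions $\hat g,\hat a\in K$ such that for every sampling sequence $\{\tau_i\}_{i=0}^\infty$ with $\tau_0=0$, $\lim(\tau_i)=+\infty$, $0<\tau_{i+1}-\tau_i\le\bar\delta$ for $i=0,1,\ldots$, and for every $(x_0,z_0)\in C^0([-r,0];\mathbb{R}^n)\times C^0([-r,0];\mathbb{R}^l)$, $\xi\in L^\infty_{loc}(\mathbb{R}_+;\mathbb{R}^k)$, $d\in L^\infty_{loc}(\mathbb{R}_+;D)$, the solution of $( * )$ together with $$\dot z(t)=F(z_t,w(t),u(t)),\ t\ge 0;\qquad \dot w(t)=R(\Psi(z_t),u(t),0),\ t\in[\tau_i,\tau_{i+1});\qquad \hat x_t=\Psi(z_t),\ t\ge 0;$$ $$w(\tau_i)=h(x_{\tau_i})+\xi(\tau_i),\qquad u(t)=\tilde k(\hat x_{\tau_i}),\ t\in[\tau_i,\tau_{i+1}),\qquad i=0,1,\ldots$$ with initial condition $(x_0,z_0)$, corresponding to inputs $d,\xi$, exists for all $t\ge0$ and satisfies $$\|x_t\|+\|\hat x_t\|\le\exp(-\omega t)\,\hat a(\|x_0\|+\|z_0\|)+\hat\gamma\sup_{0\le s\le t}(|\xi(s)|)+\sup_{0\le s\le t}\left(\hat g(|d(s)|)\right),\quad\forall t\ge0.$$ Moreover, if the function $a\in K_\infty$ associated with the REO is linear, then $\hat a$ is linear too.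
   Context: Notation. $|\cdot|$ is the Euclidean norm; for $x\in C^0([-r,0];\mathbb{R}^n)$, $\|x\|:=\max_{\theta\in[-r,0]}|x(\theta)|$. For a continuous $x:[a-r,b)\to\mathbb{R}^n$ and $t\in[a,b)$, $x_t\in C^0([-r,0];\mathbb{R}^n)$ is the history $x_t(\theta)=x(t+\theta)$. $K$ is the set of increasing continuous functions $\rho:\mathbb{R}_+\to\mathbb{R}_+$ with $\rho(0)=0$; $K_\infty$ is the set of $\rho\in K$ with $\lim_{s\to+\infty}\rho(s)=+\infty$. $L^\infty_{loc}(\mathbb{R}_+;D)$ is the class of Lebesgue measurable, locally bounded mappings $d:\mathbb{R}_+\to D$; suprema of such mappings are actual (not essential) suprema. Solutions of delay systems are continuous mappings, absolutely continuous for $t\ge0$, satisfying the differential equation almost everywhere and having the prescribed initial history on $[-r,0]$. The signal $w$ is reset at each sampling time $\tau_i$ and evolves by its differential equation on $[\tau_i,\tau_{i+1})$. Robust Exponential Observer (REO). Let $F:C^0([-r,0];\mathbb{R}^l)\times\mathbb{R}^k\times U\to\mathbb{R}^l$ and $\Psi:C^0([-r,0];\mathbb{R}^l)\to C^0([-r,0];\mathbb{R}^n)$ be continuous with $F(0,0,0)=0$, $\Psi(0)=0$, and suppose that for every bounded $\Omega\subset C^0([-r,0];\mathbb{R}^l)\times\mathbb{R}^k\times U$ the set $F(\Omega)$ is bounded and there is $L_\Omega\ge0$ with $(z(0)-\bar z(0))^T(F(z,y,u)-F(\bar z,y,u))\le L_\Omega\|z-\bar z\|^2$ for all $(z,y,u),(\bar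 z,y,u)\in\Omega$. The system $\dot z=F(z_t,y,u)$, $\hat x_t=\Psi(z_t)$ is called an REO for the system $\dot x=f(x_t,u,d)$, $y=h(x_t)+\xi$ if there exist constants $\gamma,\sigma>0$ and functions $g\in K$, $a\in K_\infty$ such that for every $(x_0,z_0)\in C^0([-r,0];\mathbb{R}^n)\times C^0([-r,0];\mathbb{R}^l)$, $u\in L^\infty_{loc}(\mathbb{R}_+;U)$, $d\in L^\infty_{loc}(\mathbb{R}_+;D)$, $\xi\in L^\infty_{loc}(\mathbb{R}_+;\mathbb{R}^k)$, the solution $(x(t),z(t))$ of $\dot x=f(x_t,u,d)$, $\dot z=F(z_t,h(x_t)+\xi,u)$, $\hat x_t=\Psi(z_t)$ with initial condition $(x_0,z_0)$ exists for all $t\ge0$ and satisfies, for all $t\ge 0$, $$\|\hat x_t-x_t\|\le\exp(-\sigma t)a(\|x_0\|+\|z_0\|)+\gamma\sup_{0\le s\le t}\left(|\xi(s)|\exp(-\sigma(t-s))\right)+\sup_{0\le s\le t}\left(g(|d(s)|)\right).$$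
   Formalization: In hypothesis (3), t ↦ h(x_t) is additionally assumed locally absolutely continuous, so that it is the integral of R; with only the almost-everywhere derivative identity the claim fails, e.g. for x' = -x with an output h(x_t) that is singular in t. *)

theory Defs
  imports "HOL-Analysis.Analysis"
begin

section \<open>The history space\<close>

text \<open>
  The Banach space of continuous functions on the interval from \<open>-r\<close> to \<open>0\<close>, with the maximum norm,
  is represented isometrically by the closed subspace \<open>C0 r\<close> of the bounded continuous functions
  on the real line that are constant to the left of \<open>-r\<close> and to the right of \<open>0\<close>.
  Norm, topology and boundedness are thus those of the library type of bounded continuous
  functions. Lemmas \<open>C0_extend\<close> and \<open>C0_norm\<close> show that the representation is
  bijective and isometric.
\<close>

definition C0 :: "real \<Rightarrow> (real \<Rightarrow>\<^sub>C 'a::metric_space) set" where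
  "C0 r = {\<phi>. \<forall>\<theta>. apply_bcontfun \<phi> \<theta> = apply_bcontfun \<phi> (clamp (-r) 0 \<theta>)}"

definition hist :: "real \<Rightarrow> (real \<Rightarrow> 'a::metric_space) \<Rightarrow> real \<Rightarrow> (real \<Rightarrow>\<^sub>C 'a)" where
  "hist r x t = Bcontfun (ext_cont (\<lambda>\<theta>. x (t + \<theta>)) (-r) 0)"

lemma C0_extend:
  fixes \<phi> :: "real \<Rightarrow> 'a::metric_space"
  assumes "r \<ge> 0" and "continuous_on {-r..0} \<phi>"
  shows "\<exists>!\<psi>. \<psi> \<in> C0 r \<and> (\<forall>\<theta>\<in>{-r..0}. apply_bcontfun \<psi> \<theta> = \<phi> \<theta>)"
proof -
  have cl: "clamp (-r) 0 \<theta> \<in> {-r..0}" for \<theta> :: real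
    using clamp_in_interval[of "-r" "0::real" \<theta>] assms(1) by simp
  have cont: "continuous_on (cbox (-r) 0) \<phi>" using assms(2) by simp
  obtain g :: "real \<Rightarrow>\<^sub>C 'a" where g: "\<And>x. x \<in> cbox (-r) 0 \<Longrightarrow> g x = \<phi> x"
      "\<And>x. g x = \<phi> (clamp (-r) 0 x)"
    by (rule continuous_on_cbox_bcontfunE[OF cont]) (rule that)
  show ?thesis
  proof (rule ex1I[of _ g])
    show "g \<in> C0 r \<and> (\<forall>\<theta>\<in>{-r..0}. apply_bcontfun g \<theta> = \<phi> \<theta>)"
      using g cl by (auto simp: C0_def)
  next
    fix \<psi> assume \<psi>: "\<psi> \<in> C0 r \<and> (\<forall>\<theta>\<in>{-r..0}. apply_bcontfun \<psi> \<theta> = \<phi> \<theta>)"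
    show "\<psi> = g"
    proof (rule bcontfun_eqI)
      fix \<theta>
      have "apply_bcontfun \<psi> \<theta> = apply_bcontfun \<psi> (clamp (-r) 0 \<theta>)"
        using \<psi> by (simp add: C0_def)
      then show "apply_bcontfun \<psi> \<theta> = apply_bcontfun g \<theta>"
        using \<psi> g(2) cl by metis
    qed
  qed
qed

lemma C0_norm:
  fixes \<phi> :: "real \<Rightarrow>\<^sub>C 'a::real_normed_vector"
  assumes "r \<ge> 0" and "\<phi> \<in> C0 r"
  shows "norm \<phi> = (SUP \<theta>\<in>{-r..0}. norm (\<phi> \<theta>))"
proof (rule antisym)
  have bdd: "bdd_above ((\<lambda>\<theta>. norm (\<phi> \<theta>)) ` {-r..0})"
    by (rule bdd_aboveI2[where M = "norm \<phi>"]) (rule norm_bounded)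
  show "norm \<phi> \<le> (SUP \<theta>\<in>{-r..0}. norm (\<phi> \<theta>))"
  proof (rule norm_bound)
    fix \<theta>
    have "clamp (-r) 0 \<theta> \<in> {-r..0}"
      using clamp_in_interval[of "-r" "0::real" \<theta>] assms(1) by simp
    moreover have "\<phi> \<theta> = \<phi> (clamp (-r) 0 \<theta>)"
      using assms(2) by (simp add: C0_def)
    ultimately show "norm (\<phi> \<theta>) \<le> (SUP \<theta>\<in>{-r..0}. norm (\<phi> \<theta>))"
      using cSUP_upper[OF _ bdd] by metis
  qed
  show "(SUP \<theta>\<in>{-r..0}. norm (\<phi> \<theta>)) \<le> norm \<phi>"
    using assms(1) by (intro cSUP_least norm_bounded) auto
qed

lemma
  fixes x :: "real \<Rightarrow> 'a::metric_space"
  assumes "r \<ge> 0" and "continuous_on {t-r..t} x"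
  shows hist_in_C0: "hist r x t \<in> C0 r"
    and hist_apply: "\<theta> \<in> {-r..0} \<Longrightarrow> hist r x t \<theta> = x (t + \<theta>)"
proof -
  have cl: "clamp (-r) 0 \<theta> \<in> cbox (-r) (0::real)" for \<theta> :: real
    using clamp_in_interval[of "-r" "0::real" \<theta>] assms(1) by simp
  have cont: "continuous_on (cbox (-r) 0) (\<lambda>\<theta>. x (t + \<theta>))"
    by (rule continuous_on_compose2[OF assms(2)]) (auto intro!: continuous_intros)
  obtain g :: "real \<Rightarrow>\<^sub>C 'a" where "\<And>s. s \<in> cbox (-r) 0 \<Longrightarrow> g s = x (t + s)"
      "\<And>s. g s = x (t + clamp (-r) 0 s)"
    by (rule continuous_on_cbox_bcontfunE[OF cont]) (rule that)
  then have "ext_cont (\<lambda>\<theta>. x (t + \<theta>)) (-r) 0 = apply_bcontfun g"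
    by (auto simp: ext_cont_def)
  then have *: "apply_bcontfun (hist r x t) = ext_cont (\<lambda>\<theta>. x (t + \<theta>)) (-r) 0"
    by (simp add: hist_def apply_bcontfun_inverse)
  show "hist r x t \<in> C0 r"
    by (simp add: C0_def * ext_cont_def clamp_cancel_cbox[OF cl])
  show "hist r x t \<theta> = x (t + \<theta>)" if "\<theta> \<in> {-r..0}"
    unfolding * using that by simp
qed


section \<open>Comparison functions and inputs\<close>

definition class_K :: "(real \<Rightarrow> real) set" where
  "class_K = {\<rho>. strict_mono_on {0..} \<rho> \<and> continuous_on {0..} \<rho> \<and> \<rho> 0 = 0}"

definition class_K_inf :: "(real \<Rightarrow> real) set" where
  "class_K_inf = {\<rho> \<in> class_K. filterlim \<rho> at_top at_top}"

definition linear_on_nonneg :: "(real \<Rightarrow> real) \<Rightarrow> bool" where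
  "linear_on_nonneg \<rho> \<longleftrightarrow> (\<exists>c. \<forall>s\<ge>0. \<rho> s = c * s)"

text \<open>Signals are functions on the real line of which only the values on \<open>{0..}\<close> matter.\<close>

definition Linf_loc :: "'a::euclidean_space set \<Rightarrow> (real \<Rightarrow> 'a) set" where
  "Linf_loc D = {d. d \<in> borel_measurable (lebesgue_on {0..}) \<and>
                    (\<forall>t\<ge>0. bounded (d ` {0..t})) \<and> (\<forall>t\<ge>0. d t \<in> D)}"


section \<open>Differential equations in the sense of Caratheodory\<close>

definition abs_cont_on :: "real \<Rightarrow> real \<Rightarrow> (real \<Rightarrow> 'a::real_normed_vector) \<Rightarrow> bool" where
  "abs_cont_on a b v \<longleftrightarrow>
     (\<forall>\<epsilon>>0. \<exists>\<delta>>0. \<forall>P::(real \<times> real) set.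
        finite P \<and> (\<forall>(p, q)\<in>P. a \<le> p \<and> p \<le> q \<and> q \<le> b) \<and>
        disjoint_family_on (\<lambda>(p, q). {p<..<q}) P \<and> (\<Sum>(p, q)\<in>P. q - p) < \<delta> \<longrightarrow>
        (\<Sum>(p, q)\<in>P. norm (v q - v p)) < \<epsilon>)"

text \<open>
  \<open>ae_ode S v g\<close> is the meaning of \<open>dv/dt = g(t)\<close> on the interval \<open>S\<close>: \<open>v\<close> is absolutely continuous
  on compact subintervals of \<open>S\<close> and the equation holds almost everywhere. Without absolute continuity
  the derivative would not determine \<open>v\<close> (think of the Cantor function).
\<close>

definition ae_ode :: "real set \<Rightarrow> (real \<Rightarrow> 'a::real_normed_vector) \<Rightarrow> (real \<Rightarrow> 'a) \<Rightarrow> bool" where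
  "ae_ode S v g \<longleftrightarrow>
     (\<forall>a b. a \<le> b \<and> {a..b} \<subseteq> S \<longrightarrow> abs_cont_on a b v) \<and>
     (AE t in lebesgue_on S. (v has_vector_derivative g t) (at t))"

text \<open>
  \<open>delay_sol r x0 g x\<close>: \<open>x\<close> is a solution on \<open>[-r, \<infinity>)\<close> of \<open>dx/dt = g(t)\<close>, \<open>t \<ge> 0\<close>, with initial history
  \<open>x0\<close>; in a delay equation \<open>g\<close> is given in terms of the histories of \<open>x\<close> itself.
\<close>

definition delay_sol ::
  "real \<Rightarrow> (real \<Rightarrow>\<^sub>C 'a::real_normed_vector) \<Rightarrow> (real \<Rightarrow> 'a) \<Rightarrow> (real \<Rightarrow> 'a) \<Rightarrow> bool" where
  "delay_sol r x0 g x \<longleftrightarrow>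
     continuous_on {-r..} x \<and> (\<forall>\<theta>\<in>{-r..0}. x \<theta> = x0 \<theta>) \<and> ae_ode {0..} x g"


section \<open>Robust exponential observers\<close>

definition is_REO ::
  "real \<Rightarrow> (real^'q) set
   \<Rightarrow> ((real \<Rightarrow>\<^sub>C (real^'n)) \<times> (real^'m) \<times> (real^'q) \<Rightarrow> real^'n)
   \<Rightarrow> ((real \<Rightarrow>\<^sub>C (real^'n)) \<Rightarrow> real^'k)
   \<Rightarrow> ((real \<Rightarrow>\<^sub>C (real^'l)) \<times> (real^'k) \<times> (real^'m) \<Rightarrow> real^'l)
   \<Rightarrow> ((real \<Rightarrow>\<^sub>C (real^'l)) \<Rightarrow> (real \<Rightarrow>\<^sub>C (real^'n)))
   \<Rightarrow> real \<Rightarrow> real \<Rightarrow> (real \<Rightarrow> real) \<Rightarrow> (real \<Rightarrow> real) \<Rightarrow> bool" where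
  "is_REO r D f h F \<Psi> \<gamma> \<sigma> g a \<longleftrightarrow>
     continuous_on (C0 r \<times> UNIV \<times> UNIV) F \<and> F (0, 0, 0) = 0 \<and>
     \<Psi> ` C0 r \<subseteq> C0 r \<and> continuous_on (C0 r) \<Psi> \<and> \<Psi> 0 = 0 \<and>
     (\<forall>\<Omega> \<subseteq> C0 r \<times> UNIV \<times> UNIV. bounded \<Omega> \<longrightarrow>
        bounded (F ` \<Omega>) \<and>
        (\<exists>L\<ge>0. \<forall>z z' y u. (z, y, u) \<in> \<Omega> \<and> (z', y, u) \<in> \<Omega> \<longrightarrow>
           (apply_bcontfun z 0 - apply_bcontfun z' 0) \<bullet> (F (z, y, u) - F (z', y, u)) \<le> L * (norm (z - z'))\<^sup>2)) \<and>
     \<gamma> > 0 \<and> \<sigma> > 0 \<and> g \<in> class_K \<and> a \<in> class_K_inf \<and>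
     (\<forall>x0\<in>C0 r. \<forall>z0\<in>C0 r. \<forall>u\<in>Linf_loc UNIV. \<forall>d\<in>Linf_loc D. \<forall>\<xi>\<in>Linf_loc UNIV.
        let sol = (\<lambda>x z. delay_sol r x0 (\<lambda>t. f (hist r x t, u t, d t)) x \<and>
                         delay_sol r z0 (\<lambda>t. F (hist r z t, h (hist r x t) + \<xi> t, u t)) z)
        in (\<exists>x z. sol x z) \<and>
           (\<forall>x z. sol x z \<longrightarrow>
              (\<forall>t\<ge>0. norm (\<Psi> (hist r z t) - hist r x t)
                 \<le> exp (- \<sigma> * t) * a (norm x0 + norm z0)
                    + \<gamma> * (SUP s\<in>{0..t}. norm (\<xi> s) * exp (- \<sigma> * (t - s)))
                    + (SUP s\<in>{0..t}. g (norm (d s))))))"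


section \<open>The sampled-data closed loop\<close>

definition sampling_sequence :: "real \<Rightarrow> (nat \<Rightarrow> real) \<Rightarrow> bool" where
  "sampling_sequence \<delta> \<tau> \<longleftrightarrow>
     \<tau> 0 = 0 \<and> filterlim \<tau> at_top sequentially \<and>
     (\<forall>i. 0 < \<tau> (Suc i) - \<tau> i \<and> \<tau> (Suc i) - \<tau> i \<le> \<delta>)"

definition closed_loop_sol ::
  "real \<Rightarrow> ((real \<Rightarrow>\<^sub>C (real^'n)) \<times> (real^'m) \<times> (real^'q) \<Rightarrow> real^'n)
   \<Rightarrow> ((real \<Rightarrow>\<^sub>C (real^'n)) \<Rightarrow> real^'k)
   \<Rightarrow> ((real \<Rightarrow>\<^sub>C (real^'n)) \<times> (real^'m) \<times> (real^'q) \<Rightarrow> real^'k)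
   \<Rightarrow> ((real \<Rightarrow>\<^sub>C (real^'n)) \<Rightarrow> real^'m)
   \<Rightarrow> ((real \<Rightarrow>\<^sub>C (real^'l)) \<times> (real^'k) \<times> (real^'m) \<Rightarrow> real^'l)
   \<Rightarrow> ((real \<Rightarrow>\<^sub>C (real^'l)) \<Rightarrow> (real \<Rightarrow>\<^sub>C (real^'n)))
   \<Rightarrow> (nat \<Rightarrow> real) \<Rightarrow> (real \<Rightarrow>\<^sub>C (real^'n)) \<Rightarrow> (real \<Rightarrow>\<^sub>C (real^'l))
   \<Rightarrow> (real \<Rightarrow> real^'q) \<Rightarrow> (real \<Rightarrow> real^'k)
   \<Rightarrow> (real \<Rightarrow> real^'n) \<Rightarrow> (real \<Rightarrow> real^'l) \<Rightarrow> (real \<Rightarrow> real^'k) \<Rightarrow> (real \<Rightarrow> real^'m) \<Rightarrow> bool" where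
  "closed_loop_sol r f h R k F \<Psi> \<tau> x0 z0 d \<xi> x z w u \<longleftrightarrow>
     delay_sol r x0 (\<lambda>t. f (hist r x t, u t, d t)) x \<and>
     delay_sol r z0 (\<lambda>t. F (hist r z t, w t, u t)) z \<and>
     (\<forall>i. w (\<tau> i) = h (hist r x (\<tau> i)) + \<xi> (\<tau> i) \<and>
          ae_ode {\<tau> i..<\<tau> (Suc i)} w (\<lambda>t. R (\<Psi> (hist r z t), u t, 0)) \<and>
          (\<forall>t\<in>{\<tau> i..<\<tau> (Suc i)}. u t = k (\<Psi> (hist r z (\<tau> i)))))"

end

theory Submission
  imports Defs "HOL-Complex_Analysis.Great_Picard"
begin

text \<open>
  The error \<open>E(t) = \<parallel>\<Psi>(z\<^sub>t) - x\<^sub>t\<parallel>\<close> of the observer is governed by the mismatch \<open>w - h(x\<^sub>t)\<close> between the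
  predicted and the true output, and this mismatch is reset to the measurement error \<open>\<xi>(\<tau>\<^sub>i)\<close> at every
  sampling time. Between two samples it grows at a rate of at most \<open>L E(t) + \<kappa>(|d(t)|)\<close>. The two estimates
  form a loop whose gain is proportional to the sampling period. If the period is small, the loop closes
  (\<open>small_gain\<close>), and \<open>E(t)\<close> is an exponentially decaying term plus a multiple of the noise.

  The plant then runs under the nominal feedback, up to a perturbation made of \<open>d\<close>, of \<open>E\<close> and of the
  displacement \<open>x\<^sub>\<tau> - x\<^sub>t\<close> of the history since the last sample. On a window of fixed length the
  trajectory is compared with the nominal solution that starts from the same history. The nominal decay
  contracts the norm by the factor \<open>1/8\<close>, and the displacement costs the sampling period times the size of
  the trajectory itself. With the weight \<open>exp(\<omega>t)\<close> both contributions together are at most half of the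
  weighted supremum of \<open>\<parallel>x\<^sub>t\<parallel>\<close> and can be absorbed (\<open>sampled_feedback_decay\<close>). The first instants need a
  separate Gronwall bound, because there the history still contains the initial function, whose modulus of
  continuity is not controlled.

  Existence is settled one sampling interval at a time. There the control is a known constant, so the
  plant decouples, and it remains to solve \<open>z' = F(z\<^sub>t, w, u)\<close>, \<open>w' = R(\<Psi>(z\<^sub>t), u, 0)\<close>. The observer property
  supplies \<open>z\<close> for every prescribed \<open>w\<close>, so that \<open>w\<close> is a fixed point of a causal operator. As \<open>F\<close> is merely
  continuous in \<open>w\<close>, the operator is continuous but need not be a contraction. The observer estimate and the
  short sampling interval give an invariant ball, in which Tonelli's delayed approximations converge
  (\<open>causal_fixed_point\<close>, \<open>predictor_exists\<close>).

  All differential inequalities rest on one fact: an absolutely continuous function grows no faster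
  than its derivative allows almost everywhere (\<open>abs_cont_increment_le\<close>).
\<close>

section \<open>Histories\<close>

lemma C0_diff: "\<phi> \<in> C0 r \<Longrightarrow> \<psi> \<in> C0 r \<Longrightarrow> \<phi> - \<psi> \<in> C0 r"
  for \<phi> \<psi> :: "real \<Rightarrow>\<^sub>C 'a::real_normed_vector"
  unfolding C0_def by simp

lemma zero_in_C0: "(0 :: real \<Rightarrow>\<^sub>C 'a::real_normed_vector) \<in> C0 r"
  by (simp add: C0_def)

lemma C0_norm_le:
  fixes \<phi> :: "real \<Rightarrow>\<^sub>C 'a::real_normed_vector"
  assumes "r \<ge> 0" "\<phi> \<in> C0 r" "\<And>\<theta>. \<theta> \<in> {-r..0} \<Longrightarrow> norm (\<phi> \<theta>) \<le> B"
  shows "norm \<phi> \<le> B"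
  using assms by (subst C0_norm[of r]) (auto intro!: cSUP_least)

lemma hist_norm_le:
  fixes x :: "real \<Rightarrow> 'a::real_normed_vector"
  assumes "r \<ge> 0" "continuous_on {t-r..t} x" "\<And>s. s \<in> {t-r..t} \<Longrightarrow> norm (x s) \<le> B"
  shows "norm (hist r x t) \<le> B"
  using assms by (intro C0_norm_le[of r] hist_in_C0) (auto simp: hist_apply)

lemma hist_diff_le:
  fixes x y :: "real \<Rightarrow> 'a::real_normed_vector"
  assumes "r \<ge> 0" "continuous_on {t-r..t} x" "continuous_on {t'-r..t'} y"
    and "\<And>\<theta>. \<theta> \<in> {-r..0} \<Longrightarrow> norm (x (t + \<theta>) - y (t' + \<theta>)) \<le> B"
  shows "norm (hist r x t - hist r y t') \<le> B"
  using assms by (intro C0_norm_le[of r] C0_diff hist_in_C0) (auto simp: hist_apply)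

lemma hist_cong:
  assumes "r \<ge> 0" "\<And>s. s \<in> {t-r..t} \<Longrightarrow> x s = y s"
  shows "hist r x t = hist r y t"
proof -
  have "clamp (-r) 0 \<theta> \<in> {-r..0}" for \<theta> :: real
    using clamp_in_interval[of "-r" "0::real" \<theta>] assms(1) by simp
  then have "x (t + clamp (-r) 0 \<theta>) = y (t + clamp (-r) 0 \<theta>)" for \<theta>
    using assms(2)[of "t + clamp (-r) 0 \<theta>"] \<open>clamp (-r) 0 \<theta> \<in> {-r..0}\<close> by auto
  then show ?thesis by (simp add: hist_def ext_cont_def)
qed

lemma continuous_on_hist:
  fixes x :: "real \<Rightarrow> 'a::real_normed_vector"
  assumes "r \<ge> 0" "continuous_on {a-r..b} x"
  shows "continuous_on {a..b} (hist r x)"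
proof (rule uniformly_continuous_imp_continuous, unfold uniformly_continuous_on_def, intro allI impI)
  fix e :: real assume "e > 0"
  have sub: "continuous_on {t-r..t} x" if "t \<in> {a..b}" for t
    using that by (intro continuous_on_subset[OF assms(2)]) auto
  have "uniformly_continuous_on {a-r..b} x"
    using assms(2) by (intro compact_uniformly_continuous) auto
  then obtain d where d: "d > 0"
    "\<And>s s'. s \<in> {a-r..b} \<Longrightarrow> s' \<in> {a-r..b} \<Longrightarrow> dist s' s < d \<Longrightarrow> dist (x s') (x s) < e/2"
    unfolding uniformly_continuous_on_def using \<open>e > 0\<close> by (metis half_gt_zero)
  have "dist (hist r x t') (hist r x t) < e"
    if "t \<in> {a..b}" "t' \<in> {a..b}" "dist t' t < d" for t t'
  proof -
    have "norm (hist r x t' - hist r x t) \<le> e/2"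
    proof (rule hist_diff_le[OF assms(1) sub sub])
      fix \<theta> assume "\<theta> \<in> {-r..0}"
      then show "norm (x (t' + \<theta>) - x (t + \<theta>)) \<le> e/2"
        using d(2)[of "t + \<theta>" "t' + \<theta>"] that by (auto simp: dist_norm)
    qed (use that in auto)
    then show ?thesis using \<open>e > 0\<close> by (simp add: dist_norm)
  qed
  then show "\<exists>d>0. \<forall>t\<in>{a..b}. \<forall>t'\<in>{a..b}. dist t' t < d \<longrightarrow> dist (hist r x t') (hist r x t) < e"
    using d(1) by blast
qed

lemma continuous_on_hist_atLeast:
  fixes x :: "real \<Rightarrow> 'a::real_normed_vector"
  assumes "r \<ge> 0" "continuous_on {-r..} x"
  shows "continuous_on {0..} (hist r x)"
proof (clarsimp simp: continuous_on_eq_continuous_within)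
  fix t :: real assume "t \<ge> 0"
  have "continuous_on {0..t+1} (hist r x)"
    using assms by (intro continuous_on_hist) (auto elim!: continuous_on_subset)
  then have "continuous (at t within {0..t+1}) (hist r x)"
    using \<open>t \<ge> 0\<close> by (simp add: continuous_on_eq_continuous_within)
  moreover have "at t within {0..} = at t within {0..t+1}"
    by (rule at_within_nhd[of _ "{..<t+1}"]) auto
  ultimately show "continuous (at t within {0..}) (hist r x)"
    by (simp add: continuous_within)
qed

section \<open>Absolutely continuous functions\<close>

lemma negligible_imp_open_cover:
  fixes N :: "real set"
  assumes "negligible N" "e > 0"
  obtains U where "open U" "N \<subseteq> U" "U \<in> lmeasurable" "measure lebesgue U < e"
proof -
  have N: "N \<in> sets lebesgue" "N \<in> null_sets lebesgue"
    using assms(1) negligible_iff_null_sets by auto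
  then obtain U where U: "open U" "N \<subseteq> U" "U - N \<in> lmeasurable"
      "emeasure lebesgue (U - N) < ennreal e"
    using sets_lebesgue_outer_open[OF N(1) assms(2)] by metis
  have "U = (U - N) \<union> N" using U by auto
  then have em: "emeasure lebesgue U = emeasure lebesgue (U - N)"
    using emeasure_Un_null_set[OF _ N(2), of "U - N"] U(3) by (metis fmeasurableD)
  have "U \<in> lmeasurable"
    using em U(1,4) by (intro fmeasurableI) (auto intro: order.strict_trans simp: borel_open)
  moreover have "measure lebesgue U < e"
    using em U(4) assms(2) by (metis emeasure_eq_measure2 U(3) \<open>U \<in> lmeasurable\<close> ennreal_less_iff measure_nonneg)
  ultimately show ?thesis using that U by blast
qed

text \<open>
  A tagged partition is chosen that is fine in two ways. Around a tag where \<open>v\<close> and \<open>\<phi>\<close> are differentiable,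
  \<open>v - \<phi>\<close> increases by at most a small multiple of the length of the interval. The intervals with tags in the
  exceptional set lie in an open set of small measure, so absolute continuity makes the increments of \<open>v\<close>
  over them small in total. The monotonicity of \<open>\<phi>\<close> lets its increments over these intervals be dropped,
  so that \<open>\<phi>\<close> itself may be any function that is differentiable where it is needed.
\<close>
lemma abs_cont_increment_le:
  fixes v \<phi> :: "real \<Rightarrow> real"
  assumes "a \<le> b" and ac: "abs_cont_on a b v" and mono: "mono_on {a..b} \<phi>"
    and N: "negligible N"
    and deriv: "\<And>t. t \<in> {a<..<b} - N \<Longrightarrow>
      \<exists>v' \<phi>'. (v has_vector_derivative v') (at t) \<and> (\<phi> has_vector_derivative \<phi>') (at t) \<and> v' \<le> \<phi>'"
  shows "v b - v a \<le> \<phi> b - \<phi> a"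
proof (rule field_le_epsilon)
  fix e :: real assume "e > 0"
  define \<psi> where "\<psi> t = v t - \<phi> t" for t
  define N' where "N' = N \<union> {a, b}"
  define \<epsilon> where "\<epsilon> = e / (2 * (b - a + 1))"
  have \<epsilon>: "\<epsilon> > 0" "\<epsilon> * (b - a) \<le> e/2"
    using \<open>a \<le> b\<close> \<open>e > 0\<close> by (auto simp: \<epsilon>_def field_simps)
  obtain \<delta> where \<delta>: "\<delta> > 0" "\<And>P. finite P \<Longrightarrow> (\<forall>(p, q)\<in>P. a \<le> p \<and> p \<le> q \<and> q \<le> b) \<Longrightarrow>
        disjoint_family_on (\<lambda>(p, q). {p<..<q}) P \<Longrightarrow> (\<Sum>(p, q)\<in>P. q - p) < \<delta> \<Longrightarrow>
        (\<Sum>(p, q)\<in>P. norm (v q - v p)) < e/2"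
    using ac[unfolded abs_cont_on_def, rule_format, of "e/2"] \<open>e > 0\<close> by auto
  have negN': "negligible N'" unfolding N'_def using N by auto
  obtain U where U: "open U" "N' \<subseteq> U" "U \<in> lmeasurable" "measure lebesgue U < \<delta>"
    using negligible_imp_open_cover[OF negN' \<delta>(1)] by blast
  have "\<exists>d>0. \<forall>p q. a \<le> p \<and> p \<le> t \<and> t \<le> q \<and> q \<le> b \<and> p \<in> ball t d \<and> q \<in> ball t d
          \<longrightarrow> \<psi> q - \<psi> p \<le> \<epsilon> * (q - p)" if "t \<in> {a..b} - N'" for t
  proof -
    have "t \<in> {a<..<b} - N" using that by (auto simp: N'_def)
    then obtain v' \<phi>' where v': "(v has_vector_derivative v') (at t)"
      "(\<phi> has_vector_derivative \<phi>') (at t)" "v' \<le> \<phi>'" using deriv by blast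
    have "(\<psi> has_vector_derivative (v' - \<phi>')) (at t)"
      unfolding \<psi>_def by (intro has_vector_derivative_diff v')
    then have "(\<psi> has_derivative (\<lambda>h. h * (v' - \<phi>'))) (at t)"
      by (simp add: has_vector_derivative_def)
    then obtain d where d: "d > 0"
      "\<And>y. norm (y - t) < d \<Longrightarrow> norm (\<psi> y - \<psi> t - (y - t) * (v' - \<phi>')) \<le> \<epsilon> * norm (y - t)"
      unfolding has_derivative_at_alt using \<epsilon>(1) by blast
    have "\<psi> q - \<psi> p \<le> \<epsilon> * (q - p)"
      if "p \<le> t" "t \<le> q" "p \<in> ball t d" "q \<in> ball t d" for p q
    proof -
      have "(q - t) * (v' - \<phi>') \<le> 0" "0 \<le> (p - t) * (v' - \<phi>')"
        using that v'(3) by (auto simp: mult_le_0_iff zero_le_mult_iff)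
      then show ?thesis
        using d(2)[of p] d(2)[of q] that by (auto simp: dist_real_def algebra_simps abs_le_iff)
    qed
    then show ?thesis using d(1) by blast
  qed
  then obtain d where d: "\<And>t. t \<in> {a..b} - N' \<Longrightarrow> d t > 0"
     "\<And>t p q. t \<in> {a..b} - N' \<Longrightarrow> a \<le> p \<Longrightarrow> p \<le> t \<Longrightarrow> t \<le> q \<Longrightarrow> q \<le> b \<Longrightarrow>
        p \<in> ball t (d t) \<Longrightarrow> q \<in> ball t (d t) \<Longrightarrow> \<psi> q - \<psi> p \<le> \<epsilon> * (q - p)"
    by metis
  define G where "G t = (if t \<in> N' then U else if t \<in> {a..b} then ball t (d t) else UNIV)" for t
  have "gauge G" unfolding gauge_def G_def using U d(1) by auto
  then obtain T where T: "T tagged_division_of {a..b}" "G fine T"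
    using fine_division_exists_real by blast
  note Tc = tagged_division_ofD[OF T(1)]
  have finT: "finite T" using Tc by blast
  have itv: "\<exists>p q. K = {p..q} \<and> p \<le> t \<and> t \<le> q \<and> a \<le> p \<and> q \<le> b \<and> Inf K = p \<and> Sup K = q"
    if tK: "(t, K) \<in> T" for t K
  proof -
    obtain p q where "K = cbox p q" using Tc(4)[OF tK] by blast
    moreover have "t \<in> K" "K \<subseteq> {a..b}" using Tc(2,3)[OF tK] by auto
    ultimately show ?thesis by (intro exI[of _ p] exI[of _ q]) auto
  qed
  \<comment> \<open>Degenerate intervals are left out: only then do distinct tags have distinct intervals.\<close>
  define B where "B = {(t, K) \<in> T. t \<in> N' \<and> Inf K < Sup K}"
  define P where "P = (\<lambda>(t, K). (Inf K, Sup K)) ` B"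
  have BT: "B \<subseteq> T" by (auto simp: B_def)
  have finB: "finite B" using BT finT finite_subset by blast
  have intdis: "{Inf K<..<Sup K} \<inter> {Inf K'<..<Sup K'} = {}"
    if KK': "(t, K) \<in> T" "(t', K') \<in> T" "(t, K) \<noteq> (t', K')" for t K t' K'
  proof -
    have "K = {Inf K..Sup K}" "K' = {Inf K'..Sup K'}"
      using itv[OF KK'(1)] itv[OF KK'(2)] by metis+
    then have "interior K = {Inf K<..<Sup K}" "interior K' = {Inf K'<..<Sup K'}"
      by (metis interior_atLeastAtMost_real)+
    then show ?thesis using Tc(5)[OF KK'] by simp
  qed
  have inj: "inj_on (\<lambda>(t, K). (Inf K, Sup K)) B"
  proof (rule inj_onI)
    fix c c' assume c: "c \<in> B" "c' \<in> B"
      and eq: "(\<lambda>(t, K). (Inf K, Sup K)) c = (\<lambda>(t, K). (Inf K, Sup K)) c'"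
    obtain t K t' K' where tK: "c = (t, K)" "c' = (t', K')" by (metis surj_pair)
    show "c = c'"
    proof (rule ccontr)
      assume "c \<noteq> c'"
      then have "{Inf K<..<Sup K} \<inter> {Inf K'<..<Sup K'} = {}"
        using intdis[of t K t' K'] c BT tK by blast
      then show False using c eq tK dense[of "Inf K" "Sup K"] by (auto simp: B_def)
    qed
  qed
  have sumP: "(\<Sum>(p, q)\<in>P. norm (v q - v p)) = (\<Sum>(t, K)\<in>B. norm (v (Sup K) - v (Inf K)))"
    "(\<Sum>(p, q)\<in>P. q - p) = (\<Sum>(t, K)\<in>B. Sup K - Inf K)"
    using sum.reindex[OF inj, of "\<lambda>(p, q). norm (v q - v p)"] sum.reindex[OF inj, of "\<lambda>(p, q). q - p"]
    by (simp_all add: P_def case_prod_unfold o_def)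
  have "(\<Sum>(t, K)\<in>B. Sup K - Inf K) \<le> measure lebesgue U"
  proof -
    have part: "B tagged_partial_division_of {a..b}"
      using T(1) BT unfolding tagged_division_of_def by (blast intro: tagged_partial_division_subset)
    have div: "snd ` B division_of \<Union>(snd ` B)"
      using tagged_partial_division_of_Union_self[OF part] division_of_tagged_division by blast
    have injs: "inj_on snd B"
    proof (rule inj_onI)
      fix c c' assume c: "c \<in> B" "c' \<in> B" "snd c = snd c'"
      then show "c = c'" using inj_onD[OF inj, of c c'] by (simp add: case_prod_unfold)
    qed
    have "(\<Sum>(t, K)\<in>B. Sup K - Inf K) = (\<Sum>(t, K)\<in>B. measure lebesgue K)"
    proof (rule sum.cong, simp, safe)
      fix t K assume "(t, K) \<in> B"
      with BT itv obtain p q where "K = {p..q}" "p \<le> q" "Inf K = p" "Sup K = q"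
        by (metis (no_types, lifting) order.trans subsetD)
      then show "Sup K - Inf K = measure lebesgue K" by simp
    qed
    also have "\<dots> = sum (measure lebesgue) (snd ` B)"
      by (subst sum.reindex[OF injs]) (simp add: case_prod_unfold)
    also have "\<dots> = measure lebesgue (\<Union>(snd ` B))"
      using content_division[OF div] by blast
    also have "\<dots> \<le> measure lebesgue U"
    proof (rule measure_mono_fmeasurable)
      show "\<Union>(snd ` B) \<subseteq> U"
      proof
        fix y assume "y \<in> \<Union>(snd ` B)"
        then obtain t K where tK: "(t, K) \<in> B" "y \<in> K" by auto
        then have "K \<subseteq> G t" "t \<in> N'" using fineD[OF T(2), of t K] by (auto simp: B_def)
        then show "y \<in> U" using tK by (auto simp: G_def)
      qed
      show "\<Union>(snd ` B) \<in> sets lebesgue"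
        using lmeasurable_division[OF div] by auto
    qed (use U in auto)
    finally show ?thesis .
  qed
  then have "(\<Sum>(p, q)\<in>P. norm (v q - v p)) < e/2"
  proof (intro \<delta>(2))
    show "disjoint_family_on (\<lambda>(p, q). {p<..<q}) P"
      unfolding disjoint_family_on_def
    proof (intro ballI impI)
      fix m n assume "m \<in> P" "n \<in> P" "m \<noteq> n"
      then obtain t K t' K' where "(t, K) \<in> B" "m = (Inf K, Sup K)" "(t', K') \<in> B" "n = (Inf K', Sup K')"
        "(t, K) \<noteq> (t', K')"
        unfolding P_def by (smt (verit) case_prod_conv imageE surj_pair)
      then show "(case m of (p, q) \<Rightarrow> {p<..<q}) \<inter> (case n of (p, q) \<Rightarrow> {p<..<q}) = {}"
        using intdis[of t K t' K'] BT by auto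
    qed
    show "\<forall>(p, q)\<in>P. a \<le> p \<and> p \<le> q \<and> q \<le> b"
    proof
      fix m assume "m \<in> P"
      then obtain t K where "(t, K) \<in> T" "m = (Inf K, Sup K)"
        unfolding P_def using BT by auto
      then show "case m of (p, q) \<Rightarrow> a \<le> p \<and> p \<le> q \<and> q \<le> b"
        using itv[of t K] by auto
    qed
  qed (use finB U sumP in \<open>auto simp: P_def\<close>)
  then have bad: "(\<Sum>(t, K)\<in>B. norm (v (Sup K) - v (Inf K))) < e/2" using sumP by simp
  have "\<psi> b - \<psi> a = (\<Sum>(t, K)\<in>T. \<psi> (Sup K) - \<psi> (Inf K))"
    using additive_tagged_division_1[OF \<open>a \<le> b\<close> T(1)] by metis
  also have "\<dots> \<le> (\<Sum>(t, K)\<in>T. \<epsilon> * (Sup K - Inf K)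
      + (if (t, K) \<in> B then norm (v (Sup K) - v (Inf K)) else 0))"
  proof (rule sum_mono, safe)
    fix t K assume tK: "(t, K) \<in> T"
    then obtain p q where pq: "K = {p..q}" "p \<le> t" "t \<le> q" "a \<le> p" "q \<le> b" "Inf K = p" "Sup K = q"
      using itv by blast
    consider "t \<notin> N'" | "t \<in> N'" "p = q" | "t \<in> N'" "p < q" using pq by linarith
    then show "\<psi> (Sup K) - \<psi> (Inf K) \<le> \<epsilon> * (Sup K - Inf K)
      + (if (t, K) \<in> B then norm (v (Sup K) - v (Inf K)) else 0)"
    proof cases
      case 1
      have "K \<subseteq> ball t (d t)"
        using fineD[OF T(2) tK] 1 pq by (simp add: G_def)
      moreover have "p \<in> K" "q \<in> K" using pq by auto
      ultimately have "p \<in> ball t (d t)" "q \<in> ball t (d t)" by blast+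
      then have "\<psi> q - \<psi> p \<le> \<epsilon> * (q - p)" using d(2)[of t p q] 1 pq by auto
      then show ?thesis using 1 pq by (auto simp: B_def)
    next
      case 2 then show ?thesis using pq by auto
    next
      case 3
      have "\<phi> p \<le> \<phi> q" using mono pq by (auto simp: mono_on_def)
      moreover have "0 \<le> \<epsilon> * (q - p)" using \<epsilon>(1) pq by simp
      moreover have "(t, K) \<in> B" using 3 tK pq by (auto simp: B_def)
      ultimately show ?thesis using pq by (simp add: \<psi>_def)
    qed
  qed
  also have "\<dots> = \<epsilon> * (\<Sum>(t, K)\<in>T. Sup K - Inf K) + (\<Sum>(t, K)\<in>B. norm (v (Sup K) - v (Inf K)))"
  proof -
    have "B = T \<inter> B" using BT by auto
    then show ?thesis
      by (simp add: case_prod_unfold sum.distrib sum_distrib_left sum.inter_restrict[OF finT, symmetric])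
  qed
  also have "(\<Sum>(t, K)\<in>T. Sup K - Inf K) = b - a"
    using additive_tagged_division_1[OF \<open>a \<le> b\<close> T(1), of "\<lambda>x. x"] .
  finally have "\<psi> b - \<psi> a \<le> e" using bad \<epsilon>(2) by linarith
  then show "v b - v a \<le> \<phi> b - \<phi> a + e" by (simp add: \<psi>_def)
qed

text \<open>
  Absolute continuity passes to every function whose increments are dominated by those of two
  absolutely continuous ones; differences, squared norms and Lipschitz functions are instances.
\<close>
lemma abs_cont_on_control:
  assumes v: "abs_cont_on a b v" and v': "abs_cont_on a b v'" and "C \<ge> 0"
    and le: "\<And>p q. a \<le> p \<Longrightarrow> p \<le> q \<Longrightarrow> q \<le> b \<Longrightarrow>
      norm (V q - V p) \<le> C * (norm (v q - v p) + norm (v' q - v' p))"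
  shows "abs_cont_on a b V"
  unfolding abs_cont_on_def
proof (intro allI impI)
  fix \<epsilon> :: real assume "\<epsilon> > 0"
  define e where "e = \<epsilon> / (2 * C + 1)"
  have e: "e > 0" "2 * C * e < \<epsilon>"
    using \<open>\<epsilon> > 0\<close> \<open>C \<ge> 0\<close> by (auto simp: e_def field_simps)
  obtain d where d: "d > 0" "\<And>P. finite P \<and> (\<forall>(p, q)\<in>P. a \<le> p \<and> p \<le> q \<and> q \<le> b) \<and>
        disjoint_family_on (\<lambda>(p, q). {p<..<q}) P \<and> (\<Sum>(p, q)\<in>P. q - p) < d \<Longrightarrow>
        (\<Sum>(p, q)\<in>P. norm (v q - v p)) < e"
    using v[unfolded abs_cont_on_def, rule_format, OF e(1)] by auto
  obtain d' where d': "d' > 0" "\<And>P. finite P \<and> (\<forall>(p, q)\<in>P. a \<le> p \<and> p \<le> q \<and> q \<le> b) \<and>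
        disjoint_family_on (\<lambda>(p, q). {p<..<q}) P \<and> (\<Sum>(p, q)\<in>P. q - p) < d' \<Longrightarrow>
        (\<Sum>(p, q)\<in>P. norm (v' q - v' p)) < e"
    using v'[unfolded abs_cont_on_def, rule_format, OF e(1)] by auto
  show "\<exists>\<delta>>0. \<forall>P. finite P \<and> (\<forall>(p, q)\<in>P. a \<le> p \<and> p \<le> q \<and> q \<le> b) \<and>
        disjoint_family_on (\<lambda>(p, q). {p<..<q}) P \<and> (\<Sum>(p, q)\<in>P. q - p) < \<delta> \<longrightarrow>
        (\<Sum>(p, q)\<in>P. norm (V q - V p)) < \<epsilon>"
  proof (intro exI[of _ "min d d'"] conjI allI impI)
    fix P assume P: "finite P \<and> (\<forall>(p, q)\<in>P. a \<le> p \<and> p \<le> q \<and> q \<le> b) \<and>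
        disjoint_family_on (\<lambda>(p, q). {p<..<q}) P \<and> (\<Sum>(p, q)\<in>P. q - p) < min d d'"
    have "(\<Sum>(p, q)\<in>P. norm (V q - V p)) \<le> (\<Sum>(p, q)\<in>P. C * (norm (v q - v p) + norm (v' q - v' p)))"
      using P le by (intro sum_mono) auto
    also have "\<dots> = C * ((\<Sum>(p, q)\<in>P. norm (v q - v p)) + (\<Sum>(p, q)\<in>P. norm (v' q - v' p)))"
      by (simp add: case_prod_unfold sum.distrib sum_distrib_left distrib_left)
    also have "\<dots> \<le> C * (e + e)"
      using d(2)[of P] d'(2)[of P] P \<open>C \<ge> 0\<close> by (intro mult_left_mono) auto
    also have "\<dots> < \<epsilon>" using e(2) by simp
    finally show "(\<Sum>(p, q)\<in>P. norm (V q - V p)) < \<epsilon>" .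
  qed (use d d' in auto)
qed

lemma abs_cont_on_Lipschitz:
  assumes "C \<ge> 0" "\<And>p q. a \<le> p \<Longrightarrow> p \<le> q \<Longrightarrow> q \<le> b \<Longrightarrow> norm (V q - V p) \<le> C * (q - p)"
  shows "abs_cont_on a b V"
proof -
  have id: "abs_cont_on a b (\<lambda>t::real. t)"
    unfolding abs_cont_on_def
  proof (intro allI impI)
    fix \<epsilon> :: real assume "\<epsilon> > 0"
    show "\<exists>\<delta>>0. \<forall>P. finite P \<and> (\<forall>(p, q)\<in>P. a \<le> p \<and> p \<le> q \<and> q \<le> b) \<and>
        disjoint_family_on (\<lambda>(p, q). {p<..<q}) P \<and> (\<Sum>(p, q)\<in>P. q - p) < \<delta> \<longrightarrow>
        (\<Sum>(p, q)\<in>P. norm (q - p)) < \<epsilon>"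
    proof (intro exI[of _ \<epsilon>] conjI allI impI \<open>\<epsilon> > 0\<close>)
      fix P :: "(real \<times> real) set" assume P: "finite P \<and> (\<forall>(p, q)\<in>P. a \<le> p \<and> p \<le> q \<and> q \<le> b) \<and>
        disjoint_family_on (\<lambda>(p, q). {p<..<q}) P \<and> (\<Sum>(p, q)\<in>P. q - p) < \<epsilon>"
      then have "(\<Sum>(p, q)\<in>P. norm (q - p)) = (\<Sum>(p, q)\<in>P. q - p)"
        by (intro sum.cong) auto
      then show "(\<Sum>(p, q)\<in>P. norm (q - p)) < \<epsilon>" using P by simp
    qed
  qed
  show ?thesis
  proof (rule abs_cont_on_control[OF id id assms(1)])
    fix p q assume *: "a \<le> p" "p \<le> q" "q \<le> b"
    have "C * (q - p) \<ge> 0" using * assms(1) by simp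
    then show "norm (V q - V p) \<le> C * (norm (q - p) + norm (q - p))"
      using assms(2)[OF *] * by (simp add: algebra_simps)
  qed
qed

lemma abs_cont_on_diff:
  assumes "abs_cont_on a b v" "abs_cont_on a b v'"
  shows "abs_cont_on a b (\<lambda>t. v t - v' t)"
proof (rule abs_cont_on_control[OF assms, of 1])
  fix p q
  have "v q - v' q - (v p - v' p) = (v q - v p) - (v' q - v' p)" by simp
  then show "norm (v q - v' q - (v p - v' p)) \<le> 1 * (norm (v q - v p) + norm (v' q - v' p))"
    by (metis mult_1 norm_triangle_ineq4)
qed simp

lemma abs_cont_on_subset:
  assumes "abs_cont_on a b v" "a \<le> a'" "b' \<le> b"
  shows "abs_cont_on a' b' v"
  unfolding abs_cont_on_def
proof (intro allI impI)
  fix \<epsilon> :: real assume "\<epsilon> > 0"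
  then obtain d where d: "d > 0" "\<forall>P. finite P \<and> (\<forall>(p, q)\<in>P. a \<le> p \<and> p \<le> q \<and> q \<le> b) \<and>
        disjoint_family_on (\<lambda>(p, q). {p<..<q}) P \<and> (\<Sum>(p, q)\<in>P. q - p) < d \<longrightarrow>
        (\<Sum>(p, q)\<in>P. norm (v q - v p)) < \<epsilon>"
    using assms(1)[unfolded abs_cont_on_def] by meson
  show "\<exists>\<delta>>0. \<forall>P. finite P \<and> (\<forall>(p, q)\<in>P. a' \<le> p \<and> p \<le> q \<and> q \<le> b') \<and>
        disjoint_family_on (\<lambda>(p, q). {p<..<q}) P \<and> (\<Sum>(p, q)\<in>P. q - p) < \<delta> \<longrightarrow>
        (\<Sum>(p, q)\<in>P. norm (v q - v p)) < \<epsilon>"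
    using d assms(2,3) by (intro exI[of _ d]) fastforce
qed

lemma abs_cont_on_shift:
  assumes "abs_cont_on (t0 + a) (t0 + b) v"
  shows "abs_cont_on a b (\<lambda>s. v (t0 + s))"
  unfolding abs_cont_on_def
proof (intro allI impI)
  fix \<epsilon> :: real assume "\<epsilon> > 0"
  then obtain d where d: "d > 0" "\<And>P. finite P \<and> (\<forall>(p, q)\<in>P. t0 + a \<le> p \<and> p \<le> q \<and> q \<le> t0 + b) \<and>
        disjoint_family_on (\<lambda>(p, q). {p<..<q}) P \<and> (\<Sum>(p, q)\<in>P. q - p) < d \<Longrightarrow>
        (\<Sum>(p, q)\<in>P. norm (v q - v p)) < \<epsilon>"
    using assms[unfolded abs_cont_on_def] by meson
  show "\<exists>\<delta>>0. \<forall>P. finite P \<and> (\<forall>(p, q)\<in>P. a \<le> p \<and> p \<le> q \<and> q \<le> b) \<and>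
        disjoint_family_on (\<lambda>(p, q). {p<..<q}) P \<and> (\<Sum>(p, q)\<in>P. q - p) < \<delta> \<longrightarrow>
        (\<Sum>(p, q)\<in>P. norm (v (t0 + q) - v (t0 + p))) < \<epsilon>"
  proof (intro exI[of _ d] conjI allI impI d(1))
    fix P :: "(real \<times> real) set" assume P: "finite P \<and> (\<forall>(p, q)\<in>P. a \<le> p \<and> p \<le> q \<and> q \<le> b) \<and>
        disjoint_family_on (\<lambda>(p, q). {p<..<q}) P \<and> (\<Sum>(p, q)\<in>P. q - p) < d"
    define h where "h = (\<lambda>(p, q). (t0 + p, t0 + q :: real))"
    have inj: "inj_on h P" by (auto simp: h_def inj_on_def)
    have "(\<Sum>(p, q)\<in>h ` P. norm (v q - v p)) < \<epsilon>"
    proof (rule d(2), intro conjI)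
      show "finite (h ` P)" using P by auto
      show "\<forall>(p, q)\<in>h ` P. t0 + a \<le> p \<and> p \<le> q \<and> q \<le> t0 + b" using P by (auto simp: h_def)
      show "disjoint_family_on (\<lambda>(p, q). {p<..<q}) (h ` P)"
        unfolding disjoint_family_on_def
      proof (intro ballI impI)
        fix m n assume "m \<in> h ` P" "n \<in> h ` P" "m \<noteq> n"
        then obtain p q p' q' where *: "(p, q) \<in> P" "(p', q') \<in> P" "m = (t0 + p, t0 + q)"
          "n = (t0 + p', t0 + q')" "(p, q) \<noteq> (p', q')"
          by (auto simp: h_def)
        then have "{p<..<q} \<inter> {p'<..<q'} = {}"
          using P unfolding disjoint_family_on_def by fastforce
        then show "(case m of (p, q) \<Rightarrow> {p<..<q}) \<inter> (case n of (p, q) \<Rightarrow> {p<..<q}) = {}"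
          using * by auto
      qed
      show "(\<Sum>(p, q)\<in>h ` P. q - p) < d"
        using P by (subst sum.reindex[OF inj]) (simp add: h_def case_prod_unfold)
    qed
    then show "(\<Sum>(p, q)\<in>P. norm (v (t0 + q) - v (t0 + p))) < \<epsilon>"
      by (subst (asm) sum.reindex[OF inj]) (simp add: h_def case_prod_unfold)
  qed
qed

lemma abs_cont_on_norm_squared:
  fixes e :: "real \<Rightarrow> 'a::real_inner"
  assumes "abs_cont_on a b e" "\<And>t. t \<in> {a..b} \<Longrightarrow> norm (e t) \<le> C" "C \<ge> 0"
  shows "abs_cont_on a b (\<lambda>t. (norm (e t))\<^sup>2)"
proof (rule abs_cont_on_control[OF assms(1,1) assms(3)])
  fix p q assume *: "a \<le> p" "p \<le> q" "q \<le> b"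
  have "(norm (e q))\<^sup>2 - (norm (e p))\<^sup>2 = (norm (e q) + norm (e p)) * (norm (e q) - norm (e p))"
    by (simp add: power2_eq_square algebra_simps)
  then have "norm ((norm (e q))\<^sup>2 - (norm (e p))\<^sup>2) = (norm (e q) + norm (e p)) * \<bar>norm (e q) - norm (e p)\<bar>"
    by (simp add: abs_mult)
  also have "\<dots> \<le> (C + C) * norm (e q - e p)"
    using * assms(2)[of p] assms(2)[of q] assms(3) by (intro mult_mono) (auto simp: norm_triangle_ineq3)
  finally show "norm ((norm (e q))\<^sup>2 - (norm (e p))\<^sup>2) \<le> C * (norm (e q - e p) + norm (e q - e p))"
    by (simp add: algebra_simps)
qed

lemma ae_ode_negligible:
  assumes "ae_ode S v g" "S \<in> sets lebesgue"
  obtains N where "negligible N" "\<And>t. t \<in> S - N \<Longrightarrow> (v has_vector_derivative g t) (at t)"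
proof -
  have "AE t in lebesgue. t \<in> S \<longrightarrow> (v has_vector_derivative g t) (at t)"
    using assms by (simp add: ae_ode_def AE_restrict_space_iff)
  then obtain N where "N \<in> null_sets lebesgue"
    "{t. \<not> (t \<in> S \<longrightarrow> (v has_vector_derivative g t) (at t))} \<subseteq> N"
    by (auto elim!: AE_E3 simp: eventually_ae_filter)
  then show ?thesis using that[of N] negligible_iff_null_sets by blast
qed

lemma ae_odeI:
  assumes "\<And>a b. a \<le> b \<Longrightarrow> {a..b} \<subseteq> S \<Longrightarrow> abs_cont_on a b v" "S \<in> sets lebesgue" "negligible N"
    "\<And>t. t \<in> S - N \<Longrightarrow> (v has_vector_derivative g t) (at t)"
  shows "ae_ode S v g"
proof -
  have "AE t in lebesgue. t \<notin> N"
    using assms(3) AE_not_in negligible_iff_null_sets by blast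
  then have "AE t in lebesgue. t \<in> S \<longrightarrow> (v has_vector_derivative g t) (at t)"
    using assms(4) by (auto elim!: eventually_mono)
  then show ?thesis using assms(1,2) by (simp add: ae_ode_def AE_restrict_space_iff)
qed

text \<open>The scalar inequality is applied to the component of \<open>v\<close> in the direction of \<open>v b - v a\<close>.\<close>
lemma abs_cont_norm_increment_le:
  fixes v :: "real \<Rightarrow> 'a::real_inner"
  assumes "a \<le> b" "abs_cont_on a b v" "negligible N" "B \<ge> 0"
    and deriv: "\<And>t. t \<in> {a<..<b} - N \<Longrightarrow> (v has_vector_derivative g t) (at t) \<and> norm (g t) \<le> B"
  shows "norm (v b - v a) \<le> B * (b - a)"
proof -
  define e where "e = sgn (v b - v a)"
  have e1: "norm e \<le> 1" by (simp add: e_def norm_sgn)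
  have "e \<bullet> v b - e \<bullet> v a \<le> B * b - B * a"
  proof (rule abs_cont_increment_le[OF assms(1) _ _ assms(3)])
    show "abs_cont_on a b (\<lambda>t. e \<bullet> v t)"
    proof (rule abs_cont_on_control[OF assms(2,2), of 1])
      fix p q
      have "norm (e \<bullet> v q - e \<bullet> v p) \<le> norm e * norm (v q - v p)"
        using Cauchy_Schwarz_ineq2[of e "v q - v p"] by (simp add: inner_diff_right)
      also have "\<dots> \<le> 1 * norm (v q - v p)" using e1 by (intro mult_right_mono) auto
      finally show "norm (e \<bullet> v q - e \<bullet> v p) \<le> 1 * (norm (v q - v p) + norm (v q - v p))"
        by (smt (verit) norm_ge_zero)
    qed simp
    show "mono_on {a..b} (\<lambda>t. B * t)" using assms(4) by (auto simp: mono_on_def mult_left_mono)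
    fix t assume "t \<in> {a<..<b} - N"
    then have g: "(v has_vector_derivative g t) (at t)" "norm (g t) \<le> B" using deriv by auto
    have "((\<lambda>t. e \<bullet> v t) has_vector_derivative (e \<bullet> g t)) (at t)"
      by (rule bounded_linear.has_vector_derivative[OF bounded_linear_inner_right g(1)])
    moreover have "((\<lambda>t. B * t) has_vector_derivative B) (at t)"
      by (auto intro!: derivative_eq_intros simp: has_real_derivative_iff_has_vector_derivative[symmetric])
    moreover have "e \<bullet> g t \<le> B"
      using norm_cauchy_schwarz[of e "g t"] mult_mono[OF e1 g(2)] assms(4) by simp
    ultimately show "\<exists>v' \<phi>'. ((\<lambda>t. e \<bullet> v t) has_vector_derivative v') (at t) \<and>
        ((\<lambda>t. B * t) has_vector_derivative \<phi>') (at t) \<and> v' \<le> \<phi>'" by blast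
  qed
  moreover have "sgn w \<bullet> w = norm w" for w :: 'a
    by (cases "w = 0") (simp_all add: sgn_div_norm dot_square_norm power2_eq_square)
  then have "e \<bullet> v b - e \<bullet> v a = norm (v b - v a)"
    by (simp only: e_def inner_diff_right[symmetric])
  ultimately show ?thesis by (simp add: algebra_simps)
qed

section \<open>Gronwall estimates with memory\<close>

definition growth_const :: "real \<Rightarrow> real \<Rightarrow> real" where
  "growth_const c T = 2 * exp ((4 * c + 1) * T) * (1 + 2 * c * T + 2 * T)"

lemma growth_const_mono: "c \<ge> 0 \<Longrightarrow> 0 \<le> s \<Longrightarrow> s \<le> T \<Longrightarrow> growth_const c s \<le> growth_const c T"
  unfolding growth_const_def by (intro mult_mono add_mono) (auto intro!: mult_left_mono)

lemma growth_const_ge_1: "c \<ge> 0 \<Longrightarrow> 0 \<le> T \<Longrightarrow> growth_const c T \<ge> 1"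
  using growth_const_mono[of c 0 T] by (simp add: growth_const_def)

text \<open>
  The hypothesis on the rate bounds \<open>e t \<bullet> g t\<close> by the supremum of \<open>e\<close> over the whole past; quantifying over
  all bounds \<open>B\<close> of the past avoids naming this supremum. Let \<open>W\<close> be the supremum of
  \<open>exp(- la t) |e(t)|\<^sup>2\<close>. Then \<open>|e|\<^sup>2\<close> is at most \<open>m\<^sup>2 + exp(la s) W\<close> up to time \<open>s\<close>, and integrating this
  bound reproduces \<open>W\<close> with the factor \<open>2 c / la\<close>. The choice of \<open>la\<close> makes this factor at most one half, so \<open>W\<close>
  can be absorbed. The squared norm is used because one-sided Lipschitz conditions control exactly
  its derivative.
\<close>
lemma gronwall_history:
  fixes e g :: "real \<Rightarrow> 'a::real_inner"
  assumes "r \<ge> 0" "T \<ge> 0" and cont: "continuous_on {-r..T} e" and ac: "abs_cont_on 0 T e"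
    and N: "negligible N"
    and deriv: "\<And>t. t \<in> {0<..<T} - N \<Longrightarrow> (e has_vector_derivative g t) (at t)"
    and init: "\<And>\<theta>. \<theta> \<in> {-r..0} \<Longrightarrow> norm (e \<theta>) \<le> m"
    and "c \<ge> 0" "\<eta> \<ge> 0"
    and rate: "\<And>t B. t \<in> {0<..<T} \<Longrightarrow> (\<And>s. s \<in> {-r..t} \<Longrightarrow> norm (e s) \<le> B) \<Longrightarrow>
      e t \<bullet> g t \<le> c * B\<^sup>2 + \<eta>"
    and t: "t \<in> {-r..T}"
  shows "(norm (e t))\<^sup>2 \<le> growth_const c T * (m\<^sup>2 + \<eta>)"
proof -
  define la where "la = 4 * c + 1"
  have la: "la > 0" "2 * c \<le> la / 2" using \<open>c \<ge> 0\<close> by (auto simp: la_def)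
  define V where "V t = (norm (e t))\<^sup>2" for t
  have m0: "m \<ge> 0" using init[of 0] \<open>r \<ge> 0\<close> order.trans[OF norm_ge_zero[of "e 0"]] by auto
  have cV: "continuous_on {-r..T} V" unfolding V_def by (intro continuous_intros cont)
  have "continuous_on {0..T} (\<lambda>t. exp (- la * t) * V t)"
    using \<open>r \<ge> 0\<close> by (intro continuous_intros continuous_on_subset[OF cV]) auto
  then obtain t1 where t1: "t1 \<in> {0..T}"
    "\<And>t. t \<in> {0..T} \<Longrightarrow> exp (- la * t) * V t \<le> exp (- la * t1) * V t1"
    using continuous_attains_sup[of "{0..T}" "\<lambda>t. exp (- la * t) * V t"] \<open>T \<ge> 0\<close> by auto
  define W where "W = exp (- la * t1) * V t1"
  have W0: "W \<ge> 0" by (simp add: W_def V_def)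
  have VW: "V t \<le> exp (la * t) * W" if "t \<in> {0..T}" for t
    using t1(2)[OF that] by (simp add: W_def exp_minus field_simps)
  have Vm: "V \<theta> \<le> m\<^sup>2" if "\<theta> \<in> {-r..0}" for \<theta>
    using init[OF that] unfolding V_def by (intro power_mono) auto
  define \<phi> where "\<phi> t = (2 * c * m\<^sup>2 + 2 * \<eta>) * t + 2 * c * W / la * exp (la * t)" for t
  have step: "V t \<le> m\<^sup>2 + (2 * c * m\<^sup>2 + 2 * \<eta>) * T + W / 2 * exp (la * t)" if t: "t \<in> {0..T}" for t
  proof -
    have "continuous_on {0..t} e"
      using t \<open>r \<ge> 0\<close> by (intro continuous_on_subset[OF cont]) auto
    then have "bounded (e ` {0..t})"
      using compact_continuous_image compact_imp_bounded by blast
    then obtain C where C: "\<And>s. s \<in> {0..t} \<Longrightarrow> norm (e s) \<le> C"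
      unfolding bounded_iff by blast
    have "V t - V 0 \<le> \<phi> t - \<phi> 0"
    proof (rule abs_cont_increment_le[OF _ _ _ N])
      show "abs_cont_on 0 t V"
        unfolding V_def using t C order.trans[OF norm_ge_zero C[of 0]]
        by (intro abs_cont_on_norm_squared[of _ _ _ C] abs_cont_on_subset[OF ac]) auto
      show "mono_on {0..t} \<phi>"
        unfolding mono_on_def \<phi>_def using la W0 \<open>c \<ge> 0\<close> \<open>\<eta> \<ge> 0\<close>
        by (auto intro!: add_mono mult_left_mono divide_right_mono)
      fix s assume s: "s \<in> {0<..<t} - N"
      have "((\<lambda>t. e t \<bullet> e t) has_vector_derivative (e s \<bullet> g s + g s \<bullet> e s)) (at s)"
        using deriv[of s] s t
        by (intro bounded_bilinear.has_vector_derivative[OF bounded_bilinear_inner]) auto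
      then have 1: "(V has_vector_derivative (2 * (e s \<bullet> g s))) (at s)"
        by (simp add: V_def[abs_def] dot_square_norm inner_commute)
      have 2: "(\<phi> has_vector_derivative (2 * (c * m\<^sup>2 + \<eta>) + 2 * c * W * exp (la * s))) (at s)"
        unfolding \<phi>_def using la(1)
        by (auto intro!: derivative_eq_intros simp: has_real_derivative_iff_has_vector_derivative[symmetric])
      have "e s \<bullet> g s \<le> c * (sqrt (m\<^sup>2 + exp (la * s) * W))\<^sup>2 + \<eta>"
      proof (rule rate)
        fix s' assume s': "s' \<in> {-r..s}"
        have "V s' \<le> m\<^sup>2 + exp (la * s) * W"
        proof (cases "s' \<le> 0")
          case True
          then show ?thesis using Vm[of s'] s' W0 by (smt (verit) atLeastAtMost_iff exp_ge_zero mult_nonneg_nonneg)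
        next
          case False
          then have "V s' \<le> exp (la * s') * W" using VW s' s t by auto
          also have "\<dots> \<le> exp (la * s) * W" using s' la W0 by (intro mult_right_mono) auto
          finally show ?thesis by (smt (verit) zero_le_power2)
        qed
        then show "norm (e s') \<le> sqrt (m\<^sup>2 + exp (la * s) * W)"
          unfolding V_def by (rule real_le_rsqrt)
      qed (use s t in auto)
      then have 3: "2 * (e s \<bullet> g s) \<le> 2 * (c * m\<^sup>2 + \<eta>) + 2 * c * W * exp (la * s)"
        using W0 by (simp add: algebra_simps)
      show "\<exists>v' \<phi>'. (V has_vector_derivative v') (at s) \<and> (\<phi> has_vector_derivative \<phi>') (at s) \<and> v' \<le> \<phi>'"
        using 1 2 3 by blast
    qed (use t in auto)
    moreover have "V 0 \<le> m\<^sup>2" using Vm[of 0] \<open>r \<ge> 0\<close> by auto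
    moreover have "(2 * c * m\<^sup>2 + 2 * \<eta>) * t \<le> (2 * c * m\<^sup>2 + 2 * \<eta>) * T"
      using t \<open>c \<ge> 0\<close> \<open>\<eta> \<ge> 0\<close> by (intro mult_left_mono) auto
    moreover have "2 * c * W / la * exp (la * t) \<le> W / 2 * exp (la * t)"
    proof (intro mult_right_mono)
      have "2 * c * W \<le> la / 2 * W" using la(2) W0 by (rule mult_right_mono)
      then show "2 * c * W / la \<le> W / 2" using la(1) by (simp add: field_simps)
    qed auto
    moreover have "\<phi> 0 \<ge> 0" unfolding \<phi>_def using la W0 \<open>c \<ge> 0\<close> by simp
    ultimately show ?thesis unfolding \<phi>_def by linarith
  qed
  define Q where "Q = m\<^sup>2 + (2 * c * m\<^sup>2 + 2 * \<eta>) * T"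
  have Q0: "Q \<ge> 0" unfolding Q_def using \<open>c \<ge> 0\<close> \<open>\<eta> \<ge> 0\<close> \<open>T \<ge> 0\<close> by auto
  have "exp (- la * t1) * V t1 \<le> exp (- la * t1) * (Q + W / 2 * exp (la * t1))"
    using step[OF t1(1)] by (intro mult_left_mono) (auto simp: Q_def W_def)
  also have "\<dots> = exp (- la * t1) * Q + W / 2 * (exp (- la * t1) * exp (la * t1))"
    by (simp add: algebra_simps)
  also have "\<dots> \<le> 1 * Q + W / 2 * 1"
    using t1(1) la(1) Q0 W0 by (intro add_mono mult_right_mono mult_left_mono) (auto simp: exp_add[symmetric])
  finally have WQ: "W \<le> 2 * Q" by (simp add: W_def)
  have QK: "2 * Q * exp (la * T) \<le> growth_const c T * (m\<^sup>2 + \<eta>)"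
  proof -
    have "Q \<le> (1 + 2 * c * T + 2 * T) * (m\<^sup>2 + \<eta>)"
      using \<open>c \<ge> 0\<close> \<open>\<eta> \<ge> 0\<close> \<open>T \<ge> 0\<close> by (simp add: Q_def algebra_simps)
    then have "2 * exp (la * T) * Q \<le> 2 * exp (la * T) * ((1 + 2 * c * T + 2 * T) * (m\<^sup>2 + \<eta>))"
      by (intro mult_left_mono) auto
    then show ?thesis by (simp add: growth_const_def la_def algebra_simps)
  qed
  show ?thesis
  proof (cases "t \<le> 0")
    case True
    have "m\<^sup>2 \<le> growth_const c T * (m\<^sup>2 + \<eta>)"
      using mult_mono[OF growth_const_ge_1[OF \<open>c \<ge> 0\<close> \<open>T \<ge> 0\<close>], of "m\<^sup>2" "m\<^sup>2 + \<eta>"] \<open>\<eta> \<ge> 0\<close>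
        growth_const_ge_1[OF \<open>c \<ge> 0\<close> \<open>T \<ge> 0\<close>] by auto
    then show ?thesis using Vm[of t] True t by (simp add: V_def)
  next
    case False
    then have "V t \<le> exp (la * t) * W" using VW t by auto
    also have "\<dots> \<le> exp (la * T) * (2 * Q)"
      using WQ t la(1) W0 by (intro mult_mono) auto
    finally show ?thesis using QK by (simp add: V_def algebra_simps)
  qed
qed

lemma delay_sol_abs_cont: "delay_sol r x0 g x \<Longrightarrow> 0 \<le> a \<Longrightarrow> a \<le> b \<Longrightarrow> abs_cont_on a b x"
  unfolding delay_sol_def ae_ode_def by auto

lemma delay_sol_cont: "delay_sol r x0 g x \<Longrightarrow> A \<subseteq> {-r..} \<Longrightarrow> continuous_on A x"
  unfolding delay_sol_def by (auto elim: continuous_on_subset)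

lemma delay_sol_deriv:
  assumes "delay_sol r x0 g x"
  obtains N where "negligible N" "\<And>t. t \<ge> 0 \<Longrightarrow> t \<notin> N \<Longrightarrow> (x has_vector_derivative g t) (at t)"
proof -
  have "ae_ode {0..} x g" using assms by (simp add: delay_sol_def)
  then show ?thesis by (rule ae_ode_negligible) (auto intro: that)
qed

text \<open>
  The one-sided Lipschitz constant is available on a bounded set only, namely as long as \<open>z\<close> stays within
  distance 1 of \<open>z'\<close>. At the first time at which the distance reaches 1 the Gronwall estimate would still
  hold, and it gives a distance below 1; so that time does not occur.
\<close>
lemma one_sided_dependence:
  fixes z z' :: "real \<Rightarrow> 'a::real_inner"
  assumes "r \<ge> 0" "T \<ge> 0" and z: "delay_sol r z0 (\<lambda>t. G t (hist r z t)) z"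
    and z': "delay_sol r z0 g' z'"
    and "c \<ge> 0" "\<eta> \<ge> 0"
    and oneside: "\<And>t \<phi> \<psi>. t \<in> {0<..<T} \<Longrightarrow> \<phi> \<in> C0 r \<Longrightarrow> \<psi> \<in> C0 r \<Longrightarrow> norm \<phi> \<le> B + 1 \<Longrightarrow> norm \<psi> \<le> B + 1 \<Longrightarrow>
      (\<phi> 0 - \<psi> 0) \<bullet> (G t \<phi> - G t \<psi>) \<le> c * (norm (\<phi> - \<psi>))\<^sup>2"
    and bound: "\<And>s. s \<in> {-r..T} \<Longrightarrow> norm (z' s) \<le> B"
    and defect: "\<And>t. t \<in> {0<..<T} \<Longrightarrow> norm (G t (hist r z' t) - g' t) \<le> \<eta>"
    and small: "growth_const c T * \<eta> < 1"
    and t: "t \<in> {-r..T}"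
  shows "(norm (z t - z' t))\<^sup>2 \<le> growth_const c T * \<eta>"
proof -
  define e where "e t = z t - z' t" for t
  define g where "g t = G t (hist r z t) - g' t" for t
  have cz: "continuous_on {p..q} z" "continuous_on {p..q} z'" if "p \<ge> -r" for p q
    using delay_sol_cont[OF z] delay_sol_cont[OF z'] that by auto
  obtain N where N: "negligible N"
    "\<And>t. t \<ge> 0 \<Longrightarrow> t \<notin> N \<Longrightarrow> (z has_vector_derivative (G t (hist r z t))) (at t)"
    by (rule delay_sol_deriv[OF z]) blast
  obtain N' where N': "negligible N'" "\<And>t. t \<ge> 0 \<Longrightarrow> t \<notin> N' \<Longrightarrow> (z' has_vector_derivative g' t) (at t)"
    by (rule delay_sol_deriv[OF z']) blast
  have init: "norm (e \<theta>) \<le> 0" if "\<theta> \<in> {-r..0}" for \<theta>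
    using z z' that by (simp add: e_def delay_sol_def)
  have gron: "(norm (e t))\<^sup>2 \<le> growth_const c s * \<eta>"
    if s: "0 \<le> s" "s \<le> T" "\<And>t. t \<in> {0..<s} \<Longrightarrow> norm (e t) \<le> 1" and t: "t \<in> {-r..s}" for s t
  proof -
    have "(norm (e t))\<^sup>2 \<le> growth_const c s * (0\<^sup>2 + \<eta>)"
    proof (rule gronwall_history[OF \<open>r \<ge> 0\<close> s(1) _ _ negligible_Un[OF N(1) N'(1)] _ init \<open>c \<ge> 0\<close> \<open>\<eta> \<ge> 0\<close> _ t])
      show "continuous_on {-r..s} e" unfolding e_def by (intro continuous_intros cz) auto
      show "abs_cont_on 0 s e"
        unfolding e_def using delay_sol_abs_cont[OF z] delay_sol_abs_cont[OF z'] s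
        by (intro abs_cont_on_diff) auto
      show "(e has_vector_derivative g t) (at t)" if "t \<in> {0<..<s} - (N \<union> N')" for t
        unfolding e_def g_def using N N' that by (intro has_vector_derivative_diff) auto
      fix t B' assume t: "t \<in> {0<..<s}" and B': "\<And>s'. s' \<in> {-r..t} \<Longrightarrow> norm (e s') \<le> B'"
      have e1: "norm (e s') \<le> 1" if "s' \<in> {-r..t}" for s'
        using init[of s'] s(3)[of s'] that t by (cases "s' \<le> 0") auto
      have cz': "continuous_on {t-r..t} z" "continuous_on {t-r..t} z'" using cz t by auto
      have C0: "hist r z t \<in> C0 r" "hist r z' t \<in> C0 r"
        using hist_in_C0 cz' \<open>r \<ge> 0\<close> by auto
      have "norm (hist r z' t) \<le> B"
        using t s by (intro hist_norm_le cz' \<open>r \<ge> 0\<close> bound) auto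
      moreover have "norm (hist r z t - hist r z' t) \<le> 1"
        using t e1 by (intro hist_diff_le cz' \<open>r \<ge> 0\<close>) (auto simp: e_def)
      ultimately have nb: "norm (hist r z' t) \<le> B + 1" "norm (hist r z t) \<le> B + 1"
        using norm_triangle_sub[of "hist r z t" "hist r z' t"] by linarith+
      have h0: "hist r z t 0 = z t" "hist r z' t 0 = z' t"
        using hist_apply[OF \<open>r \<ge> 0\<close> cz'(1), of 0] hist_apply[OF \<open>r \<ge> 0\<close> cz'(2), of 0] \<open>r \<ge> 0\<close> by auto
      have hd: "norm (hist r z t - hist r z' t) \<le> B'"
        using t B' by (intro hist_diff_le cz' \<open>r \<ge> 0\<close>) (auto simp: e_def)
      have "e t \<bullet> g t = e t \<bullet> (G t (hist r z t) - G t (hist r z' t)) + e t \<bullet> (G t (hist r z' t) - g' t)"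
        by (simp add: g_def inner_add_right[symmetric])
      also have "e t \<bullet> (G t (hist r z t) - G t (hist r z' t)) \<le> c * (norm (hist r z t - hist r z' t))\<^sup>2"
        using oneside[of t "hist r z t" "hist r z' t"] C0 nb h0 t s by (simp add: e_def)
      also have "\<dots> \<le> c * B'\<^sup>2"
        using hd \<open>c \<ge> 0\<close> by (intro mult_left_mono power_mono) auto
      also have "e t \<bullet> (G t (hist r z' t) - g' t) \<le> norm (e t) * norm (G t (hist r z' t) - g' t)"
        by (rule norm_cauchy_schwarz)
      also have "\<dots> \<le> 1 * \<eta>"
        using e1[of t] defect[of t] t s \<open>r \<ge> 0\<close> by (intro mult_mono) auto
      finally show "e t \<bullet> g t \<le> c * B'\<^sup>2 + \<eta>" by simp
    qed
    then show ?thesis by simp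
  qed
  have small_e: "norm (e t) < 1" if t: "t \<in> {0..T}" for t
  proof (rule ccontr)
    assume "\<not> norm (e t) < 1"
    define S where "S = {s \<in> {0..T}. 1 \<le> norm (e s)}"
    have "continuous_on {0..T} e" unfolding e_def using \<open>r \<ge> 0\<close> by (intro continuous_intros cz) auto
    then have "closed S" unfolding S_def
      by (intro continuous_closed_preimage_constant continuous_on_closed_Collect_le continuous_intros) auto
    moreover have "bounded S" unfolding S_def by (rule bounded_subset[of "{0..T}"]) auto
    ultimately have "compact S" by (simp add: compact_eq_bounded_closed)
    moreover have "S \<noteq> {}" using \<open>\<not> norm (e t) < 1\<close> t by (auto simp: S_def)
    ultimately obtain s where s: "s \<in> S" "\<And>s'. s' \<in> S \<Longrightarrow> s \<le> s'"
      using compact_attains_inf by metis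
    have sT: "0 \<le> s" "s \<le> T" "1 \<le> norm (e s)" using s(1) by (auto simp: S_def)
    have "(norm (e s))\<^sup>2 \<le> growth_const c s * \<eta>"
    proof (rule gron[OF sT(1,2)])
      fix t assume "t \<in> {0..<s}"
      then show "norm (e t) \<le> 1" using s(2)[of t] sT by (force simp: S_def)
    qed (use sT \<open>r \<ge> 0\<close> in auto)
    also have "\<dots> \<le> growth_const c T * \<eta>"
      using growth_const_mono[OF \<open>c \<ge> 0\<close> sT(1,2)] \<open>\<eta> \<ge> 0\<close> by (rule mult_right_mono)
    also have "\<dots> < 1" by (rule small)
    finally show False using sT(3) by (simp add: power_less_one_iff abs_square_less_1)
  qed
  show ?thesis using gron[OF \<open>T \<ge> 0\<close> order.refl _ t] small_e by (fastforce simp: e_def)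
qed

section \<open>Causality and continuous dependence on inputs\<close>

text \<open>All inputs of the vector field are gathered in one argument ranging over \<open>Y\<close>.\<close>
definition one_sided_Lipschitz ::
  "real \<Rightarrow> 'b::metric_space set \<Rightarrow> ((real \<Rightarrow>\<^sub>C 'a::real_inner) \<times> 'b \<Rightarrow> 'a) \<Rightarrow> bool" where
  "one_sided_Lipschitz r Y G \<longleftrightarrow> (\<forall>S \<subseteq> C0 r \<times> Y. bounded S \<longrightarrow>
     (\<exists>L\<ge>0. \<forall>\<phi> \<psi> v. (\<phi>, v) \<in> S \<and> (\<psi>, v) \<in> S \<longrightarrow>
        (apply_bcontfun \<phi> 0 - apply_bcontfun \<psi> 0) \<bullet> (G (\<phi>, v) - G (\<psi>, v)) \<le> L * (norm (\<phi> - \<psi>))\<^sup>2))"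

lemma one_sided_LipschitzE:
  fixes G :: "(real \<Rightarrow>\<^sub>C 'a::real_inner) \<times> 'b::metric_space \<Rightarrow> 'a"
  assumes "one_sided_Lipschitz r Y G" "V \<subseteq> Y" "bounded V"
  obtains L where "L \<ge> 0" "\<And>\<phi> \<psi> v. \<phi> \<in> C0 r \<Longrightarrow> \<psi> \<in> C0 r \<Longrightarrow> v \<in> V \<Longrightarrow> norm \<phi> \<le> B \<Longrightarrow> norm \<psi> \<le> B \<Longrightarrow>
    (\<phi> 0 - \<psi> 0) \<bullet> (G (\<phi>, v) - G (\<psi>, v)) \<le> L * (norm (\<phi> - \<psi>))\<^sup>2"
proof -
  define S :: "((real \<Rightarrow>\<^sub>C 'a) \<times> 'b) set" where "S = (C0 r \<inter> cball 0 B) \<times> V"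
  have "bounded S" unfolding S_def
    by (intro bounded_Times assms bounded_subset[OF bounded_cball]) auto
  moreover have "S \<subseteq> C0 r \<times> Y" using assms(2) by (auto simp: S_def)
  ultimately obtain L where "L \<ge> 0" "\<forall>\<phi> \<psi> v. (\<phi>, v) \<in> S \<and> (\<psi>, v) \<in> S \<longrightarrow>
      (\<phi> 0 - \<psi> 0) \<bullet> (G (\<phi>, v) - G (\<psi>, v)) \<le> L * (norm (\<phi> - \<psi>))\<^sup>2"
    using assms(1) unfolding one_sided_Lipschitz_def by meson
  then show ?thesis using that[of L] by (auto simp: S_def)
qed

lemma bounded_continuous_real:
  fixes z :: "real \<Rightarrow> 'a::real_normed_vector"
  assumes "continuous_on {a..b} z"
  obtains B where "B \<ge> 0" "\<And>s. s \<in> {a..b} \<Longrightarrow> norm (z s) \<le> B"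
proof -
  have "bounded (z ` {a..b})"
    using assms compact_continuous_image compact_imp_bounded by blast
  then obtain B where "\<forall>s\<in>{a..b}. norm (z s) \<le> B" by (auto simp: bounded_iff)
  then show ?thesis using that[of "max B 0"] by (fastforce simp: le_max_iff_disj)
qed

text \<open>
  Inputs that agree before \<open>T\<close> give solutions that agree up to and including \<open>T\<close>. Values at \<open>T\<close>
  are deliberately left free: sampled inputs jump there.
\<close>
lemma delay_sol_causal:
  fixes z z' :: "real \<Rightarrow> 'a::real_inner"
  assumes "r \<ge> 0" and G: "one_sided_Lipschitz r Y G"
    and z: "delay_sol r z0 (\<lambda>t. G (hist r z t, v t)) z"
    and z': "delay_sol r z0 (\<lambda>t. G (hist r z' t, v' t)) z'"
    and V: "v ` {0<..<T} \<subseteq> Y" "bounded (v ` {0<..<T})"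
    and eq: "\<And>t. t \<in> {0<..<T} \<Longrightarrow> v t = v' t"
    and t: "t \<in> {-r..T}"
  shows "z t = z' t"
proof (cases "t \<le> 0")
  case True
  then show ?thesis using z z' t by (simp add: delay_sol_def)
next
  case False
  then have "T \<ge> 0" using t by auto
  obtain B where B: "\<And>s. s \<in> {-r..T} \<Longrightarrow> norm (z' s) \<le> B"
    using bounded_continuous_real[OF delay_sol_cont[OF z']] by (metis atLeastAtMost_iff atLeast_iff subsetI)
  obtain L where L: "L \<ge> 0" "\<And>\<phi> \<psi> v'. \<phi> \<in> C0 r \<Longrightarrow> \<psi> \<in> C0 r \<Longrightarrow> v' \<in> v ` {0<..<T} \<Longrightarrow>
      norm \<phi> \<le> B + 1 \<Longrightarrow> norm \<psi> \<le> B + 1 \<Longrightarrow>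
    (\<phi> 0 - \<psi> 0) \<bullet> (G (\<phi>, v') - G (\<psi>, v')) \<le> L * (norm (\<phi> - \<psi>))\<^sup>2"
    by (rule one_sided_LipschitzE[OF G V, of "B + 1"]) blast
  have "(norm (z t - z' t))\<^sup>2 \<le> growth_const L T * 0"
    by (rule one_sided_dependence[OF \<open>r \<ge> 0\<close> \<open>T \<ge> 0\<close>, where G = "\<lambda>t \<phi>. G (\<phi>, v t)", OF z z' L(1) _ L(2) B])
      (use t eq in auto)
  then show ?thesis by simp
qed

text \<open>
  Along the fixed solution \<open>z\<close> the field \<open>G\<close> is uniformly continuous in the input, since the histories of \<open>z\<close>
  on \<open>[0, T]\<close> form a compact set. A uniformly small change of the input is therefore a uniformly small
  defect of \<open>z\<close> as a solution of the perturbed equation. As \<open>G\<close> is only continuous in its input, the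
  estimate is qualitative.
\<close>
lemma delay_sol_continuous_dependence:
  fixes z :: "real \<Rightarrow> 'a::real_inner" and v :: "real \<Rightarrow> 'b::euclidean_space"
  assumes "r \<ge> 0" "T \<ge> 0" and G: "one_sided_Lipschitz r UNIV G"
    and Gcont: "continuous_on (C0 r \<times> UNIV) G"
    and z: "delay_sol r z0 (\<lambda>t. G (hist r z t, v t)) z"
    and V: "bounded (v ` {0<..<T})"
    and "\<epsilon> > 0"
  obtains \<delta> where "\<delta> > 0" "\<And>z' v' t. delay_sol r z0 (\<lambda>t. G (hist r z' t, v' t)) z' \<Longrightarrow>
    (\<And>t. t \<in> {0<..<T} \<Longrightarrow> norm (v' t - v t) \<le> \<delta>) \<Longrightarrow> t \<in> {-r..T} \<Longrightarrow> norm (z' t - z t) \<le> \<epsilon>"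
proof -
  have cz: "continuous_on {-r..T} z" by (rule delay_sol_cont[OF z]) auto
  obtain B where B: "\<And>s. s \<in> {-r..T} \<Longrightarrow> norm (z s) \<le> B"
    using bounded_continuous_real[OF cz] by blast
  obtain Vb where Vb: "\<And>t. t \<in> {0<..<T} \<Longrightarrow> norm (v t) \<le> Vb"
    using V unfolding bounded_iff by blast
  define K where "K = cball (0::'b) (Vb + 1)"
  obtain L where L: "L \<ge> 0" "\<And>\<phi> \<psi> v'. \<phi> \<in> C0 r \<Longrightarrow> \<psi> \<in> C0 r \<Longrightarrow> v' \<in> K \<Longrightarrow>
      norm \<phi> \<le> B + 1 \<Longrightarrow> norm \<psi> \<le> B + 1 \<Longrightarrow>
    (\<phi> 0 - \<psi> 0) \<bullet> (G (\<phi>, v') - G (\<psi>, v')) \<le> L * (norm (\<phi> - \<psi>))\<^sup>2"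
    by (rule one_sided_LipschitzE[OF G, of K "B + 1"]) (auto simp: K_def)
  define gc where "gc = growth_const L T"
  have gc: "gc \<ge> 1" unfolding gc_def using L(1) \<open>T \<ge> 0\<close> by (rule growth_const_ge_1)
  define \<eta> where "\<eta> = min (1/2) (\<epsilon>\<^sup>2) / gc"
  have \<eta>: "\<eta> > 0" "gc * \<eta> < 1" "gc * \<eta> \<le> \<epsilon>\<^sup>2" using gc \<open>\<epsilon> > 0\<close> by (auto simp: \<eta>_def)
  define H where "H = hist r z ` {0..T} \<times> K"
  have "continuous_on {0..T} (hist r z)"
    using cz \<open>r \<ge> 0\<close> by (intro continuous_on_hist) auto
  then have "compact H" unfolding H_def K_def by (intro compact_Times compact_continuous_image) auto
  moreover have HC: "hist r z t \<in> C0 r" if "t \<in> {0..T}" for t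
    using that \<open>r \<ge> 0\<close> by (intro hist_in_C0 continuous_on_subset[OF cz]) auto
  then have "continuous_on H G"
    by (intro continuous_on_subset[OF Gcont]) (auto simp: H_def)
  ultimately have "uniformly_continuous_on H G" by (rule compact_uniformly_continuous[rotated])
  then obtain d where d: "d > 0" "\<And>x x'. x \<in> H \<Longrightarrow> x' \<in> H \<Longrightarrow> dist x' x < d \<Longrightarrow> dist (G x') (G x) < \<eta>"
    unfolding uniformly_continuous_on_def using \<eta>(1) by metis
  define \<delta> where "\<delta> = min 1 (d / 2)"
  show ?thesis
  proof (rule that[of \<delta>])
    show "\<delta> > 0" using d(1) by (simp add: \<delta>_def)
    fix z' v' t assume z': "delay_sol r z0 (\<lambda>t. G (hist r z' t, v' t)) z'"
      and v': "\<And>t. t \<in> {0<..<T} \<Longrightarrow> norm (v' t - v t) \<le> \<delta>" and t: "t \<in> {-r..T}"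
    have vK: "v' t \<in> K" "v t \<in> K" if "t \<in> {0<..<T}" for t
      using Vb[OF that] v'[OF that] norm_triangle_sub[of "v' t" "v t"] by (auto simp: K_def \<delta>_def)
    have "(norm (z' t - z t))\<^sup>2 \<le> growth_const L T * \<eta>"
    proof (rule one_sided_dependence[OF \<open>r \<ge> 0\<close> \<open>T \<ge> 0\<close>, where G = "\<lambda>t \<phi>. G (\<phi>, v' t)", OF z' z L(1) _ L(2) B])
      fix t assume t: "t \<in> {0<..<T}"
      have "dist (hist r z t, v' t) (hist r z t, v t) < d"
        using v'[OF t] d(1) by (simp add: dist_Pair_Pair dist_norm \<delta>_def)
      then show "norm (G (hist r z t, v' t) - G (hist r z t, v t)) \<le> \<eta>"
        using d(2)[of "(hist r z t, v t)" "(hist r z t, v' t)"] vK[OF t] t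
        by (auto simp: H_def dist_norm)
    qed (use \<eta> t vK in \<open>auto simp: gc_def\<close>)
    also have "\<dots> \<le> \<epsilon>\<^sup>2" using \<eta> by (simp add: gc_def)
    finally show "norm (z' t - z t) \<le> \<epsilon>" using \<open>\<epsilon> > 0\<close> by (simp add: power2_le_iff_abs_le)
  qed
qed

section \<open>Fixed points of causal operators\<close>

definition bounded_paths :: "real \<Rightarrow> real \<Rightarrow> real \<Rightarrow> (real \<Rightarrow> 'b::real_normed_vector) set" where
  "bounded_paths p q B = {v. continuous_on {p..q} v \<and> (\<forall>t\<in>{p..q}. norm (v t) \<le> B)}"

text \<open>
  Tonelli's method. Delaying the output of \<open>\<Phi>\<close> by \<open>\<epsilon>\<close> produces an operator for which \<open>n\<close> iterations determine
  the path up to time \<open>p + n \<epsilon>\<close>, so iteration reaches an exact fixed point after finitely many steps. As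
  \<open>\<epsilon>\<close> tends to 0 these fixed points are uniformly bounded and equi-Lipschitz. By Arzela-Ascoli a
  subsequence converges, and the limit is a fixed point of \<open>\<Phi>\<close> by continuity.
\<close>
lemma causal_fixed_point:
  fixes \<Phi> :: "(real \<Rightarrow> 'b::euclidean_space) \<Rightarrow> real \<Rightarrow> 'b"
  assumes "p < q" "norm w0 \<le> B"
    and init: "\<And>v. v \<in> bounded_paths p q B \<Longrightarrow> \<Phi> v p = w0"
    and bound: "\<And>v t. v \<in> bounded_paths p q B \<Longrightarrow> t \<in> {p..q} \<Longrightarrow> norm (\<Phi> v t) \<le> B"
    and Lip: "\<And>v s t. v \<in> bounded_paths p q B \<Longrightarrow> s \<in> {p..q} \<Longrightarrow> t \<in> {p..q} \<Longrightarrow> norm (\<Phi> v s - \<Phi> v t) \<le> K * \<bar>s - t\<bar>"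
    and causal: "\<And>v v' t. v \<in> bounded_paths p q B \<Longrightarrow> v' \<in> bounded_paths p q B \<Longrightarrow> t \<in> {p..q} \<Longrightarrow>
      (\<And>s. s \<in> {p..t} \<Longrightarrow> v s = v' s) \<Longrightarrow> \<Phi> v t = \<Phi> v' t"
    and cont: "\<And>vn v t. (\<And>n. vn n \<in> bounded_paths p q B) \<Longrightarrow> v \<in> bounded_paths p q B \<Longrightarrow> uniform_limit {p..q} vn v sequentially \<Longrightarrow>
      t \<in> {p..q} \<Longrightarrow> (\<lambda>n. \<Phi> (vn n) t) \<longlonglongrightarrow> \<Phi> v t"
  shows "\<exists>v\<in>bounded_paths p q B. \<forall>t\<in>{p..q}. \<Phi> v t = v t"
proof -
  define SS :: "(real \<Rightarrow> 'b) set" where "SS = bounded_paths p q B"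
  have SSI: "v \<in> SS" if "continuous_on {p..q} v" "\<And>t. t \<in> {p..q} \<Longrightarrow> norm (v t) \<le> B" for v
    using that by (simp add: SS_def bounded_paths_def)
  have K0: "K \<ge> 0"
  proof -
    have "(\<lambda>_. w0) \<in> SS" using \<open>norm w0 \<le> B\<close> by (intro SSI) auto
    then have "0 \<le> K * \<bar>p - q\<bar>"
      using Lip[of "\<lambda>_. w0" p q] \<open>p < q\<close> by (auto simp: SS_def intro: order.trans[OF norm_ge_zero])
    then show ?thesis using \<open>p < q\<close> by (simp add: zero_le_mult_iff)
  qed
  have contPhi: "continuous_on {p..q} (\<Phi> v)" if "v \<in> SS" for v
  proof (rule uniformly_continuous_imp_continuous, unfold uniformly_continuous_on_def, intro allI impI)
    fix e :: real assume "e > 0"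
    show "\<exists>d>0. \<forall>x\<in>{p..q}. \<forall>x'\<in>{p..q}. dist x' x < d \<longrightarrow> dist (\<Phi> v x') (\<Phi> v x) < e"
    proof (intro exI[of _ "e / (K + 1)"] conjI ballI impI)
      fix x x' assume *: "x \<in> {p..q}" "x' \<in> {p..q}" "dist x' x < e / (K + 1)"
      have "dist (\<Phi> v x') (\<Phi> v x) \<le> K * dist x' x"
        using Lip[of v x' x] that * by (simp add: SS_def dist_norm)
      also have "\<dots> \<le> K * (e / (K + 1))" using * K0 by (intro mult_left_mono) auto
      also have "\<dots> < e" using K0 \<open>e > 0\<close> by (simp add: field_simps)
      finally show "dist (\<Phi> v x') (\<Phi> v x) < e" .
    qed (use K0 \<open>e > 0\<close> in auto)
  qed
  have approx: "\<exists>v\<in>SS. \<forall>t\<in>{p..q}. v t = \<Phi> v (max p (t - \<epsilon>))" if "\<epsilon> > 0" for \<epsilon>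
  proof -
    define \<Phi>' where "\<Phi>' v t = \<Phi> v (max p (t - \<epsilon>))" for v t
    define v where "v n = (\<Phi>' ^^ n) (\<lambda>_. w0)" for n
    have vS: "v n \<in> SS" for n
    proof (induction n)
      case 0 show ?case using \<open>norm w0 \<le> B\<close> by (intro SSI) (auto simp: v_def)
    next
      case (Suc n)
      have "continuous_on {p..q} (\<lambda>t. \<Phi> (v n) (max p (t - \<epsilon>)))"
        using \<open>\<epsilon> > 0\<close> by (intro continuous_on_compose2[OF contPhi[OF Suc]] continuous_intros) auto
      moreover have "norm (\<Phi> (v n) (max p (t - \<epsilon>))) \<le> B" if "t \<in> {p..q}" for t
        using Suc \<open>\<epsilon> > 0\<close> that by (intro bound) (auto simp: SS_def)
      ultimately show ?case by (intro SSI) (auto simp: v_def \<Phi>'_def)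
    qed
    have stab: "v (Suc n) t = v n t" if "t \<in> {p..q}" "t \<le> p + n * \<epsilon>" for n t
      using that
    proof (induction n arbitrary: t)
      case 0
      then have "t = p" by auto
      then show ?case using init[of "\<lambda>_. w0"] vS[of 0] \<open>\<epsilon> > 0\<close> by (simp add: v_def \<Phi>'_def SS_def)
    next
      case (Suc n)
      have "\<Phi> (v (Suc n)) (max p (t - \<epsilon>)) = \<Phi> (v n) (max p (t - \<epsilon>))"
      proof (rule causal)
        fix s assume s: "s \<in> {p..max p (t - \<epsilon>)}"
        have "0 \<le> n * \<epsilon>" using \<open>\<epsilon> > 0\<close> by simp
        then show "v (Suc n) s = v n s"
          using s Suc.prems \<open>\<epsilon> > 0\<close> by (intro Suc.IH) (auto simp: algebra_simps max_def split: if_splits)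
      qed (use vS Suc.prems \<open>\<epsilon> > 0\<close> in \<open>auto simp: SS_def\<close>)
      then show ?case by (simp add: v_def \<Phi>'_def)
    qed
    obtain n :: nat where "(q - p) / \<epsilon> \<le> n" using real_arch_simple by blast
    then have "q \<le> p + n * \<epsilon>" using \<open>\<epsilon> > 0\<close> by (simp add: field_simps)
    then have "v (Suc n) t = v n t" if "t \<in> {p..q}" for t using stab[of t n] that by auto
    then show ?thesis using vS[of n] by (intro bexI[of _ "v n"]) (auto simp: v_def \<Phi>'_def)
  qed
  have "\<forall>n. \<exists>v\<in>SS. \<forall>t\<in>{p..q}. v t = \<Phi> v (max p (t - 1 / Suc n))"
    using approx by simp
  then obtain u where uS: "\<And>n. u n \<in> SS"
    and u: "\<And>n t. t \<in> {p..q} \<Longrightarrow> u n t = \<Phi> (u n) (max p (t - 1 / Suc n))" by metis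
  have mem: "max p (t - 1 / Suc n) \<in> {p..q}" if "t \<in> {p..q}" for n t
  proof -
    have "0 \<le> 1 / real (Suc n)" by simp
    then show ?thesis using that unfolding atLeastAtMost_iff by linarith
  qed
  have uLip: "norm (u n s - u n t) \<le> K * \<bar>s - t\<bar>" if "s \<in> {p..q}" "t \<in> {p..q}" for n s t
  proof -
    have "norm (u n s - u n t) \<le> K * \<bar>max p (s - 1 / Suc n) - max p (t - 1 / Suc n)\<bar>"
      unfolding u[OF that(1)] u[OF that(2)]
      using uS[of n] by (intro Lip mem that) (simp add: SS_def)
    also have "\<dots> \<le> K * \<bar>s - t\<bar>" using K0 by (intro mult_left_mono) auto
    finally show ?thesis .
  qed
  obtain g \<rho> where g: "continuous_on {p..q} g" "strict_mono (\<rho> :: nat \<Rightarrow> nat)"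
    "\<And>e. 0 < e \<Longrightarrow> \<exists>N. \<forall>n x. n \<ge> N \<and> x \<in> {p..q} \<longrightarrow> norm (u (\<rho> n) x - g x) < e"
  proof (rule Arzela_Ascoli[of "{p..q}" u B])
    show "norm (u n x) \<le> B" if "x \<in> {p..q}" for n x using uS[of n] that by (simp add: SS_def bounded_paths_def)
    fix x e :: real assume x: "x \<in> {p..q}" "0 < e"
    show "\<exists>d>0. \<forall>n y. y \<in> {p..q} \<and> norm (x - y) < d \<longrightarrow> norm (u n x - u n y) < e"
    proof (intro exI[of _ "e / (K + 1)"] conjI allI impI)
      fix n y assume *: "y \<in> {p..q} \<and> norm (x - y) < e / (K + 1)"
      have "norm (u n x - u n y) \<le> K * \<bar>x - y\<bar>"
        using uLip[of x y n] x * by simp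
      also have "\<dots> \<le> K * (e / (K + 1))" using * K0 by (intro mult_left_mono) auto
      also have "\<dots> < e" using K0 x by (simp add: field_simps)
      finally show "norm (u n x - u n y) < e" .
    qed (use K0 x in auto)
  qed (auto intro: that)
  have ul: "uniform_limit {p..q} (\<lambda>n. u (\<rho> n)) g sequentially"
    unfolding uniform_limit_iff eventually_sequentially dist_norm using g(3) by blast
  have gS: "g \<in> SS"
  proof (rule SSI[OF g(1)])
    fix t assume t: "t \<in> {p..q}"
    have "(\<lambda>n. u (\<rho> n) t) \<longlonglongrightarrow> g t" using tendsto_uniform_limitI[OF ul t] .
    then show "norm (g t) \<le> B"
      using uS t by (intro LIMSEQ_le_const2[OF tendsto_norm]) (auto simp: SS_def bounded_paths_def)
  qed
  have "\<Phi> g t = g t" if t: "t \<in> {p..q}" for t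
  proof -
    have 1: "(\<lambda>n. u (\<rho> n) t) \<longlonglongrightarrow> g t" using tendsto_uniform_limitI[OF ul t] .
    have 2: "(\<lambda>n. \<Phi> (u (\<rho> n)) t) \<longlonglongrightarrow> \<Phi> g t"
      using cont[OF _ _ ul t] uS gS by (simp add: SS_def)
    have le: "norm (u (\<rho> n) t - \<Phi> (u (\<rho> n)) t) \<le> K * (1 / Suc (\<rho> n))" for n
    proof -
      have "norm (u (\<rho> n) t - \<Phi> (u (\<rho> n)) t) \<le> K * \<bar>max p (t - 1 / Suc (\<rho> n)) - t\<bar>"
        unfolding u[OF t, of "\<rho> n"] using uS[of "\<rho> n"] by (intro Lip mem t) (simp add: SS_def)
      also have "\<dots> \<le> K * (1 / Suc (\<rho> n))"
      proof (rule mult_left_mono[OF _ K0])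
        have "0 \<le> 1 / real (Suc (\<rho> n))" by simp
        then show "\<bar>max p (t - 1 / Suc (\<rho> n)) - t\<bar> \<le> 1 / Suc (\<rho> n)"
          using t unfolding atLeastAtMost_iff by linarith
      qed
      finally show ?thesis .
    qed
    have "(\<lambda>n. 1 / real (Suc (\<rho> n))) \<longlonglongrightarrow> 0"
      using LIMSEQ_subseq_LIMSEQ[OF LIMSEQ_inverse_real_of_nat g(2)] by (simp add: o_def inverse_eq_divide)
    then have lim: "(\<lambda>n. K * (1 / Suc (\<rho> n))) \<longlonglongrightarrow> 0" by (rule tendsto_mult_right_zero)
    have "(\<lambda>n. u (\<rho> n) t - \<Phi> (u (\<rho> n)) t) \<longlonglongrightarrow> 0"
      by (rule Lim_null_comparison[OF always_eventually lim]) (rule allI, rule le)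
    then have "g t - \<Phi> g t = 0" using LIMSEQ_unique[OF tendsto_diff[OF 1 2]] by blast
    then show ?thesis by simp
  qed
  then show ?thesis using gS unfolding SS_def by blast
qed

section \<open>Sampled control with an exponentially stabilising feedback\<close>

lemma gronwall_history_linear:
  fixes e g :: "real \<Rightarrow> 'a::real_inner"
  assumes "r \<ge> 0" "T \<ge> 0" and cont: "continuous_on {-r..T} e" and ac: "abs_cont_on 0 T e"
    and N: "negligible N"
    and deriv: "\<And>t. t \<in> {0<..<T} - N \<Longrightarrow> (e has_vector_derivative g t) (at t)"
    and init: "\<And>\<theta>. \<theta> \<in> {-r..0} \<Longrightarrow> norm (e \<theta>) \<le> m"
    and "c \<ge> 0" "P \<ge> 0"
    and rate: "\<And>t B. t \<in> {0<..<T} \<Longrightarrow> (\<And>s. s \<in> {-r..t} \<Longrightarrow> norm (e s) \<le> B) \<Longrightarrow>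
      norm (g t) \<le> c * B + P"
    and t: "t \<in> {-r..T}"
  shows "norm (e t) \<le> growth_const (c + 1) T * (m + P)"
proof -
  define K where "K = growth_const (c + 1) T"
  have K: "K \<ge> 1" unfolding K_def using \<open>c \<ge> 0\<close> \<open>T \<ge> 0\<close> by (intro growth_const_ge_1) auto
  have m0: "m \<ge> 0" using order.trans[OF norm_ge_zero init[of 0]] \<open>r \<ge> 0\<close> by auto
  have "(norm (e t))\<^sup>2 \<le> K * (m\<^sup>2 + P\<^sup>2)"
    unfolding K_def
  proof (rule gronwall_history[OF \<open>r \<ge> 0\<close> \<open>T \<ge> 0\<close> cont ac N deriv init _ _ _ t])
    fix t B assume t: "t \<in> {0<..<T}" and B: "\<And>s. s \<in> {-r..t} \<Longrightarrow> norm (e s) \<le> B"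
    have e: "norm (e t) \<le> B" using B[of t] t \<open>r \<ge> 0\<close> by auto
    have "e t \<bullet> g t \<le> norm (e t) * norm (g t)" by (rule norm_cauchy_schwarz)
    also have "\<dots> \<le> B * (c * B + P)"
      using e rate[OF t B] order.trans[OF norm_ge_zero e] by (intro mult_mono) auto
    also have "\<dots> \<le> (c + 1) * B\<^sup>2 + P\<^sup>2"
    proof -
      have "2 * (B * P) \<le> B\<^sup>2 + P\<^sup>2" using sum_squares_bound[of B P] by simp
      moreover have "0 \<le> B\<^sup>2 + P\<^sup>2" by simp
      ultimately have "B * P \<le> B\<^sup>2 + P\<^sup>2" by linarith
      then show ?thesis by (simp add: power2_eq_square algebra_simps)
    qed
    finally show "e t \<bullet> g t \<le> (c + 1) * B\<^sup>2 + P\<^sup>2" .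
  qed (use \<open>c \<ge> 0\<close> in auto)
  also have "\<dots> \<le> K * (m + P)\<^sup>2"
    using K m0 \<open>P \<ge> 0\<close> by (intro mult_left_mono) (auto simp: power2_sum)
  also have "\<dots> \<le> K * K * (m + P)\<^sup>2"
    using K by (intro mult_right_mono) auto
  finally have "(norm (e t))\<^sup>2 \<le> (K * (m + P))\<^sup>2" by (simp add: power2_eq_square algebra_simps)
  moreover have "0 \<le> K * (m + P)" using K m0 \<open>P \<ge> 0\<close> by simp
  ultimately show ?thesis unfolding K_def[symmetric] by (rule power2_le_imp_le)
qed

lemma negligible_shift:
  fixes N :: "real set"
  assumes "negligible N"
  shows "negligible {s. t0 + s \<in> N}"
proof -
  have "{s. t0 + s \<in> N} = (+) (- t0) ` N"
    by (auto simp: image_iff intro!: bexI[of _ "t0 + _"])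
  then show ?thesis using negligible_translation[OF assms, of "- t0"] by simp
qed

locale stabilising_feedback =
  fixes r :: real and D :: "(real^'q) set"
    and f :: "(real \<Rightarrow>\<^sub>C (real^'n)) \<times> (real^'m) \<times> (real^'q) \<Rightarrow> real^'n"
    and k :: "(real \<Rightarrow>\<^sub>C (real^'n)) \<Rightarrow> real^'m"
    and \<kappa> :: "real \<Rightarrow> real" and \<mu> M L :: real
  assumes r: "r > 0" and f_0: "f (0, 0, 0) = 0" and k_0: "k 0 = 0"
    and \<mu>: "\<mu> > 0" and M: "M > 0" and L: "L > 0"
    and Lipschitz: "\<And>x x' u u'. x \<in> C0 r \<Longrightarrow> x' \<in> C0 r \<Longrightarrow>
      norm (k x' - k x) + norm (f (x', u', 0) - f (x, u, 0)) \<le> L * norm (x' - x) + L * norm (u' - u)"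
    and disturbance: "\<And>x u d. x \<in> C0 r \<Longrightarrow> d \<in> D \<Longrightarrow> norm (f (x, u, d) - f (x, u, 0)) \<le> \<kappa> (norm d)"
    and nominal_exists: "\<And>x0. x0 \<in> C0 r \<Longrightarrow>
      \<exists>x. delay_sol r x0 (\<lambda>t. f (hist r x t, k (hist r x t), 0)) x"
    and nominal_decay: "\<And>x0 x t. x0 \<in> C0 r \<Longrightarrow> delay_sol r x0 (\<lambda>t. f (hist r x t, k (hist r x t), 0)) x \<Longrightarrow>
      t \<ge> 0 \<Longrightarrow> norm (hist r x t) \<le> M * exp (- \<mu> * t) * norm x0"
begin

text \<open>A Lipschitz constant of the nominal closed-loop field \<open>\<phi> \<mapsto> f (\<phi>, k \<phi>, 0)\<close>.\<close>
definition c where "c = L + L\<^sup>2"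

lemma c_pos: "c > 0" and L2_le_c: "L\<^sup>2 \<le> c"
  using L by (auto simp: c_def add_pos_pos)

lemma feedback_Lipschitz: "x \<in> C0 r \<Longrightarrow> x' \<in> C0 r \<Longrightarrow> norm (k x' - k x) \<le> L * norm (x' - x)"
proof -
  assume x: "x \<in> C0 r" "x' \<in> C0 r"
  have "norm (k x' - k x) \<le> norm (k x' - k x) + norm (f (x', 0, 0) - f (x, 0, 0))" by simp
  also have "\<dots> \<le> L * norm (x' - x) + L * norm (0 - 0 :: real^'m)" by (rule Lipschitz[OF x])
  finally show ?thesis by simp
qed

lemma field_perturbation:
  assumes "\<phi> \<in> C0 r" "\<psi> \<in> C0 r" "y \<in> C0 r" "d \<in> D"
  shows "norm (f (\<phi>, k y, d) - f (\<psi>, k \<psi>, 0)) \<le> \<kappa> (norm d) + L * norm (\<phi> - \<psi>) + L\<^sup>2 * norm (y - \<psi>)"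
proof -
  have "norm (f (\<phi>, k y, d) - f (\<psi>, k \<psi>, 0)) \<le> norm (f (\<phi>, k y, d) - f (\<phi>, k y, 0)) + norm (f (\<phi>, k y, 0) - f (\<psi>, k \<psi>, 0))"
    using norm_triangle_ineq[of "f (\<phi>, k y, d) - f (\<phi>, k y, 0)" "f (\<phi>, k y, 0) - f (\<psi>, k \<psi>, 0)"] by simp
  moreover have "norm (f (\<phi>, k y, 0) - f (\<psi>, k \<psi>, 0)) \<le> L * norm (\<phi> - \<psi>) + L * norm (k y - k \<psi>)"
    using Lipschitz[OF assms(2,1), of "k y" "k \<psi>"] norm_ge_zero[of "k \<phi> - k \<psi>"] by linarith
  moreover have "L * norm (k y - k \<psi>) \<le> L * (L * norm (y - \<psi>))"
    using feedback_Lipschitz[OF assms(2,3)] L by (intro mult_left_mono) auto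
  ultimately show ?thesis
    using disturbance[OF assms(1,4), of "k y"] by (simp add: power2_eq_square algebra_simps)
qed

lemma field_growth:
  assumes "\<phi> \<in> C0 r" "y \<in> C0 r" "d \<in> D"
  shows "norm (f (\<phi>, k y, d)) \<le> \<kappa> (norm d) + L * norm \<phi> + L\<^sup>2 * norm y"
  using field_perturbation[OF assms(1) zero_in_C0 assms(2,3)] by (simp add: k_0 f_0)

text \<open>
  The difference from the nominal solution with the same history at \<open>t0\<close> starts from 0. It satisfies a
  Gronwall inequality whose inhomogeneity \<open>P\<close> collects the disturbance and the error of the measured
  history \<open>y\<close>.
\<close>
lemma compare_with_nominal:
  fixes x :: "real \<Rightarrow> real^'n"
  assumes x: "delay_sol r x0 (\<lambda>t. f (hist r x t, u t, d t)) x"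
    and d: "\<And>t. t \<ge> 0 \<Longrightarrow> d t \<in> D" and "t0 \<ge> 0" "T \<ge> 0" "P \<ge> 0"
    and pert: "\<And>s. s \<in> {t0..t0+T} \<Longrightarrow>
      \<exists>y\<in>C0 r. u s = k y \<and> \<kappa> (norm (d s)) + L\<^sup>2 * norm (y - hist r x s) \<le> P"
  shows "norm (hist r x (t0 + T)) \<le> M * exp (- \<mu> * T) * norm (hist r x t0) + growth_const (c + 1) T * P"
proof -
  have cx: "continuous_on {p..q} x" if "p \<ge> -r" for p q
    using delay_sol_cont[OF x] that by auto
  have xC0: "hist r x t \<in> C0 r" if "t \<ge> 0" for t
    using that r by (intro hist_in_C0 cx) auto
  obtain xn where xn: "delay_sol r (hist r x t0) (\<lambda>t. f (hist r xn t, k (hist r xn t), 0)) xn"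
    using nominal_exists[OF xC0[OF \<open>t0 \<ge> 0\<close>]] by blast
  have cxn: "continuous_on {p..q} xn" if "p \<ge> -r" for p q
    using delay_sol_cont[OF xn] that by auto
  have xnC0: "hist r xn t \<in> C0 r" if "t \<ge> 0" for t
    using that r by (intro hist_in_C0 cxn) auto
  define e where "e s = x (t0 + s) - xn s" for s
  define gg where "gg s = f (hist r x (t0 + s), u (t0 + s), d (t0 + s)) - f (hist r xn s, k (hist r xn s), 0)" for s
  obtain N where N: "negligible N"
    "\<And>t. t \<ge> 0 \<Longrightarrow> t \<notin> N \<Longrightarrow> (x has_vector_derivative f (hist r x t, u t, d t)) (at t)"
    by (rule delay_sol_deriv[OF x]) blast
  obtain N' where N': "negligible N'"
    "\<And>t. t \<ge> 0 \<Longrightarrow> t \<notin> N' \<Longrightarrow> (xn has_vector_derivative f (hist r xn t, k (hist r xn t), 0)) (at t)"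
    by (rule delay_sol_deriv[OF xn]) blast
  have hd: "norm (hist r x (t0 + s) - hist r xn s) \<le> B"
    if "s \<ge> 0" "\<And>s'. s' \<in> {-r..s} \<Longrightarrow> norm (e s') \<le> B" for s B
  proof (rule hist_diff_le)
    fix \<theta> assume "\<theta> \<in> {-r..0}"
    then show "norm (x (t0 + s + \<theta>) - xn (s + \<theta>)) \<le> B"
      using that(1) that(2)[of "s + \<theta>"] by (simp add: e_def add.assoc)
  qed (use that(1) r \<open>t0 \<ge> 0\<close> cx cxn in auto)
  have e: "norm (e t) \<le> growth_const (c + 1) T * (0 + P)" if t: "t \<in> {-r..T}" for t
  proof (rule gronwall_history_linear[where g = gg and N = "{s. t0 + s \<in> N} \<union> N'", OF _ \<open>T \<ge> 0\<close> _ _ _ _ _ _ \<open>P \<ge> 0\<close> _ t])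
    show "continuous_on {-r..T} e"
      unfolding e_def using \<open>t0 \<ge> 0\<close>
      by (intro continuous_on_diff cxn continuous_on_compose2[OF cx[of "-r" "t0 + T"]] continuous_on_add
        continuous_on_const continuous_on_id) auto
    show "abs_cont_on 0 T e"
      unfolding e_def using delay_sol_abs_cont[OF x, of t0 "t0 + T"] delay_sol_abs_cont[OF xn] \<open>t0 \<ge> 0\<close> \<open>T \<ge> 0\<close>
      by (intro abs_cont_on_diff abs_cont_on_shift) auto
    show "negligible ({s. t0 + s \<in> N} \<union> N')" by (rule negligible_Un[OF negligible_shift[OF N(1)] N'(1)])
    show "norm (e \<theta>) \<le> 0" if "\<theta> \<in> {-r..0}" for \<theta>
    proof -
      have "hist r x t0 \<theta> = x (t0 + \<theta>)" using that r \<open>t0 \<ge> 0\<close> by (intro hist_apply cx) auto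
      then show ?thesis using xn that by (simp add: e_def delay_sol_def)
    qed
    show "(e has_vector_derivative gg t) (at t)" if t: "t \<in> {0<..<T} - ({s. t0 + s \<in> N} \<union> N')" for t
    proof -
      have "(x has_vector_derivative f (hist r x (t0 + t), u (t0 + t), d (t0 + t))) (at (t0 + t))"
        using N(2)[of "t0 + t"] t \<open>t0 \<ge> 0\<close> by auto
      then have "((x \<circ> (\<lambda>s. t0 + s)) has_vector_derivative 1 *\<^sub>R f (hist r x (t0 + t), u (t0 + t), d (t0 + t))) (at t)"
        by (intro vector_diff_chain_at)
          (auto intro!: derivative_eq_intros simp: has_real_derivative_iff_has_vector_derivative[symmetric])
      then show ?thesis
        unfolding e_def gg_def using N'(2)[of t] t
        by (intro has_vector_derivative_diff) (auto simp: o_def)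
    qed
    fix s B assume s: "s \<in> {0<..<T}" and B: "\<And>s'. s' \<in> {-r..s} \<Longrightarrow> norm (e s') \<le> B"
    obtain y where y: "y \<in> C0 r" "u (t0 + s) = k y"
      "\<kappa> (norm (d (t0 + s))) + L\<^sup>2 * norm (y - hist r x (t0 + s)) \<le> P"
      using pert[of "t0 + s"] s by auto
    have h: "norm (hist r x (t0 + s) - hist r xn s) \<le> B" using s B by (intro hd) auto
    have "norm (y - hist r xn s) \<le> norm (y - hist r x (t0 + s)) + norm (hist r x (t0 + s) - hist r xn s)"
      using norm_triangle_ineq[of "y - hist r x (t0 + s)" "hist r x (t0 + s) - hist r xn s"] by simp
    then have "L\<^sup>2 * norm (y - hist r xn s) \<le> L\<^sup>2 * norm (y - hist r x (t0 + s)) + L\<^sup>2 * B"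
      using h mult_left_mono[of "norm (y - hist r xn s)" "norm (y - hist r x (t0 + s)) + B" "L\<^sup>2"]
      by (simp add: distrib_left)
    moreover have "L * norm (hist r x (t0 + s) - hist r xn s) \<le> L * B" using h L by simp
    moreover have "norm (gg s) \<le> \<kappa> (norm (d (t0 + s))) + L * norm (hist r x (t0 + s) - hist r xn s)
        + L\<^sup>2 * norm (y - hist r xn s)"
      unfolding gg_def y(2) using s \<open>t0 \<ge> 0\<close> by (intro field_perturbation xC0 xnC0 y(1) d) auto
    ultimately show "norm (gg s) \<le> c * B + P" using y(3) by (simp add: c_def algebra_simps)
  qed (use r c_pos in auto)
  have "norm (hist r x (t0 + T)) \<le> norm (hist r xn T) + norm (hist r x (t0 + T) - hist r xn T)"
    by (rule norm_triangle_sub)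
  also have "norm (hist r xn T) \<le> M * exp (- \<mu> * T) * norm (hist r x t0)"
    using nominal_decay[OF xC0[OF \<open>t0 \<ge> 0\<close>] xn \<open>T \<ge> 0\<close>] .
  also have "norm (hist r x (t0 + T) - hist r xn T) \<le> growth_const (c + 1) T * P"
    using e \<open>T \<ge> 0\<close> by (intro hd) auto
  finally show ?thesis by simp
qed

text \<open>
  A bound for the initial phase. There the displacement \<open>x\<^sub>s - x\<^sub>t\<close> since the last sample need not be small,
  so the constant grows with \<open>T\<close> and no decay is obtained.
\<close>
lemma finite_time_growth:
  fixes x :: "real \<Rightarrow> real^'n"
  assumes x: "delay_sol r x0 (\<lambda>t. f (hist r x t, u t, d t)) x" and x0: "x0 \<in> C0 r"
    and d: "\<And>t. t \<ge> 0 \<Longrightarrow> d t \<in> D" and "T \<ge> 0" "A \<ge> 0" "N \<ge> 0"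
    and \<kappa>: "\<And>t. t \<in> {0..T} \<Longrightarrow> \<kappa> (norm (d t)) \<le> N"
    and u: "\<And>t. t \<in> {0..T} \<Longrightarrow> \<exists>s\<in>{0..t}. \<exists>y\<in>C0 r. u t = k y \<and> norm (y - hist r x s) \<le> A + N"
  shows "norm (hist r x T) \<le> growth_const (c + 1) T * (1 + c) * (norm x0 + A + N)"
proof -
  define K where "K = growth_const (c + 1) T"
  have K: "K \<ge> 1" unfolding K_def using c_pos \<open>T \<ge> 0\<close> by (intro growth_const_ge_1) auto
  have cx: "continuous_on {p..q} x" if "p \<ge> -r" for p q
    using delay_sol_cont[OF x] that by auto
  have xC0: "hist r x t \<in> C0 r" if "t \<ge> 0" for t
    using that r by (intro hist_in_C0 cx) auto
  obtain N' where N': "negligible N'"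
    "\<And>t. t \<ge> 0 \<Longrightarrow> t \<notin> N' \<Longrightarrow> (x has_vector_derivative f (hist r x t, u t, d t)) (at t)"
    by (rule delay_sol_deriv[OF x]) blast
  define P where "P = N + L\<^sup>2 * (A + N)"
  have "P \<le> N + c * (A + N)"
    unfolding P_def using L2_le_c \<open>A \<ge> 0\<close> \<open>N \<ge> 0\<close> by (intro add_left_mono mult_right_mono) auto
  then have P: "norm x0 + P \<le> (1 + c) * (norm x0 + A + N)"
  proof -
    have "0 \<le> c * norm x0" using c_pos by simp
    then show ?thesis using \<open>P \<le> N + c * (A + N)\<close> \<open>A \<ge> 0\<close> by (simp add: algebra_simps)
  qed
  have P0: "P \<ge> 0" using \<open>A \<ge> 0\<close> \<open>N \<ge> 0\<close> by (simp add: P_def)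
  have x_le: "norm (x t) \<le> K * (norm x0 + P)" if t: "t \<in> {-r..T}" for t
    unfolding K_def
  proof (rule gronwall_history_linear[where g = "\<lambda>t. f (hist r x t, u t, d t)", OF _ \<open>T \<ge> 0\<close> _ _ N'(1) _ _ _ P0 _ t])
    show "norm (x \<theta>) \<le> norm x0" if "\<theta> \<in> {-r..0}" for \<theta>
      using x that norm_bounded[of x0 \<theta>] by (simp add: delay_sol_def)
    fix t B assume t: "t \<in> {0<..<T}" and B: "\<And>s. s \<in> {-r..t} \<Longrightarrow> norm (x s) \<le> B"
    have XB: "norm (hist r x s) \<le> B" if "s \<in> {0..t}" for s
      using that t B r by (intro hist_norm_le cx) auto
    obtain s y where y: "s \<in> {0..t}" "y \<in> C0 r" "u t = k y" "norm (y - hist r x s) \<le> A + N"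
      using u[of t] t by auto
    have "norm y \<le> B + (A + N)"
      using XB[OF y(1)] y(4) norm_triangle_sub[of y "hist r x s"] by linarith
    then have "L\<^sup>2 * norm y \<le> L\<^sup>2 * (B + (A + N))" by (intro mult_left_mono) auto
    moreover have "L * norm (hist r x t) \<le> L * B" using XB[of t] L t by simp
    moreover have "norm (f (hist r x t, u t, d t)) \<le> \<kappa> (norm (d t)) + L * norm (hist r x t) + L\<^sup>2 * norm y"
      unfolding y(3) using t by (intro field_growth xC0 y(2) d) auto
    ultimately show "norm (f (hist r x t, u t, d t)) \<le> c * B + P"
      using \<kappa>[of t] t by (simp add: P_def c_def algebra_simps)
  qed (use r c_pos cx delay_sol_abs_cont[OF x] \<open>T \<ge> 0\<close> N' in auto)
  have "norm (hist r x T) \<le> K * (norm x0 + P)"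
    using x_le r \<open>T \<ge> 0\<close> by (intro hist_norm_le cx) auto
  also have "\<dots> \<le> K * ((1 + c) * (norm x0 + A + N))" using P K by (intro mult_left_mono) auto
  finally show ?thesis by (simp add: K_def)
qed

text \<open>
  From time \<open>r\<close> on the history lies in the part of the trajectory that solves the equation, and the
  length of the sampling interval then controls its displacement.
\<close>
lemma hist_increment_le:
  fixes x :: "real \<Rightarrow> real^'n"
  assumes x: "delay_sol r x0 (\<lambda>t. f (hist r x t, u t, d t)) x"
    and st: "r \<le> s" "s \<le> t" and "Z \<ge> 0"
    and rate: "\<And>s'. s' \<in> {s-r..t} \<Longrightarrow> norm (f (hist r x s', u s', d s')) \<le> Z"
  shows "norm (hist r x s - hist r x t) \<le> Z * (t - s)"
proof -
  have cx: "continuous_on {p..q} x" if "p \<ge> -r" for p q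
    using delay_sol_cont[OF x] that by auto
  obtain N where N: "negligible N"
    "\<And>t. t \<ge> 0 \<Longrightarrow> t \<notin> N \<Longrightarrow> (x has_vector_derivative f (hist r x t, u t, d t)) (at t)"
    by (rule delay_sol_deriv[OF x]) blast
  have "norm (hist r x t - hist r x s) \<le> Z * (t - s)"
  proof (rule hist_diff_le)
    fix \<theta> assume \<theta>: "\<theta> \<in> {-r..0}"
    have "norm (x (t + \<theta>) - x (s + \<theta>)) \<le> Z * ((t + \<theta>) - (s + \<theta>))"
      using \<theta> st N rate
      by (intro abs_cont_norm_increment_le[OF _ _ N(1) \<open>Z \<ge> 0\<close>, where g = "\<lambda>t. f (hist r x t, u t, d t)"]
          delay_sol_abs_cont[OF x]) auto
    then show "norm (x (t + \<theta>) - x (s + \<theta>)) \<le> Z * (t - s)" by simp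
  qed (use r st cx in auto)
  then show ?thesis by (simp add: norm_minus_commute)
qed

text \<open>
  Here \<open>A\<close> and \<open>N\<close> describe the transient and the persistent part of the measurement error, and \<open>N\<close> also bounds
  the effect of the disturbance on \<open>[0, T]\<close>. The constants are chosen in the order \<open>T2\<close>, \<open>T1\<close>, \<open>\<omega>\<close>, \<open>\<delta>\<close>: the
  window \<open>T2\<close> makes the nominal flow contract by \<open>1/8\<close>; \<open>T1 = T2 + r + 2\<close> is how far back data enter the
  estimate on a window (the delay and two sampling periods); \<open>\<omega>\<close> keeps the weight \<open>exp(\<omega> T1)\<close> at most 2; and
  \<open>\<delta>\<close> makes the cost of the displacement at most \<open>1/8\<close>. In total \<open>2 (1/8 + 1/8)\<close> of the weighted supremum \<open>Y\<close>
  reappears on the right-hand side, and it is absorbed.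
\<close>
theorem sampled_feedback_decay:
  assumes "\<sigma> > 0"
  obtains \<delta> \<omega> C where "0 < \<delta>" "\<delta> \<le> 1" "0 < \<omega>" "\<omega> \<le> \<sigma>" "C \<ge> 1"
    "\<And>x x0 u d T A N. x0 \<in> C0 r \<Longrightarrow> delay_sol r x0 (\<lambda>t. f (hist r x t, u t, d t)) x \<Longrightarrow>
      (\<And>t. t \<ge> 0 \<Longrightarrow> d t \<in> D) \<Longrightarrow> T \<ge> 0 \<Longrightarrow> A \<ge> 0 \<Longrightarrow> N \<ge> 0 \<Longrightarrow>
      (\<And>t. t \<in> {0..T} \<Longrightarrow> \<kappa> (norm (d t)) \<le> N) \<Longrightarrow>
      (\<And>t. t \<in> {0..T} \<Longrightarrow> \<exists>s\<in>{0..t}. t - s \<le> \<delta> \<and>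
         (\<exists>y\<in>C0 r. u t = k y \<and> norm (y - hist r x s) \<le> exp (- \<sigma> * s) * A + N)) \<Longrightarrow>
      norm (hist r x T) \<le> C * (exp (- \<omega> * T) * (norm x0 + A) + N)"
proof -
  define T2 where "T2 = max 1 (ln (8 * M) / \<mu>)"
  define T1 where "T1 = T2 + r + 2"
  define \<omega> where "\<omega> = min \<sigma> (ln 2 / T1)"
  define gc where "gc = growth_const (c + 1) T2"
  define gc1 where "gc1 = growth_const (c + 1) T1"
  define \<delta> where "\<delta> = min 1 (1 / (8 * (gc * c\<^sup>2) + 1))"
  define C2 where "C2 = 2 * (gc1 * (1 + c)) + 2 * (gc * (1 + c)\<^sup>2)"
  have T2: "T2 \<ge> 1" "M * exp (- \<mu> * T2) \<le> 1 / 8"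
  proof -
    have "ln (8 * M) / \<mu> \<le> T2" by (simp add: T2_def)
    then have "ln (8 * M) \<le> \<mu> * T2" using \<mu> by (simp add: field_simps)
    then have "8 * M \<le> exp (\<mu> * T2)" using M by (metis exp_le_cancel_iff exp_ln mult_pos_pos zero_less_numeral)
    then show "M * exp (- \<mu> * T2) \<le> 1 / 8" by (simp add: exp_minus field_simps)
  qed (simp add: T2_def)
  have T1: "T1 > 0" using T2 r by (simp add: T1_def)
  have \<omega>: "\<omega> > 0" "\<omega> \<le> \<sigma>" "\<omega> * T1 \<le> ln 2"
    using T1 assms by (auto simp: \<omega>_def field_simps min_def)
  have q: "exp (\<omega> * T1) \<le> 2" using \<omega>(3) by (metis exp_le_cancel_iff exp_ln zero_less_numeral)
  have gc: "gc \<ge> 1" "gc1 \<ge> 1" unfolding gc_def gc1_def using c_pos T1 T2 by (auto intro!: growth_const_ge_1)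
  have gcc: "gc * c\<^sup>2 > 0" using gc c_pos by auto
  have \<delta>: "\<delta> > 0" "\<delta> \<le> 1" using gcc by (auto simp: \<delta>_def)
  have \<delta>gc: "gc * c\<^sup>2 * \<delta> \<le> 1 / 8"
  proof -
    have "gc * c\<^sup>2 * \<delta> \<le> gc * c\<^sup>2 * (1 / (8 * (gc * c\<^sup>2) + 1))"
      using gcc by (intro mult_left_mono) (auto simp: \<delta>_def)
    also have "\<dots> \<le> 1 / 8" using gcc by (simp add: field_simps)
    finally show ?thesis .
  qed
  have C2: "C2 \<ge> 1"
  proof -
    have "1 * 1 \<le> gc1 * (1 + c)" using gc c_pos by (intro mult_mono) auto
    moreover have "0 \<le> gc * (1 + c)\<^sup>2" using gc by auto
    ultimately show ?thesis by (simp add: C2_def)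
  qed
  show ?thesis
  proof (rule that[of \<delta> \<omega> "2 * C2"])
    fix x x0 u d T A N
    assume x0: "x0 \<in> C0 r" and x: "delay_sol r x0 (\<lambda>t. f (hist r x t, u t, d t)) x"
      and d: "\<And>t. t \<ge> 0 \<Longrightarrow> d t \<in> D" and T: "T \<ge> 0" and A: "A \<ge> 0" and N: "N \<ge> 0"
      and \<kappa>: "\<And>t. t \<in> {0..T} \<Longrightarrow> \<kappa> (norm (d t)) \<le> N"
      and u: "\<And>t. t \<in> {0..T} \<Longrightarrow> \<exists>s\<in>{0..t}. t - s \<le> \<delta> \<and>
         (\<exists>y\<in>C0 r. u t = k y \<and> norm (y - hist r x s) \<le> exp (- \<sigma> * s) * A + N)"
    have cx: "continuous_on {p..q} x" if "p \<ge> -r" for p q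
      using delay_sol_cont[OF x] that by auto
    have xC0: "hist r x t \<in> C0 r" if "t \<ge> 0" for t
      using that r by (intro hist_in_C0 cx) auto
    have "continuous_on {0..T} (\<lambda>t. exp (\<omega> * t) * norm (hist r x t))"
      using r by (intro continuous_intros continuous_on_hist cx) auto
    then obtain t1 where t1: "t1 \<in> {0..T}"
      "\<And>t. t \<in> {0..T} \<Longrightarrow> exp (\<omega> * t) * norm (hist r x t) \<le> exp (\<omega> * t1) * norm (hist r x t1)"
      using continuous_attains_sup[of "{0..T}" "\<lambda>t. exp (\<omega> * t) * norm (hist r x t)"] T by auto
    define Y where "Y = exp (\<omega> * t1) * norm (hist r x t1)"
    have Y0: "Y \<ge> 0" by (simp add: Y_def)
    have XY: "norm (hist r x t) \<le> exp (- \<omega> * t) * Y" if "t \<in> {0..T}" for t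
      using t1(2)[OF that] by (simp add: Y_def exp_minus field_simps)
    define W where "W = norm x0 + A + exp (\<omega> * T) * N"
    have W0: "W \<ge> 0" using A N by (simp add: W_def)
    have step: "exp (\<omega> * t) * norm (hist r x t) \<le> Y / 2 + C2 * W" if t: "t \<in> {0..T}" for t
    proof (cases "t \<le> T1")
      case True
      have "norm (hist r x t) \<le> growth_const (c + 1) t * (1 + c) * (norm x0 + A + N)"
      proof (rule finite_time_growth[OF x x0 d])
        fix t' assume t': "t' \<in> {0..t}"
        then obtain s y where s: "s \<in> {0..t'}" "y \<in> C0 r" "u t' = k y"
          "norm (y - hist r x s) \<le> exp (- \<sigma> * s) * A + N"
          using u[of t'] t by auto
        have "exp (- \<sigma> * s) * A \<le> 1 * A" using s assms A by (intro mult_right_mono) auto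
        then have "norm (y - hist r x s) \<le> A + N" using s(4) by simp
        then show "\<exists>s\<in>{0..t'}. \<exists>y\<in>C0 r. u t' = k y \<and> norm (y - hist r x s) \<le> A + N"
          using s(1-3) by blast
      qed (use t \<kappa> A N in auto)
      also have "\<dots> \<le> gc1 * (1 + c) * W"
      proof (intro mult_mono)
        show "growth_const (c + 1) t \<le> gc1"
          unfolding gc1_def using True t c_pos by (intro growth_const_mono) auto
        have "1 * N \<le> exp (\<omega> * T) * N" using \<omega> T N by (intro mult_right_mono) auto
        then show "norm x0 + A + N \<le> W" by (simp add: W_def)
      qed (use gc c_pos A N in auto)
      finally have "exp (\<omega> * t) * norm (hist r x t) \<le> 2 * (gc1 * (1 + c) * W)"
      proof (intro mult_mono)
        have "exp (\<omega> * t) \<le> exp (\<omega> * T1)" using True \<omega> by simp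
        then show "exp (\<omega> * t) \<le> 2" using q by linarith
      qed auto
      also have "\<dots> \<le> C2 * W"
      proof -
        have "0 \<le> gc * (1 + c)\<^sup>2 * W" using gc W0 by auto
        then show ?thesis by (simp add: C2_def algebra_simps)
      qed
      finally show ?thesis using Y0 by simp
    next
      case False
      define t0 where "t0 = t - T2"
      define Q where "Q = exp (- \<omega> * (t - T1))"
      have Q0: "Q \<ge> 0" by (simp add: Q_def)
      have expQ: "exp (- \<omega> * s) \<le> Q" if "s \<ge> t - T1" for s
        unfolding Q_def using that \<omega>(1) by simp
      have XQ: "norm (hist r x s) \<le> Q * Y" if "s \<ge> t - T1" "s \<le> t" for s
      proof -
        have "norm (hist r x s) \<le> exp (- \<omega> * s) * Y" using that False t by (intro XY) auto
        also have "\<dots> \<le> Q * Y" using expQ[OF that(1)] Y0 by (intro mult_right_mono) auto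
        finally show ?thesis .
      qed
      have AQ: "exp (- \<sigma> * s) * A \<le> Q * A" if "s \<ge> t - T1" for s
      proof -
        have "s \<ge> 0" using that False by simp
        then have "exp (- \<sigma> * s) \<le> exp (- \<omega> * s)" using \<omega>(2) by (simp add: mult_right_mono)
        then have "exp (- \<sigma> * s) \<le> Q" using expQ[OF that] by linarith
        then show ?thesis using A by (rule mult_right_mono)
      qed
      \<comment> \<open>A bound of the speed on the window and on the part of the past that its histories see.\<close>
      define Z where "Z = (1 + c) * N + c * (Q * Y) + c * (Q * A)"
      have Z0: "Z \<ge> 0" unfolding Z_def using c_pos N Q0 Y0 A by (intro add_nonneg_nonneg mult_nonneg_nonneg) auto
      have rate: "norm (f (hist r x s, u s, d s)) \<le> Z" if s: "s \<ge> t - T1 + 1" "s \<le> t" for s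
      proof -
        have "s \<ge> 0" using s False by simp
        then obtain s' y where s': "s' \<in> {0..s}" "s - s' \<le> \<delta>" "y \<in> C0 r" "u s = k y"
          "norm (y - hist r x s') \<le> exp (- \<sigma> * s') * A + N"
          using u[of s] s t by auto
        have "s' \<ge> t - T1" using s s' \<delta> by auto
        then have "norm y \<le> Q * Y + Q * A + N"
          using XQ[of s'] AQ[of s'] s' s norm_triangle_sub[of y "hist r x s'"] by auto
        then have "L\<^sup>2 * norm y \<le> L\<^sup>2 * (Q * Y + Q * A + N)" by (intro mult_left_mono) auto
        moreover have "L * norm (hist r x s) \<le> L * (Q * Y)" using XQ[of s] s L by simp
        moreover have "norm (f (hist r x s, u s, d s)) \<le> \<kappa> (norm (d s)) + L * norm (hist r x s) + L\<^sup>2 * norm y"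
          unfolding s'(4) using \<open>s \<ge> 0\<close> by (intro field_growth xC0 s'(3) d) auto
        moreover have "\<kappa> (norm (d s)) \<le> N" using \<kappa>[of s] \<open>s \<ge> 0\<close> s t by auto
        moreover have "0 \<le> L * N" "0 \<le> L * (Q * A)" using L N Q0 A by auto
        ultimately show ?thesis by (simp add: Z_def c_def algebra_simps)
      qed
      define P where "P = N + c * (Q * A + N + \<delta> * Z)"
      have P0: "P \<ge> 0" unfolding P_def using c_pos N Q0 A \<delta> Z0 by (intro add_nonneg_nonneg mult_nonneg_nonneg) auto
      have "norm (hist r x (t0 + T2)) \<le> M * exp (- \<mu> * T2) * norm (hist r x t0) + growth_const (c + 1) T2 * P"
      proof (rule compare_with_nominal[OF x d _ _ P0])
        show "t0 \<ge> 0" "T2 \<ge> 0" using False T2 r by (auto simp: t0_def T1_def)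
        fix s assume s: "s \<in> {t0..t0 + T2}"
        then have s_bds: "s \<ge> t - T2" "s \<le> t" "s \<ge> 0" using False r by (auto simp: t0_def T1_def)
        obtain s' y where s': "s' \<in> {0..s}" "s - s' \<le> \<delta>" "y \<in> C0 r" "u s = k y"
          "norm (y - hist r x s') \<le> exp (- \<sigma> * s') * A + N"
          using u[of s] s_bds t by auto
        have s'2: "s' \<ge> t - T2 - 1" using s' s_bds \<delta> by auto
        have "norm (hist r x s' - hist r x s) \<le> Z * (s - s')"
          by (rule hist_increment_le[OF x _ _ Z0]) (use s' s'2 s_bds False r T2 rate in \<open>auto simp: T1_def\<close>)
        also have "\<dots> \<le> Z * \<delta>" using s' Z0 by (intro mult_left_mono) auto
        finally have "norm (y - hist r x s) \<le> Q * A + N + \<delta> * Z"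
          using s'(5) AQ[of s'] s'2 r norm_triangle_ineq[of "y - hist r x s'" "hist r x s' - hist r x s"]
          by (simp add: T1_def mult.commute)
        then have "L\<^sup>2 * norm (y - hist r x s) \<le> c * (Q * A + N + \<delta> * Z)"
          using L2_le_c c_pos by (intro mult_mono) auto
        then show "\<exists>y\<in>C0 r. u s = k y \<and> \<kappa> (norm (d s)) + L\<^sup>2 * norm (y - hist r x s) \<le> P"
          using s' \<kappa>[of s] s_bds t by (intro bexI[of _ y]) (auto simp: P_def)
      qed
      then have "norm (hist r x t) \<le> M * exp (- \<mu> * T2) * norm (hist r x t0) + gc * P"
        by (simp add: t0_def gc_def)
      also have "M * exp (- \<mu> * T2) * norm (hist r x t0) \<le> 1 / 8 * (Q * Y)"
        using T2 M r XQ[of t0] by (intro mult_mono) (auto simp: t0_def T1_def)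
      also have "gc * P \<le> 1 / 8 * (Q * Y) + gc * (1 + c)\<^sup>2 * (N + Q * A)"
      proof -
        have "c * (\<delta> * Z) = \<delta> * (c * ((1 + c) * N + c * (Q * A))) + c\<^sup>2 * \<delta> * (Q * Y)"
          by (simp add: Z_def power2_eq_square algebra_simps)
        also have "\<delta> * (c * ((1 + c) * N + c * (Q * A))) \<le> 1 * (c * ((1 + c) * N + c * (Q * A)))"
          using \<delta> c_pos N Q0 A by (intro mult_right_mono mult_nonneg_nonneg add_nonneg_nonneg) auto
        finally have "P \<le> N + c * (Q * A + N) + c * ((1 + c) * N + c * (Q * A)) + c\<^sup>2 * \<delta> * (Q * Y)"
          by (simp add: P_def algebra_simps)
        also have "\<dots> \<le> (1 + c)\<^sup>2 * (N + Q * A) + c\<^sup>2 * \<delta> * (Q * Y)"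
        proof -
          have "0 \<le> Q * A" "0 \<le> c * (Q * A)" using Q0 A c_pos by auto
          then show ?thesis by (simp add: power2_eq_square algebra_simps)
        qed
        finally have "gc * P \<le> gc * ((1 + c)\<^sup>2 * (N + Q * A) + c\<^sup>2 * \<delta> * (Q * Y))"
          using gc by (intro mult_left_mono) auto
        also have "\<dots> = gc * (1 + c)\<^sup>2 * (N + Q * A) + gc * c\<^sup>2 * \<delta> * (Q * Y)"
          by (simp add: algebra_simps)
        also have "gc * c\<^sup>2 * \<delta> * (Q * Y) \<le> 1 / 8 * (Q * Y)"
          using \<delta>gc Q0 Y0 by (intro mult_right_mono) auto
        finally show ?thesis by simp
      qed
      finally have "norm (hist r x t) \<le> 1 / 4 * (Q * Y) + gc * (1 + c)\<^sup>2 * (N + Q * A)" by simp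
      then have "exp (\<omega> * t) * norm (hist r x t)
          \<le> exp (\<omega> * t) * (1 / 4 * (Q * Y) + gc * (1 + c)\<^sup>2 * (N + Q * A))"
        by (intro mult_left_mono) auto
      also have "\<dots> = 1 / 4 * (exp (\<omega> * t) * Q) * Y + gc * (1 + c)\<^sup>2 * (exp (\<omega> * t) * N + (exp (\<omega> * t) * Q) * A)"
        by (simp add: algebra_simps)
      also have "\<dots> \<le> 1 / 4 * 2 * Y + gc * (1 + c)\<^sup>2 * (exp (\<omega> * T) * N + 2 * A)"
      proof -
        have "exp (\<omega> * t) * Q = exp (\<omega> * T1)"
          by (simp add: Q_def exp_add[symmetric] algebra_simps)
        then show ?thesis using q Y0 gc A N t \<omega>
          by (intro add_mono mult_mono mult_left_mono mult_right_mono) auto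
      qed
      also have "\<dots> \<le> Y / 2 + C2 * W"
      proof -
        have "gc * (1 + c)\<^sup>2 * (exp (\<omega> * T) * N + 2 * A) \<le> gc * (1 + c)\<^sup>2 * (2 * W)"
          using gc A N by (intro mult_left_mono) (auto simp: W_def)
        moreover have "0 \<le> gc1 * (1 + c) * W" using gc c_pos W0 by auto
        ultimately show ?thesis by (simp add: C2_def algebra_simps)
      qed
      finally show ?thesis .
    qed
    have "Y \<le> 2 * C2 * W" using step[OF t1(1)] unfolding Y_def by simp
    then have "norm (hist r x T) \<le> exp (- \<omega> * T) * (2 * C2 * W)"
      using XY[of T] T by (smt (verit) atLeastAtMost_iff exp_ge_zero mult_left_mono)
    also have "\<dots> = 2 * C2 * (exp (- \<omega> * T) * (norm x0 + A) + exp (- \<omega> * T) * exp (\<omega> * T) * N)"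
      by (simp add: W_def algebra_simps)
    also have "exp (- \<omega> * T) * exp (\<omega> * T) = 1" by (simp add: exp_add[symmetric])
    finally show "norm (hist r x T) \<le> 2 * C2 * (exp (- \<omega> * T) * (norm x0 + A) + N)" by simp
  qed (use \<delta> \<omega> C2 in auto)
qed

end

section \<open>Inputs, comparison functions and sampling sequences\<close>

lemma Linf_loc_bounded:
  assumes "d \<in> Linf_loc D" "t \<ge> 0"
  obtains B where "B \<ge> 0" "\<And>s. s \<in> {0..t} \<Longrightarrow> norm (d s) \<le> B"
proof -
  obtain B where "\<forall>s\<in>{0..t}. norm (d s) \<le> B"
    using assms unfolding Linf_loc_def bounded_iff by auto
  then show ?thesis using that[of "max B 0"] by (fastforce simp: le_max_iff_disj)
qed

lemma Linf_loc_continuous: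
  assumes "continuous_on {0..} v"
  shows "v \<in> Linf_loc UNIV"
proof -
  have "bounded (v ` {0..t})" for t
    by (intro compact_imp_bounded compact_continuous_image continuous_on_subset[OF assms]) auto
  then show ?thesis
    using assms by (auto simp: Linf_loc_def intro!: continuous_imp_measurable_on_sets_lebesgue)
qed

lemma Linf_loc_diff:
  assumes "v \<in> Linf_loc UNIV" "v' \<in> Linf_loc UNIV"
  shows "(\<lambda>t. v t - v' t) \<in> Linf_loc UNIV"
proof -
  have "bounded ((\<lambda>s. v s - v' s) ` {0..t})" if "t \<ge> 0" for t
    using assms that by (intro bounded_minus_comp) (auto simp: Linf_loc_def)
  then show ?thesis using assms by (auto simp: Linf_loc_def)
qed

lemma Linf_loc_glue:
  assumes "v \<in> Linf_loc UNIV" "v' \<in> Linf_loc UNIV"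
  shows "(\<lambda>t. if t < s then v t else v' t) \<in> Linf_loc UNIV"
proof -
  have "bounded ((\<lambda>t. if t < s then v t else v' t) ` {0..t})" if "t \<ge> 0" for t
    by (rule bounded_subset[of "v ` {0..t} \<union> v' ` {0..t}"])
      (use assms that in \<open>auto simp: Linf_loc_def\<close>)
  moreover have "(\<lambda>t. if t < s then v t else v' t) \<in> borel_measurable (lebesgue_on {0..})"
  proof (rule measurable_If)
    have "{..<s} \<inter> {0..} \<in> sets (lebesgue_on {0..})"
      by (auto simp: sets_restrict_space_iff)
    moreover have "{t \<in> space (lebesgue_on {0..}). t < s} = {..<s} \<inter> {0..}" by auto
    ultimately show "{t \<in> space (lebesgue_on {0..}). t < s} \<in> sets (lebesgue_on {0..})" by simp
  qed (use assms in \<open>auto simp: Linf_loc_def\<close>)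
  ultimately show ?thesis by (auto simp: Linf_loc_def)
qed

text \<open>
  Signals are constructed one sampling interval after the other. Nothing uniform is known about the
  stages, but they agree on longer and longer initial intervals, and admissibility is a local property.
\<close>
lemma Linf_loc_exhaustion:
  assumes "filterlim \<tau> at_top sequentially"
    and "\<And>n::nat. \<exists>v\<in>Linf_loc UNIV. \<forall>t\<in>{0..<\<tau> n}. u t = v t"
  shows "u \<in> Linf_loc UNIV"
proof -
  obtain V where V: "\<And>n. V n \<in> Linf_loc UNIV" "\<And>n t. t \<in> {0..<\<tau> n} \<Longrightarrow> u t = V n t"
    using assms(2) by metis
  have ev: "\<forall>\<^sub>F n in sequentially. \<tau> n > t" for t
    using assms(1) by (simp add: filterlim_at_top_dense)
  have "u \<in> borel_measurable (lebesgue_on {0..})"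
  proof (rule borel_measurable_LIMSEQ_metric)
    show "V n \<in> borel_measurable (lebesgue_on {0..})" for n using V(1) by (simp add: Linf_loc_def)
    fix t assume "t \<in> space (lebesgue_on {0::real..})"
    then have "\<forall>\<^sub>F n in sequentially. V n t = u t"
      using ev[of t] V(2) by (auto elim!: eventually_mono)
    then show "(\<lambda>n. V n t) \<longlonglongrightarrow> u t" by (rule tendsto_eventually)
  qed
  moreover have "bounded (u ` {0..t})" if "t \<ge> 0" for t
  proof -
    obtain n where "\<tau> n > t" using ev[of t] by (auto simp: eventually_sequentially)
    then have "u ` {0..t} = V n ` {0..t}" using V(2) by (intro image_cong) auto
    moreover have "bounded (V n ` {0..t})" using V(1) that by (auto simp: Linf_loc_def)
    ultimately show ?thesis by simp
  qed
  ultimately show ?thesis by (auto simp: Linf_loc_def)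
qed

lemma sampling_mono: "sampling_sequence \<delta> \<tau> \<Longrightarrow> i \<le> j \<Longrightarrow> \<tau> i \<le> \<tau> j"
proof -
  assume s: "sampling_sequence \<delta> \<tau>" and ij: "i \<le> j"
  have "\<tau> n \<le> \<tau> (Suc n)" for n using s by (simp add: sampling_sequence_def less_imp_le)
  then show ?thesis using ij by (rule lift_Suc_mono_le)
qed

lemma sampling_nonneg: "sampling_sequence \<delta> \<tau> \<Longrightarrow> 0 \<le> \<tau> i"
  using sampling_mono[of \<delta> \<tau> 0 i] by (simp add: sampling_sequence_def)

lemma sampling_gap: "sampling_sequence \<delta> \<tau> \<Longrightarrow> \<tau> i < \<tau> (Suc i) \<and> \<tau> (Suc i) - \<tau> i \<le> \<delta>"
  by (simp add: sampling_sequence_def)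

lemma sampling_unbounded:
  assumes "sampling_sequence \<delta> \<tau>"
  obtains i where "t < \<tau> i"
proof -
  have "\<forall>\<^sub>F n in sequentially. \<tau> n > t"
    using assms by (simp add: sampling_sequence_def filterlim_at_top_dense)
  then show ?thesis using that by (auto simp: eventually_sequentially)
qed

lemma sampling_interval:
  assumes "sampling_sequence \<delta> \<tau>" "t \<ge> 0"
  obtains i where "\<tau> i \<le> t" "t < \<tau> (Suc i)"
proof -
  define i where "i = (LEAST i. t < \<tau> i)"
  obtain j where "t < \<tau> j" by (rule sampling_unbounded[OF assms(1)])
  then have i: "t < \<tau> i" unfolding i_def by (rule LeastI)
  moreover have "\<tau> 0 = 0" using assms(1) by (simp add: sampling_sequence_def)
  then have "i \<noteq> 0" using i assms(2) by (cases i) auto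
  then obtain j where j: "i = Suc j" using not0_implies_Suc by blast
  moreover have "\<not> t < \<tau> j" using not_less_Least[of j "\<lambda>i. t < \<tau> i"] j by (simp add: i_def)
  ultimately show ?thesis using that[of j] by simp
qed

lemma Linf_loc_sampling:
  assumes "sampling_sequence \<delta> \<tau>"
    and "\<And>i. \<exists>v\<in>Linf_loc UNIV. \<forall>t\<in>{\<tau> i..<\<tau> (Suc i)}. u t = v t"
  shows "u \<in> Linf_loc UNIV"
proof (rule Linf_loc_exhaustion)
  show "filterlim \<tau> at_top sequentially" using assms(1) by (simp add: sampling_sequence_def)
  fix n
  show "\<exists>v\<in>Linf_loc UNIV. \<forall>t\<in>{0..<\<tau> n}. u t = v t"
  proof (induction n)
    case 0
    then show ?case using assms(1)
      by (intro bexI[of _ "\<lambda>_. 0"]) (auto simp: sampling_sequence_def intro!: Linf_loc_continuous)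
  next
    case (Suc n)
    then obtain v where v: "v \<in> Linf_loc UNIV" "\<forall>t\<in>{0..<\<tau> n}. u t = v t" by blast
    obtain v' where v': "v' \<in> Linf_loc UNIV" "\<forall>t\<in>{\<tau> n..<\<tau> (Suc n)}. u t = v' t"
      using assms(2) by blast
    then show ?case using v
      by (intro bexI[of _ "\<lambda>t. if t < \<tau> n then v t else v' t"] Linf_loc_glue) auto
  qed
qed

lemma class_K_mono: "g \<in> class_K \<Longrightarrow> 0 \<le> s \<Longrightarrow> s \<le> t \<Longrightarrow> g s \<le> g t"
  unfolding class_K_def using strict_mono_on_leD[of "{0..}" g s t] by auto

lemma class_K_nonneg: "g \<in> class_K \<Longrightarrow> 0 \<le> s \<Longrightarrow> 0 \<le> g s"
  using class_K_mono[of g 0 s] by (simp add: class_K_def)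

lemma class_K_add: "g \<in> class_K \<Longrightarrow> g' \<in> class_K \<Longrightarrow> (\<lambda>s. g s + g' s) \<in> class_K"
  by (auto simp: class_K_def strict_mono_on_def intro!: continuous_intros add_strict_mono)

lemma class_K_scale: "c > 0 \<Longrightarrow> g \<in> class_K \<Longrightarrow> (\<lambda>s. c * g s) \<in> class_K"
  by (auto simp: class_K_def strict_mono_on_def intro!: continuous_intros)

lemma class_K_id: "(\<lambda>s. s) \<in> class_K"
  by (auto simp: class_K_def strict_mono_on_def)

lemma class_K_sup:
  assumes "g \<in> class_K" "d \<in> Linf_loc D" "t \<ge> 0"
  shows class_K_sup_bdd: "bdd_above ((\<lambda>s. g (norm (d s))) ` {0..t})"
    and class_K_sup_upper: "s \<in> {0..t} \<Longrightarrow> g (norm (d s)) \<le> (SUP s\<in>{0..t}. g (norm (d s)))"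
    and class_K_sup_nonneg: "0 \<le> (SUP s\<in>{0..t}. g (norm (d s)))"
proof -
  obtain B where B: "\<And>s. s \<in> {0..t} \<Longrightarrow> norm (d s) \<le> B"
    by (rule Linf_loc_bounded[OF assms(2,3)]) blast
  show bdd: "bdd_above ((\<lambda>s. g (norm (d s))) ` {0..t})"
    using B class_K_mono[OF assms(1)] by (intro bdd_aboveI2[of _ _ "g B"]) auto
  show up: "g (norm (d s)) \<le> (SUP s\<in>{0..t}. g (norm (d s)))" if "s \<in> {0..t}" for s
    by (rule cSUP_upper[OF that bdd])
  show "0 \<le> (SUP s\<in>{0..t}. g (norm (d s)))"
    using up[of 0] class_K_nonneg[OF assms(1), of "norm (d 0)"] assms(3) by auto
qed

section \<open>Equations with continuous right-hand side\<close>

lemma integral_Lipschitz: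
  fixes G :: "real \<Rightarrow> 'b::euclidean_space"
  assumes "continuous_on {p..q} G" "\<And>t. t \<in> {p..q} \<Longrightarrow> norm (G t) \<le> B"
    and "s \<in> {p..q}" "t \<in> {p..q}"
  shows "norm (integral {p..s} G - integral {p..t} G) \<le> B * \<bar>s - t\<bar>"
proof -
  have *: "norm (integral {p..t} G - integral {p..s} G) \<le> B * (t - s)"
    if "s \<le> t" "s \<in> {p..q}" "t \<in> {p..q}" for s t
  proof -
    have "integral {p..s} G + integral {s..t} G = integral {p..t} G"
      using that by (intro Henstock_Kurzweil_Integration.integral_combine integrable_continuous_real continuous_on_subset[OF assms(1)]) auto
    then have "integral {p..t} G - integral {p..s} G = integral {s..t} G" by (simp add: algebra_simps)
    moreover have "norm (integral {s..t} G) \<le> B * (t - s)"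
      using that by (intro integral_bound continuous_on_subset[OF assms(1)] assms(2)) auto
    ultimately show ?thesis by simp
  qed
  show ?thesis
    using *[of s t] *[of t s] assms(3,4) by (cases "s \<le> t") (auto simp: norm_minus_commute)
qed

lemma has_vector_derivative_indefinite_integral:
  fixes G :: "real \<Rightarrow> 'b::euclidean_space"
  assumes "continuous_on {p..q} G" "t \<in> {p<..<q}"
  shows "((\<lambda>t. integral {p..t} G) has_vector_derivative G t) (at t)"
proof -
  have "((\<lambda>t. integral {p..t} G) has_vector_derivative G t) (at t within {p..q})"
    using assms by (intro integral_has_vector_derivative) auto
  moreover have "at t within {p..q} = at t" using assms(2) by (intro at_within_interior) auto
  ultimately show ?thesis by simp
qed

lemma ae_ode_integral:
  fixes G :: "real \<Rightarrow> 'b::euclidean_space"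
  assumes G: "continuous_on {p..q} G" and w: "\<And>t. t \<in> {p..<q} \<Longrightarrow> w t = w0 + integral {p..t} G"
  shows "ae_ode {p..<q} w G"
proof (rule ae_odeI[where N = "{p}"])
  obtain B where B: "B \<ge> 0" "\<And>t. t \<in> {p..q} \<Longrightarrow> norm (G t) \<le> B"
    by (rule bounded_continuous_real[OF G]) blast
  show "abs_cont_on a b w" if "a \<le> b" "{a..b} \<subseteq> {p..<q}" for a b
  proof (rule abs_cont_on_Lipschitz[OF B(1)])
    fix s t assume "a \<le> s" "s \<le> t" "t \<le> b"
    then have "s \<in> {a..b}" "t \<in> {a..b}" "s \<le> t" by auto
    then have "s \<in> {p..<q}" "t \<in> {p..<q}" "s \<le> t" using that(2) by blast+
    then show "norm (w t - w s) \<le> B * (t - s)"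
      using integral_Lipschitz[OF G B(2), of t s] w by auto
  qed
  fix t assume t: "t \<in> {p..<q} - {p}"
  have d: "((\<lambda>t. w0 + integral {p..t} G) has_vector_derivative (0 + G t)) (at t)"
    using t by (intro has_vector_derivative_add has_vector_derivative_indefinite_integral[OF G]) auto
  have "(w has_vector_derivative (0 + G t)) (at t)"
  proof (rule has_vector_derivative_transform_within_open[OF d])
    show "open {p<..<q}" "t \<in> {p<..<q}" using t by auto
    show "w0 + integral {p..s} G = w s" if "s \<in> {p<..<q}" for s using w[of s] that by simp
  qed
  then show "(w has_vector_derivative G t) (at t)" by simp
qed auto

lemma ae_ode_imp_integral:
  fixes G :: "real \<Rightarrow> 'b::euclidean_space"
  assumes G: "continuous_on {p..q} G" and w: "ae_ode {p..<q} w G" and t: "t \<in> {p..<q}"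
  shows "w t = w p + integral {p..t} G"
proof -
  define W where "W t = w t - integral {p..t} G" for t
  obtain B where B: "B \<ge> 0" "\<And>t. t \<in> {p..q} \<Longrightarrow> norm (G t) \<le> B"
    by (rule bounded_continuous_real[OF G]) blast
  obtain N where N: "negligible N" "\<And>t. t \<in> {p..<q} - N \<Longrightarrow> (w has_vector_derivative G t) (at t)"
    by (rule ae_ode_negligible[OF w]) auto
  have "norm (W t - W p) \<le> 0 * (t - p)"
  proof (rule abs_cont_norm_increment_le[OF _ _ N(1), where g = "\<lambda>_. 0"])
    show "abs_cont_on p t W"
      unfolding W_def
    proof (rule abs_cont_on_diff)
      have "p \<le> t" "{p..t} \<subseteq> {p..<q}" using t by auto
      then show "abs_cont_on p t w" using w unfolding ae_ode_def by blast
      show "abs_cont_on p t (\<lambda>t. integral {p..t} G)"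
      proof (rule abs_cont_on_Lipschitz[OF B(1)])
        fix s s' assume "p \<le> s" "s \<le> s'" "s' \<le> t"
        then show "norm (integral {p..s'} G - integral {p..s} G) \<le> B * (s' - s)"
          using integral_Lipschitz[OF G B(2), of s' s] t by auto
      qed
    qed
    fix s assume "s \<in> {p<..<t} - N"
    then have "(W has_vector_derivative (G s - G s)) (at s)"
      unfolding W_def using t N(2) by (intro has_vector_derivative_diff has_vector_derivative_indefinite_integral[OF G]) auto
    then show "(W has_vector_derivative 0) (at s) \<and> norm (0::'b) \<le> 0" by simp
  qed (use t in auto)
  then show ?thesis by (simp add: W_def algebra_simps)
qed

lemma continuous_on_clamped:
  fixes v :: "real \<Rightarrow> 'b::topological_space"
  assumes "continuous_on {p..q} v" "p \<le> q"
  shows "continuous_on A (\<lambda>t. v (max p (min q t)))"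
  using assms(2) by (intro continuous_on_compose2[OF assms(1)] continuous_intros) auto

lemma delay_sol_cong:
  assumes "\<And>t. t \<ge> 0 \<Longrightarrow> g t = g' t"
  shows "delay_sol r x0 g x = delay_sol r x0 g' x"
proof -
  have "(AE t in lebesgue_on {0..}. (x has_vector_derivative g t) (at t)) \<longleftrightarrow>
      (AE t in lebesgue_on {0..}. (x has_vector_derivative g' t) (at t))"
    using assms by (intro AE_cong) auto
  then show ?thesis by (simp add: delay_sol_def ae_ode_def)
qed

section \<open>The small-gain argument\<close>

text \<open>
  \<open>X\<close> is the output mismatch and \<open>E\<close> the observer error. Both estimates are read in terms of the supremum \<open>S\<close>
  of \<open>X(s) exp(\<sigma>s)\<close>: the first turns \<open>S\<close> into a bound of \<open>E\<close> with gain \<open>\<gamma>\<close>, the second turns this back into a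
  bound of \<open>S\<close> with gain \<open>\<delta> L exp \<sigma>\<close>, where \<open>exp \<sigma>\<close> compensates the change of the weight over one sampling
  interval. As the product of the gains is at most one half, \<open>S\<close> is absorbed.
\<close>
lemma small_gain:
  fixes E X :: "real \<Rightarrow> real"
  assumes T: "T \<ge> 0" and \<sigma>: "\<sigma> > 0" and \<delta>: "\<delta> \<le> 1" "\<delta> > 0" and nn: "\<gamma> \<ge> 0" "L \<ge> 0" "A \<ge> 0" "G \<ge> 0" "\<Xi> \<ge> 0" "P \<ge> 0"
    and small: "\<delta> * L * exp \<sigma> * \<gamma> \<le> 1 / 2"
    and X0: "\<And>t. t \<in> {0..T} \<Longrightarrow> 0 \<le> X t" and Xbd: "\<And>t. t \<in> {0..T} \<Longrightarrow> X t \<le> XB"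
    and E: "\<And>t. t \<in> {0..T} \<Longrightarrow> E t \<le> exp (- \<sigma> * t) * A + \<gamma> * (SUP s\<in>{0..t}. X s * exp (- \<sigma> * (t - s))) + G"
    and X: "\<And>t. t \<in> {0..T} \<Longrightarrow> \<exists>p\<in>{0..t}. t - p \<le> \<delta> \<and>
        (\<forall>B. (\<forall>s\<in>{p..t}. E s \<le> B) \<longrightarrow> X t \<le> \<Xi> + \<delta> * (L * B + P))"
  shows "E T \<le> exp (- \<sigma> * T) * ((1 + 2 * \<gamma> * L * exp \<sigma>) * A) + (G + 2 * \<gamma> * (\<Xi> + L * G + P))"
proof -
  define S where "S = (SUP s\<in>{0..T}. X s * exp (\<sigma> * s))"
  have bdd: "bdd_above ((\<lambda>s. X s * exp (\<sigma> * s)) ` {0..T})"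
  proof (rule bdd_aboveI2)
    fix s assume s: "s \<in> {0..T}"
    then show "X s * exp (\<sigma> * s) \<le> XB * exp (\<sigma> * T)"
      using X0[OF s] Xbd[OF s] \<sigma> by (intro mult_mono) auto
  qed
  have S_up: "X s * exp (\<sigma> * s) \<le> S" if "s \<in> {0..T}" for s
    unfolding S_def by (rule cSUP_upper[OF that bdd])
  have S0: "S \<ge> 0" using S_up[of 0] X0[of 0] T by auto
  have E': "E t \<le> exp (- \<sigma> * t) * (A + \<gamma> * S) + G" if t: "t \<in> {0..T}" for t
  proof -
    have "(SUP s\<in>{0..t}. X s * exp (- \<sigma> * (t - s))) \<le> exp (- \<sigma> * t) * S"
    proof (rule cSUP_least)
      fix s assume s: "s \<in> {0..t}"
      have "X s * exp (- \<sigma> * (t - s)) = exp (- \<sigma> * t) * (X s * exp (\<sigma> * s))"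
        by (simp add: exp_add[symmetric] algebra_simps)
      also have "\<dots> \<le> exp (- \<sigma> * t) * S" using S_up s t by (intro mult_left_mono) auto
      finally show "X s * exp (- \<sigma> * (t - s)) \<le> exp (- \<sigma> * t) * S" .
    qed (use t in auto)
    then have "\<gamma> * (SUP s\<in>{0..t}. X s * exp (- \<sigma> * (t - s))) \<le> \<gamma> * (exp (- \<sigma> * t) * S)"
      using nn by (intro mult_left_mono) auto
    then show ?thesis using E[OF t] by (simp add: algebra_simps)
  qed
  define Q where "Q = \<Xi> + L * G + P"
  have Q0: "Q \<ge> 0" using nn by (simp add: Q_def)
  have "X t * exp (\<sigma> * t) \<le> L * exp \<sigma> * A + exp (\<sigma> * T) * Q + S / 2" if t: "t \<in> {0..T}" for t
  proof -
    obtain p where p: "p \<in> {0..t}" "t - p \<le> \<delta>"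
      "\<And>B. (\<forall>s\<in>{p..t}. E s \<le> B) \<Longrightarrow> X t \<le> \<Xi> + \<delta> * (L * B + P)"
      using X[OF t] by blast
    have AS: "A + \<gamma> * S \<ge> 0" using nn S0 by simp
    have "\<forall>s\<in>{p..t}. E s \<le> exp (- \<sigma> * p) * (A + \<gamma> * S) + G"
    proof
      fix s assume s: "s \<in> {p..t}"
      have "exp (- \<sigma> * s) * (A + \<gamma> * S) \<le> exp (- \<sigma> * p) * (A + \<gamma> * S)"
        using s \<sigma> AS by (intro mult_right_mono) auto
      then show "E s \<le> exp (- \<sigma> * p) * (A + \<gamma> * S) + G" using E'[of s] s p t by auto
    qed
    then have "X t \<le> \<Xi> + \<delta> * (L * (exp (- \<sigma> * p) * (A + \<gamma> * S) + G) + P)" by (rule p(3))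
    then have "X t * exp (\<sigma> * t) \<le> (\<Xi> + \<delta> * (L * (exp (- \<sigma> * p) * (A + \<gamma> * S) + G) + P)) * exp (\<sigma> * t)"
      by (intro mult_right_mono) auto
    also have "\<dots> = exp (\<sigma> * t) * (\<Xi> + \<delta> * (L * G + P)) + \<delta> * L * (exp (\<sigma> * t) * exp (- \<sigma> * p)) * (A + \<gamma> * S)"
      by (simp add: algebra_simps)
    also have "exp (\<sigma> * t) * (\<Xi> + \<delta> * (L * G + P)) \<le> exp (\<sigma> * T) * Q"
    proof (rule mult_mono)
      have "\<delta> * (L * G + P) \<le> 1 * (L * G + P)" using \<delta> nn by (intro mult_right_mono) auto
      then show "\<Xi> + \<delta> * (L * G + P) \<le> Q" by (simp add: Q_def)
    qed (use t \<sigma> nn \<delta> in auto)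
    also have "\<delta> * L * (exp (\<sigma> * t) * exp (- \<sigma> * p)) * (A + \<gamma> * S) \<le> \<delta> * L * exp \<sigma> * (A + \<gamma> * S)"
    proof -
      have "\<sigma> * (t - p) \<le> \<sigma> * 1" using p \<delta> \<sigma> by (intro mult_left_mono) auto
      then have "exp (\<sigma> * t) * exp (- \<sigma> * p) \<le> exp \<sigma>"
        by (simp add: exp_add[symmetric] algebra_simps)
      then show ?thesis using \<delta> nn AS by (intro mult_right_mono mult_left_mono) auto
    qed
    also have "\<dots> = \<delta> * (L * exp \<sigma> * A) + \<delta> * L * exp \<sigma> * \<gamma> * S" by (simp add: algebra_simps)
    also have "\<delta> * (L * exp \<sigma> * A) \<le> 1 * (L * exp \<sigma> * A)" using \<delta> nn by (intro mult_right_mono) auto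
    also have "\<delta> * L * exp \<sigma> * \<gamma> * S \<le> 1 / 2 * S" using small S0 by (rule mult_right_mono)
    finally show ?thesis by simp
  qed
  then have "S \<le> L * exp \<sigma> * A + exp (\<sigma> * T) * Q + S / 2"
    unfolding S_def using T by (intro cSUP_least) auto
  then have "S \<le> 2 * (L * exp \<sigma> * A + exp (\<sigma> * T) * Q)" by simp
  then have "exp (- \<sigma> * T) * (A + \<gamma> * S) \<le> exp (- \<sigma> * T) * (A + \<gamma> * (2 * (L * exp \<sigma> * A + exp (\<sigma> * T) * Q)))"
    using nn by (intro mult_left_mono add_left_mono) auto
  also have "\<dots> = exp (- \<sigma> * T) * ((1 + 2 * \<gamma> * L * exp \<sigma>) * A) + (exp (- \<sigma> * T) * exp (\<sigma> * T)) * (2 * \<gamma> * Q)"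
    by (simp add: algebra_simps)
  also have "exp (- \<sigma> * T) * exp (\<sigma> * T) = 1" by (simp add: exp_add[symmetric])
  finally show ?thesis using E'[of T] T by (simp add: Q_def)
qed

section \<open>The observer with inter-sample prediction\<close>

locale observed_plant =
  fixes r :: real and D :: "(real^'q) set"
    and f :: "(real \<Rightarrow>\<^sub>C (real^'n)) \<times> (real^'m) \<times> (real^'q) \<Rightarrow> real^'n"
    and h :: "(real \<Rightarrow>\<^sub>C (real^'n)) \<Rightarrow> real^'k"
    and R :: "(real \<Rightarrow>\<^sub>C (real^'n)) \<times> (real^'m) \<times> (real^'q) \<Rightarrow> real^'k"
    and F :: "(real \<Rightarrow>\<^sub>C (real^'l)) \<times> (real^'k) \<times> (real^'m) \<Rightarrow> real^'l"
    and \<Psi> :: "(real \<Rightarrow>\<^sub>C (real^'l)) \<Rightarrow> (real \<Rightarrow>\<^sub>C (real^'n))"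
    and \<gamma> \<sigma> :: real and g a :: "real \<Rightarrow> real" and L :: real and \<kappa> :: "real \<Rightarrow> real"
  assumes r: "r > 0" and zero_in_D: "0 \<in> D"
    and f_one_sided: "one_sided_Lipschitz r (UNIV \<times> D) f"
    and h_cont: "continuous_on (C0 r) h"
    and forward_complete: "\<And>x0 u d. x0 \<in> C0 r \<Longrightarrow> u \<in> Linf_loc UNIV \<Longrightarrow> d \<in> Linf_loc D \<Longrightarrow>
      \<exists>x. delay_sol r x0 (\<lambda>t. f (hist r x t, u t, d t)) x"
    and R_cont: "continuous_on (C0 r \<times> UNIV \<times> D) R"
    and output_derivative: "\<And>x0 u d x. x0 \<in> C0 r \<Longrightarrow> u \<in> Linf_loc UNIV \<Longrightarrow> d \<in> Linf_loc D \<Longrightarrow>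
      delay_sol r x0 (\<lambda>t. f (hist r x t, u t, d t)) x \<Longrightarrow>
      ae_ode {0..} (\<lambda>t. h (hist r x t)) (\<lambda>t. R (hist r x t, u t, d t))"
    and L: "L \<ge> 0" and \<kappa>: "\<kappa> \<in> class_K"
    and R_Lipschitz: "\<And>x x' u d. x \<in> C0 r \<Longrightarrow> x' \<in> C0 r \<Longrightarrow> d \<in> D \<Longrightarrow>
      norm (R (x', u, 0) - R (x, u, d)) \<le> L * norm (x' - x) + \<kappa> (norm d)"
    and REO: "is_REO r D f h F \<Psi> \<gamma> \<sigma> g a"
begin

abbreviation plant where
  "plant u d x0 x \<equiv> delay_sol r x0 (\<lambda>t. f (hist r x t, u t, d t)) x"

abbreviation observer where
  "observer w u z0 z \<equiv> delay_sol r z0 (\<lambda>t. F (hist r z t, w t, u t)) z"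

lemma F_cont: "continuous_on (C0 r \<times> UNIV) F"
  using REO by (simp add: is_REO_def)

lemma F_one_sided: "one_sided_Lipschitz r UNIV F"
  unfolding one_sided_Lipschitz_def
proof (intro allI impI)
  fix S :: "((real \<Rightarrow>\<^sub>C (real^'l)) \<times> (real^'k) \<times> (real^'m)) set"
  assume "S \<subseteq> C0 r \<times> UNIV" "bounded S"
  then have "\<exists>L\<ge>0. \<forall>z z' y u. (z, y, u) \<in> S \<and> (z', y, u) \<in> S \<longrightarrow>
      (apply_bcontfun z 0 - apply_bcontfun z' 0) \<bullet> (F (z, y, u) - F (z', y, u)) \<le> L * (norm (z - z'))\<^sup>2"
    using REO by (simp add: is_REO_def)
  then show "\<exists>L\<ge>0. \<forall>\<phi> \<psi> v. (\<phi>, v) \<in> S \<and> (\<psi>, v) \<in> S \<longrightarrow>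
      (apply_bcontfun \<phi> 0 - apply_bcontfun \<psi> 0) \<bullet> (F (\<phi>, v) - F (\<psi>, v)) \<le> L * (norm (\<phi> - \<psi>))\<^sup>2"
    by (simp add: split_paired_All)
qed

lemma Psi_C0: "\<phi> \<in> C0 r \<Longrightarrow> \<Psi> \<phi> \<in> C0 r"
  and Psi_cont: "continuous_on (C0 r) \<Psi>"
  and gamma_pos: "\<gamma> > 0" and sigma_pos: "\<sigma> > 0" and g_K: "g \<in> class_K" and a_K: "a \<in> class_K"
  using REO by (auto simp: is_REO_def class_K_inf_def)

lemma a_nonneg: "0 \<le> a (norm x + norm z)"
  using class_K_nonneg[OF a_K] by simp

lemma bounded_pair_input:
  assumes "u \<in> Linf_loc A" "v \<in> Linf_loc B"
  shows "bounded ((\<lambda>t. (u t, v t)) ` {0<..<T})"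
proof (rule bounded_subset)
  show "bounded (u ` {0..max T 0} \<times> v ` {0..max T 0})"
    using assms by (intro bounded_Times) (auto simp: Linf_loc_def)
qed auto

lemma plant_causal:
  assumes "plant u d x0 x" "plant u' d x0 x'" "u \<in> Linf_loc UNIV" "d \<in> Linf_loc D"
    and "\<And>t. t \<in> {0..<T} \<Longrightarrow> u t = u' t" "t \<in> {-r..T}"
  shows "x t = x' t"
proof (rule delay_sol_causal[where v = "\<lambda>t. (u t, d t)" and v' = "\<lambda>t. (u' t, d t)",
      OF _ f_one_sided assms(1,2) _ bounded_pair_input[OF assms(3,4)] _ assms(6)])
  show "(\<lambda>t. (u t, d t)) ` {0<..<T} \<subseteq> UNIV \<times> D" using assms(4) by (auto simp: Linf_loc_def)
qed (use assms(5) r in auto)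

lemma observer_causal:
  assumes "observer w u z0 z" "observer w' u' z0 z'" "w \<in> Linf_loc UNIV" "u \<in> Linf_loc UNIV"
    and "\<And>t. t \<in> {0..<T} \<Longrightarrow> w t = w' t" "\<And>t. t \<in> {0..<T} \<Longrightarrow> u t = u' t" "t \<in> {-r..T}"
  shows "z t = z' t"
  by (rule delay_sol_causal[where v = "\<lambda>t. (w t, u t)" and v' = "\<lambda>t. (w' t, u' t)",
      OF _ F_one_sided assms(1,2) _ bounded_pair_input[OF assms(3,4)] _ assms(7)])
    (use assms(5,6) r in auto)

lemma hist_sol_C0: "delay_sol r x0 G x \<Longrightarrow> t \<ge> 0 \<Longrightarrow> hist r x t \<in> C0 r"
  using r by (intro hist_in_C0 delay_sol_cont) auto

lemma output_cont: "delay_sol r x0 G x \<Longrightarrow> continuous_on {0..} (\<lambda>t. h (hist r x t))"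
  using r hist_sol_C0
  by (intro continuous_on_compose2[OF h_cont] continuous_on_hist_atLeast delay_sol_cont) auto

lemma R_Psi_cont: "continuous_on (C0 r) (\<lambda>\<phi>. R (\<Psi> \<phi>, c, 0))"
  using zero_in_D Psi_C0 by (intro continuous_on_compose2[OF R_cont] continuous_intros Psi_cont) auto

lemma predictor_cont:
  assumes "delay_sol r z0 G z" "p \<ge> 0"
  shows "continuous_on {p..q} (\<lambda>t. R (\<Psi> (hist r z t), c, 0))"
proof -
  have "continuous_on {0..} (\<lambda>t. R (\<Psi> (hist r z t), c, 0))"
    using r hist_sol_C0[OF assms(1)]
    by (intro continuous_on_compose2[OF R_Psi_cont] continuous_on_hist_atLeast delay_sol_cont[OF assms(1)]) auto
  then show ?thesis by (rule continuous_on_subset) (use assms(2) in auto)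
qed

lemma REO_property:
  assumes "x0 \<in> C0 r" "z0 \<in> C0 r" "u \<in> Linf_loc UNIV" "d \<in> Linf_loc D" "\<xi> \<in> Linf_loc UNIV"
  shows "\<exists>x z. plant u d x0 x \<and> delay_sol r z0 (\<lambda>t. F (hist r z t, h (hist r x t) + \<xi> t, u t)) z"
    and "plant u d x0 x \<Longrightarrow> delay_sol r z0 (\<lambda>t. F (hist r z t, h (hist r x t) + \<xi> t, u t)) z \<Longrightarrow> t \<ge> 0 \<Longrightarrow>
      norm (\<Psi> (hist r z t) - hist r x t) \<le> exp (- \<sigma> * t) * a (norm x0 + norm z0)
        + \<gamma> * (SUP s\<in>{0..t}. norm (\<xi> s) * exp (- \<sigma> * (t - s))) + (SUP s\<in>{0..t}. g (norm (d s)))"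
proof -
  note all = REO[unfolded is_REO_def Let_def, THEN conjunct2, THEN conjunct2, THEN conjunct2, THEN conjunct2,
    THEN conjunct2, THEN conjunct2, THEN conjunct2, THEN conjunct2, THEN conjunct2, THEN conjunct2]
  note inst = all[THEN bspec, OF assms(1), THEN bspec, OF assms(2), THEN bspec, OF assms(3),
    THEN bspec, OF assms(4), THEN bspec, OF assms(5)]
  show "\<exists>x z. plant u d x0 x \<and> delay_sol r z0 (\<lambda>t. F (hist r z t, h (hist r x t) + \<xi> t, u t)) z"
    by (rule inst[THEN conjunct1])
  show "norm (\<Psi> (hist r z t) - hist r x t) \<le> exp (- \<sigma> * t) * a (norm x0 + norm z0)
        + \<gamma> * (SUP s\<in>{0..t}. norm (\<xi> s) * exp (- \<sigma> * (t - s))) + (SUP s\<in>{0..t}. g (norm (d s)))"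
    if "plant u d x0 x" "delay_sol r z0 (\<lambda>t. F (hist r z t, h (hist r x t) + \<xi> t, u t)) z" "t \<ge> 0"
    by (rule inst[THEN conjunct2, rule_format, OF conjI[OF that(1,2)] that(3)])
qed

lemma zero_input: "(\<lambda>_. 0) \<in> Linf_loc D"
  using Linf_loc_continuous[of "\<lambda>_. 0::real^'q"] zero_in_D by (auto simp: Linf_loc_def)

text \<open>
  The observer property speaks of measurement errors rather than of measured signals. Any input \<open>w\<close> arises
  from the error \<open>w - h(x\<^sub>t)\<close>, where \<open>x\<close> is some trajectory of the plant, here the one that starts at rest.
\<close>
lemma observer_exists:
  assumes "z0 \<in> C0 r" "w \<in> Linf_loc UNIV" "u \<in> Linf_loc UNIV"
  shows "\<exists>z. observer w u z0 z"
proof -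
  note d = zero_input
  obtain x where x: "plant u (\<lambda>_. 0) 0 x"
    using forward_complete[OF zero_in_C0 assms(3) d] by blast
  define \<xi> where "\<xi> t = w t - h (hist r x t)" for t
  have "\<xi> \<in> Linf_loc UNIV"
    unfolding \<xi>_def by (intro Linf_loc_diff assms Linf_loc_continuous output_cont[OF x])
  then obtain x' z where x': "plant u (\<lambda>_. 0) 0 x'"
    and z: "delay_sol r z0 (\<lambda>t. F (hist r z t, h (hist r x' t) + \<xi> t, u t)) z"
    using REO_property(1)[OF zero_in_C0 assms(1,3) d] by blast
  have "hist r x' t = hist r x t" if "t \<ge> 0" for t
    using r that by (intro hist_cong plant_causal[OF x' x assms(3) d, where T = t]) auto
  then have "observer w u z0 z"
    using z by (subst delay_sol_cong[of _ "\<lambda>t. F (hist r z t, h (hist r x' t) + \<xi> t, u t)"]) (auto simp: \<xi>_def)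
  then show ?thesis by blast
qed

lemma observer_estimate:
  assumes "x0 \<in> C0 r" "z0 \<in> C0 r" and w: "w \<in> Linf_loc UNIV" and u: "u \<in> Linf_loc UNIV" and d: "d \<in> Linf_loc D"
    and x: "plant u d x0 x" and z: "observer w u z0 z" and t: "t \<ge> 0"
  shows "norm (\<Psi> (hist r z t) - hist r x t) \<le> exp (- \<sigma> * t) * a (norm x0 + norm z0)
    + \<gamma> * (SUP s\<in>{0..t}. norm (w s - h (hist r x s)) * exp (- \<sigma> * (t - s))) + (SUP s\<in>{0..t}. g (norm (d s)))"
proof -
  define \<xi> where "\<xi> t = w t - h (hist r x t)" for t
  have "\<xi> \<in> Linf_loc UNIV"
    unfolding \<xi>_def by (intro Linf_loc_diff w Linf_loc_continuous output_cont[OF x])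
  moreover have "delay_sol r z0 (\<lambda>t. F (hist r z t, h (hist r x t) + \<xi> t, u t)) z"
    using z by (simp add: \<xi>_def)
  ultimately show ?thesis
    using REO_property(2)[OF assms(1,2) u d _ x _ t] unfolding \<xi>_def by blast
qed

text \<open>
  Two points need care. The signals \<open>u\<close> and \<open>w\<close> of a closed-loop solution are admissible inputs: on each
  sampling interval \<open>w\<close> is the integral of a function that is continuous up to the right end point, so it has no
  blow-up there. And on such an interval the mismatch \<open>w - h(x\<^sub>t)\<close> starts at \<open>\<xi>(\<tau>\<^sub>i)\<close> and has the derivative
  \<open>R(\<Psi>(z\<^sub>t), u, 0) - R(x\<^sub>t, u, d)\<close>, which the Lipschitz property of \<open>R\<close> bounds.
\<close>
lemma closed_loop_error:
  assumes \<tau>: "sampling_sequence \<delta> \<tau>" and \<delta>: "\<delta> \<le> 1" "\<delta> * L * exp \<sigma> * \<gamma> \<le> 1 / 2"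
    and x0: "x0 \<in> C0 r" and z0: "z0 \<in> C0 r" and \<xi>: "\<xi> \<in> Linf_loc UNIV" and d: "d \<in> Linf_loc D"
    and sol: "closed_loop_sol r f h R k F \<Psi> \<tau> x0 z0 d \<xi> x z w u" and T: "T \<ge> 0"
  shows "norm (\<Psi> (hist r z T) - hist r x T)
     \<le> exp (- \<sigma> * T) * ((1 + 2 * \<gamma> * L * exp \<sigma>) * a (norm x0 + norm z0))
       + ((SUP s\<in>{0..T}. g (norm (d s))) + 2 * \<gamma> * ((SUP s\<in>{0..T}. norm (\<xi> s))
          + L * (SUP s\<in>{0..T}. g (norm (d s))) + (SUP s\<in>{0..T}. \<kappa> (norm (d s)))))"
proof -
  have x: "plant u d x0 x" and z: "observer w u z0 z"
    and w0: "\<And>i. w (\<tau> i) = h (hist r x (\<tau> i)) + \<xi> (\<tau> i)"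
    and w: "\<And>i. ae_ode {\<tau> i..<\<tau> (Suc i)} w (\<lambda>t. R (\<Psi> (hist r z t), u t, 0))"
    and u: "\<And>i t. t \<in> {\<tau> i..<\<tau> (Suc i)} \<Longrightarrow> u t = k (\<Psi> (hist r z (\<tau> i)))"
    using sol by (auto simp: closed_loop_sol_def)
  note \<tau>0 = sampling_nonneg[OF \<tau>] and gap = sampling_gap[OF \<tau>]
  have \<delta>0: "\<delta> > 0" using gap[of 0] by linarith
  have u_Linf: "u \<in> Linf_loc UNIV"
  proof (rule Linf_loc_sampling[OF \<tau>])
    show "\<exists>v\<in>Linf_loc UNIV. \<forall>t\<in>{\<tau> i..<\<tau> (Suc i)}. u t = v t" for i
      using u by (intro bexI[of _ "\<lambda>_. k (\<Psi> (hist r z (\<tau> i)))"] Linf_loc_continuous continuous_on_const) auto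
  qed
  have w_Linf: "w \<in> Linf_loc UNIV"
  proof (rule Linf_loc_sampling[OF \<tau>])
    fix i
    define c where "c = k (\<Psi> (hist r z (\<tau> i)))"
    define G where "G = (\<lambda>t. R (\<Psi> (hist r z t), c, 0))"
    define v where "v t = w (\<tau> i) + integral {\<tau> i..t} G" for t
    have G: "continuous_on {\<tau> i..\<tau> (Suc i)} G"
      unfolding G_def by (rule predictor_cont[OF z \<tau>0])
    have "ae_ode {\<tau> i..<\<tau> (Suc i)} w (\<lambda>t. R (\<Psi> (hist r z t), u t, 0)) = ae_ode {\<tau> i..<\<tau> (Suc i)} w G"
      unfolding ae_ode_def using u by (intro conj_cong AE_cong refl) (auto simp: G_def c_def)
    then have wG: "ae_ode {\<tau> i..<\<tau> (Suc i)} w G" using w by simp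
    have "continuous_on {\<tau> i..\<tau> (Suc i)} v"
      unfolding v_def using G
      by (intro continuous_intros indefinite_integral_continuous_1 integrable_continuous_real)
    then have "(\<lambda>t. v (max (\<tau> i) (min (\<tau> (Suc i)) t))) \<in> Linf_loc UNIV"
      using gap[of i] by (intro Linf_loc_continuous continuous_on_clamped) auto
    moreover have "w t = v (max (\<tau> i) (min (\<tau> (Suc i)) t))" if "t \<in> {\<tau> i..<\<tau> (Suc i)}" for t
      using ae_ode_imp_integral[OF G wG that] that by (simp add: v_def)
    ultimately show "\<exists>v\<in>Linf_loc UNIV. \<forall>t\<in>{\<tau> i..<\<tau> (Suc i)}. w t = v t"
      by (intro bexI[of _ "\<lambda>t. v (max (\<tau> i) (min (\<tau> (Suc i)) t))"] ballI)
  qed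
  define E where "E t = norm (\<Psi> (hist r z t) - hist r x t)" for t
  define X where "X t = norm (w t - h (hist r x t))" for t
  define Gs where "Gs = (SUP s\<in>{0..T}. g (norm (d s)))"
  define Ks where "Ks = (SUP s\<in>{0..T}. \<kappa> (norm (d s)))"
  define Xs where "Xs = (SUP s\<in>{0..T}. norm (\<xi> s))"
  have Gs: "Gs \<ge> 0" unfolding Gs_def by (rule class_K_sup_nonneg[OF g_K d T])
  have Ks: "Ks \<ge> 0" "\<And>s. s \<in> {0..T} \<Longrightarrow> \<kappa> (norm (d s)) \<le> Ks"
    unfolding Ks_def using class_K_sup_nonneg[OF \<kappa> d T] class_K_sup_upper[OF \<kappa> d T] by auto
  have Xs: "norm (\<xi> s) \<le> Xs" if "s \<in> {0..T}" for s
  proof -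
    obtain B where B: "\<And>s. s \<in> {0..T} \<Longrightarrow> norm (\<xi> s) \<le> B"
      by (rule Linf_loc_bounded[OF \<xi> T]) blast
    show ?thesis unfolding Xs_def using B by (intro cSUP_upper[OF that] bdd_aboveI2[of _ _ B]) auto
  qed
  have Xs0: "Xs \<ge> 0" using order.trans[OF norm_ge_zero Xs[of 0]] T by auto
  obtain XB where XB: "\<And>s. s \<in> {0..T} \<Longrightarrow> X s \<le> XB"
    unfolding X_def using Linf_loc_bounded[OF Linf_loc_diff[OF w_Linf Linf_loc_continuous[OF output_cont[OF x]]] T]
    by metis
  have "E T \<le> exp (- \<sigma> * T) * ((1 + 2 * \<gamma> * L * exp \<sigma>) * a (norm x0 + norm z0)) + (Gs + 2 * \<gamma> * (Xs + L * Gs + Ks))"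
  proof (rule small_gain[OF T sigma_pos \<delta>(1) \<delta>0 _ L a_nonneg Gs Xs0 Ks(1) \<delta>(2) _ XB])
    fix t assume t: "t \<in> {0..T}"
    have "E t \<le> exp (- \<sigma> * t) * a (norm x0 + norm z0)
        + \<gamma> * (SUP s\<in>{0..t}. X s * exp (- \<sigma> * (t - s))) + (SUP s\<in>{0..t}. g (norm (d s)))"
      unfolding E_def X_def using t by (intro observer_estimate[OF x0 z0 w_Linf u_Linf d x z]) auto
    moreover have "(SUP s\<in>{0..t}. g (norm (d s))) \<le> Gs"
      unfolding Gs_def using t by (intro cSUP_subset_mono class_K_sup_bdd[OF g_K d T]) auto
    ultimately show "E t \<le> exp (- \<sigma> * t) * a (norm x0 + norm z0)
        + \<gamma> * (SUP s\<in>{0..t}. X s * exp (- \<sigma> * (t - s))) + Gs" by linarith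
    obtain i where i: "\<tau> i \<le> t" "t < \<tau> (Suc i)"
      using sampling_interval[OF \<tau>, of t] t by auto
    have "X t \<le> Xs + \<delta> * (L * B + Ks)" if B: "\<forall>s\<in>{\<tau> i..t}. E s \<le> B" for B
    proof -
      define v where "v t = w t - h (hist r x t)" for t
      have "0 \<le> E t" by (simp add: E_def)
      then have B0: "B \<ge> 0" using B i order.trans[of 0 "E t" B] by auto
      have LB: "L * B + Ks \<ge> 0" using B0 L Ks by simp
      have hx: "ae_ode {0..} (\<lambda>t. h (hist r x t)) (\<lambda>t. R (hist r x t, u t, d t))"
        by (rule output_derivative[OF x0 u_Linf d x])
      obtain N where N: "negligible N"
        "\<And>t. t \<in> {0..} - N \<Longrightarrow> ((\<lambda>t. h (hist r x t)) has_vector_derivative R (hist r x t, u t, d t)) (at t)"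
        by (rule ae_ode_negligible[OF hx]) auto
      obtain N' where N': "negligible N'"
        "\<And>t. t \<in> {\<tau> i..<\<tau> (Suc i)} - N' \<Longrightarrow> (w has_vector_derivative R (\<Psi> (hist r z t), u t, 0)) (at t)"
        by (rule ae_ode_negligible[OF w]) auto
      have "norm (v t - v (\<tau> i)) \<le> (L * B + Ks) * (t - \<tau> i)"
      proof (rule abs_cont_norm_increment_le[OF i(1) _ negligible_Un[OF N(1) N'(1)] LB,
            where g = "\<lambda>t. R (\<Psi> (hist r z t), u t, 0) - R (hist r x t, u t, d t)"])
        have "{\<tau> i..t} \<subseteq> {0..}" "{\<tau> i..t} \<subseteq> {\<tau> i..<\<tau> (Suc i)}" using \<tau>0[of i] i by auto
        then show "abs_cont_on (\<tau> i) t v"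
          unfolding v_def using w[of i] hx i unfolding ae_ode_def by (intro abs_cont_on_diff) blast+
        fix s assume s: "s \<in> {\<tau> i<..<t} - (N \<union> N')"
        then have s0: "s \<ge> 0" "s \<in> {0..T}" using \<tau>0[of i] t by (auto intro: order.trans)
        have "(v has_vector_derivative R (\<Psi> (hist r z s), u s, 0) - R (hist r x s, u s, d s)) (at s)"
          unfolding v_def using s i s0 N(2) N'(2) by (intro has_vector_derivative_diff) auto
        moreover have "norm (R (\<Psi> (hist r z s), u s, 0) - R (hist r x s, u s, d s)) \<le> L * E s + \<kappa> (norm (d s))"
          unfolding E_def using d s0
          by (intro R_Lipschitz Psi_C0 hist_sol_C0[OF x] hist_sol_C0[OF z]) (auto simp: Linf_loc_def)
        moreover have "L * E s \<le> L * B" using B s L by (intro mult_left_mono) auto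
        ultimately show "(v has_vector_derivative R (\<Psi> (hist r z s), u s, 0) - R (hist r x s, u s, d s)) (at s)
            \<and> norm (R (\<Psi> (hist r z s), u s, 0) - R (hist r x s, u s, d s)) \<le> L * B + Ks"
          using Ks(2)[OF s0(2)] by auto
      qed
      also have "\<dots> \<le> (L * B + Ks) * \<delta>" using i gap[of i] LB by (intro mult_left_mono) auto
      finally have "norm (v t - v (\<tau> i)) \<le> \<delta> * (L * B + Ks)" by (simp add: mult.commute)
      moreover have "v (\<tau> i) = \<xi> (\<tau> i)" by (simp add: v_def w0)
      moreover have "norm (\<xi> (\<tau> i)) \<le> Xs" using \<tau>0[of i] i t by (intro Xs) auto
      ultimately show ?thesis
        using norm_triangle_sub[of "v t" "v (\<tau> i)"] by (simp add: X_def v_def)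
    qed
    then show "\<exists>p\<in>{0..t}. t - p \<le> \<delta> \<and> (\<forall>B. (\<forall>s\<in>{p..t}. E s \<le> B) \<longrightarrow> X t \<le> Xs + \<delta> * (L * B + Ks))"
      using i gap[of i] \<tau>0[of i] by (intro bexI[of _ "\<tau> i"]) auto
  qed (use gamma_pos in \<open>auto simp: X_def\<close>)
  then show ?thesis by (simp add: E_def Gs_def Ks_def Xs_def)
qed

lemma predictor_growth:
  assumes "\<phi> \<in> C0 r"
  shows "norm (R (\<phi>, c, 0)) \<le> norm (R (0, c, 0)) + L * norm \<phi>"
  using R_Lipschitz[OF zero_in_C0 assms zero_in_D, of c] \<kappa> norm_triangle_sub[of "R (\<phi>, c, 0)" "R (0, c, 0)"]
  by (simp add: class_K_def)

text \<open>
  On one interval with constant control \<open>c\<close>, the path \<open>v\<close> on \<open>[p, q]\<close> determines an observer trajectory \<open>Z v\<close>,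
  and the sought signal solves \<open>v = \<Phi> v\<close> with \<open>\<Phi> v t = w0 + \<integral> R(\<Psi>((Z v)\<^sub>s), c, 0) ds\<close>. The observer estimate
  against the plant trajectory starting at rest bounds \<open>\<Psi>(Z v)\<close> affinely in the bound \<open>B\<close> of \<open>v\<close>, with slope \<open>\<gamma>\<close>;
  as \<open>(q - p) L \<gamma> \<le> 1/2\<close>, some ball is mapped into itself. Causality of \<open>\<Phi>\<close> is the causality of the observer,
  continuity is its continuous dependence on the input together with dominated convergence.
\<close>
lemma predictor_exists:
  assumes "0 \<le> p" "p < q" and \<delta>: "(q - p) * L * \<gamma> \<le> 1 / 2"
    and z0: "z0 \<in> C0 r" and u: "u \<in> Linf_loc UNIV" and w: "w \<in> Linf_loc UNIV"
  shows "\<exists>w'\<in>Linf_loc UNIV. (\<forall>t<p. w' t = w t) \<and> (\<forall>z. observer w' u z0 z \<longrightarrow>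
      (\<forall>t\<in>{p..<q}. w' t = w0 + integral {p..t} (\<lambda>s. R (\<Psi> (hist r z s), c, 0))))"
proof -
  have q: "0 \<le> q" using assms by simp
  define d :: "real \<Rightarrow> real^'q" where "d = (\<lambda>_. 0)"
  define x0 :: "real \<Rightarrow>\<^sub>C (real^'n)" where "x0 = 0"
  have d: "d \<in> Linf_loc D" and x0: "x0 \<in> C0 r"
    using zero_input zero_in_C0 by (auto simp: d_def x0_def)
  obtain x where x: "plant u d x0 x" using forward_complete[OF x0 u d] by blast
  have "continuous_on {0..q} (hist r x)"
    using r by (intro continuous_on_hist delay_sol_cont[OF x]) auto
  then obtain Xb where Xb: "Xb \<ge> 0" "\<And>s. s \<in> {0..q} \<Longrightarrow> norm (hist r x s) \<le> Xb"
    by (rule bounded_continuous_real) blast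
  have "continuous_on {0..q} (\<lambda>t. h (hist r x t))"
    by (rule continuous_on_subset[OF output_cont[OF x]]) auto
  then obtain Hb where Hb: "Hb \<ge> 0" "\<And>s. s \<in> {0..q} \<Longrightarrow> norm (h (hist r x s)) \<le> Hb"
    by (rule bounded_continuous_real) blast
  obtain Wb where Wb: "Wb \<ge> 0" "\<And>s. s \<in> {0..q} \<Longrightarrow> norm (w s) \<le> Wb"
    by (rule Linf_loc_bounded[OF w q]) blast
  define Gs where "Gs = (SUP s\<in>{0..q}. g (norm (d s)))"
  have Gs: "Gs \<ge> 0" unfolding Gs_def by (rule class_K_sup_nonneg[OF g_K d q])
  define A where "A = a (norm x0 + norm z0)"
  have A: "A \<ge> 0" unfolding A_def by (rule a_nonneg)
  define R0 where "R0 = norm (R (0, c, 0))"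
  define C where "C = A + \<gamma> * (Wb + Hb) + Gs"
  have C: "C \<ge> 0" using A Gs gamma_pos Wb Hb by (simp add: C_def)
  define B where "B = 2 * (norm w0 + (q - p) * (R0 + L * (Xb + C)))"
  have B: "B \<ge> 0" using \<open>p < q\<close> L Xb C by (simp add: B_def R0_def)
  define K where "K = R0 + L * (Xb + C + \<gamma> * B)"
  have w0B: "norm w0 + (q - p) * K \<le> B"
  proof -
    have "(q - p) * K = (q - p) * (R0 + L * (Xb + C)) + (q - p) * L * \<gamma> * B"
      by (simp add: K_def algebra_simps)
    moreover have "(q - p) * L * \<gamma> * B \<le> 1 / 2 * B" using \<delta> B by (rule mult_right_mono)
    moreover have "1 / 2 * B = norm w0 + (q - p) * (R0 + L * (Xb + C))" by (simp add: B_def)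
    ultimately show ?thesis by linarith
  qed
  define S where "S = (bounded_paths p q B :: (real \<Rightarrow> real^'k) set)"
  \<comment> \<open>The candidate is continued by a constant beyond \<open>q\<close>, so that it is an input for all times.\<close>
  define ext where "ext v t = (if t < p then w t else v (max p (min q t)))" for v :: "real \<Rightarrow> real^'k" and t
  have ext_Linf: "ext v \<in> Linf_loc UNIV" if "v \<in> S" for v
    unfolding ext_def[abs_def] using that \<open>p < q\<close>
    by (intro Linf_loc_glue w Linf_loc_continuous continuous_on_clamped) (auto simp: S_def bounded_paths_def)
  define Z where "Z v = (SOME z. observer (ext v) u z0 z)" for v
  have Z: "observer (ext v) u z0 (Z v)" if "v \<in> S" for v
    unfolding Z_def by (rule someI_ex[OF observer_exists[OF z0 ext_Linf[OF that] u]])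
  have est_bound: "norm (\<Psi> (hist r (Z v) s)) \<le> Xb + C + \<gamma> * B" if v: "v \<in> S" and s: "s \<in> {0..q}" for v s
  proof -
    have "(SUP s'\<in>{0..s}. norm (ext v s' - h (hist r x s')) * exp (- \<sigma> * (s - s'))) \<le> Wb + B + Hb"
    proof (rule cSUP_least)
      fix s' assume s': "s' \<in> {0..s}"
      have "norm (ext v s') \<le> Wb + B"
        using Wb(2)[of s'] v s s' B Wb(1) \<open>p < q\<close> by (auto simp: ext_def S_def bounded_paths_def add_increasing add_increasing2)
      then have "norm (ext v s' - h (hist r x s')) \<le> Wb + B + Hb"
        using norm_triangle_ineq4[of "ext v s'" "h (hist r x s')"] Hb(2)[of s'] s s' by auto
      moreover have "exp (- \<sigma> * (s - s')) \<le> 1" using sigma_pos s' by simp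
      ultimately have "norm (ext v s' - h (hist r x s')) * exp (- \<sigma> * (s - s')) \<le> (Wb + B + Hb) * 1"
        using Wb B Hb by (intro mult_mono) auto
      then show "norm (ext v s' - h (hist r x s')) * exp (- \<sigma> * (s - s')) \<le> Wb + B + Hb" by simp
    qed (use s in auto)
    then have "\<gamma> * (SUP s'\<in>{0..s}. norm (ext v s' - h (hist r x s')) * exp (- \<sigma> * (s - s'))) \<le> \<gamma> * (Wb + B + Hb)"
      using gamma_pos by (intro mult_left_mono) auto
    moreover have "(SUP s'\<in>{0..s}. g (norm (d s'))) \<le> Gs"
      unfolding Gs_def using s by (intro cSUP_subset_mono class_K_sup_bdd[OF g_K d q]) auto
    moreover have "exp (- \<sigma> * s) * A \<le> 1 * A"
      using sigma_pos s A by (intro mult_right_mono) auto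
    ultimately have "norm (\<Psi> (hist r (Z v) s) - hist r x s) \<le> C + \<gamma> * B"
      using observer_estimate[OF x0 z0 ext_Linf[OF v] u d x Z[OF v], of s] s
      by (simp add: A_def C_def algebra_simps)
    then show ?thesis
      using norm_triangle_sub[of "\<Psi> (hist r (Z v) s)" "hist r x s"] Xb(2)[OF s] by simp
  qed
  define G where "G v s = R (\<Psi> (hist r (Z v) s), c, 0)" for v s
  have G_le: "norm (G v s) \<le> K" if v: "v \<in> S" and s: "s \<in> {0..q}" for v s
  proof -
    have "norm (G v s) \<le> R0 + L * norm (\<Psi> (hist r (Z v) s))"
      unfolding G_def R0_def using s by (intro predictor_growth Psi_C0 hist_sol_C0[OF Z[OF v]]) auto
    also have "\<dots> \<le> K" unfolding K_def using est_bound[OF v s] L by (intro add_left_mono mult_left_mono) auto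
    finally show ?thesis .
  qed
  have K0: "K \<ge> 0" using L Xb C gamma_pos B by (simp add: K_def R0_def)
  have G_cont: "continuous_on {p..q} (G v)" if "v \<in> S" for v
    unfolding G_def[abs_def] by (rule predictor_cont[OF Z[OF that] \<open>0 \<le> p\<close>])
  define \<Phi> where "\<Phi> v t = w0 + integral {p..t} (G v)" for v t
  have Z_eq: "hist r z s = hist r (Z v) s"
    if v: "v \<in> S" and z: "observer w' u z0 z" and eq: "\<And>s. s \<in> {0..<t} \<Longrightarrow> ext v s = w' s" and s: "s \<in> {0..t}"
    for v w' z s t
  proof (rule hist_cong)
    fix s' assume "s' \<in> {s-r..s}"
    then show "z s' = Z v s'"
      using observer_causal[OF Z[OF v] z ext_Linf[OF v] u eq refl, of s'] s by auto
  qed (use r in auto)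
  have "\<exists>v\<in>S. \<forall>t\<in>{p..q}. \<Phi> v t = v t"
  proof (rule causal_fixed_point[of p q w0 B \<Phi> K, folded S_def])
    show "p < q" by fact
    show "norm w0 \<le> B" using w0B K0 \<open>p < q\<close> mult_nonneg_nonneg[of "q - p" K] by linarith
    show "\<Phi> v p = w0" if "v \<in> S" for v by (simp add: \<Phi>_def)
    fix v assume v: "v \<in> S"
    have Lip: "norm (integral {p..s} (G v) - integral {p..t} (G v)) \<le> K * \<bar>s - t\<bar>"
      if "s \<in> {p..q}" "t \<in> {p..q}" for s t
      using \<open>0 \<le> p\<close> that by (intro integral_Lipschitz[OF G_cont[OF v]] G_le[OF v]) auto
    then show "norm (\<Phi> v s - \<Phi> v t) \<le> K * \<bar>s - t\<bar>" if "s \<in> {p..q}" "t \<in> {p..q}" for s t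
      using that by (simp add: \<Phi>_def)
    show "norm (\<Phi> v t) \<le> B" if t: "t \<in> {p..q}" for t
    proof -
      have "norm (\<Phi> v t) \<le> norm w0 + K * \<bar>t - p\<bar>"
        using Lip[OF t, of p] t norm_triangle_ineq[of w0 "integral {p..t} (G v)"] by (simp add: \<Phi>_def)
      also have "K * \<bar>t - p\<bar> \<le> K * (q - p)" using t K0 by (intro mult_left_mono) auto
      finally show ?thesis using w0B by (simp add: mult.commute)
    qed
    fix v' t assume v': "v' \<in> S" and t: "t \<in> {p..q}" and eq: "\<And>s. s \<in> {p..t} \<Longrightarrow> v s = v' s"
    have "ext v s = ext v' s" if "s \<in> {0..<t}" for s using that t eq by (auto simp: ext_def)
    then have "hist r (Z v') s = hist r (Z v) s" if "s \<in> {p..t}" for s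
      using Z_eq[OF v Z[OF v'], of t s] that \<open>0 \<le> p\<close> by auto
    then have "integral {p..t} (G v) = integral {p..t} (G v')"
      unfolding G_def by (intro integral_cong) auto
    then show "\<Phi> v t = \<Phi> v' t" by (simp add: \<Phi>_def)
  next
    fix vn v t
    assume vn: "\<And>n::nat. vn n \<in> S" and v: "v \<in> S" and ul: "uniform_limit {p..q} vn v sequentially" and t: "t \<in> {p..q}"
    have lim: "(\<lambda>n. G (vn n) s) \<longlonglongrightarrow> G v s" if s: "s \<in> {p..t}" for s
    proof -
      have "(\<lambda>n. hist r (Z (vn n)) s) \<longlonglongrightarrow> hist r (Z v) s"
        unfolding tendsto_iff
      proof (intro allI impI)
        fix e :: real assume "e > 0"
        obtain \<delta>' where \<delta>': "\<delta>' > 0" "\<And>z' v' t. delay_sol r z0 (\<lambda>t. F (hist r z' t, v' t)) z' \<Longrightarrow>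
            (\<And>t. t \<in> {0<..<q} \<Longrightarrow> norm (v' t - (ext v t, u t)) \<le> \<delta>') \<Longrightarrow> t \<in> {-r..q} \<Longrightarrow>
            norm (z' t - Z v t) \<le> e / 2"
          by (rule delay_sol_continuous_dependence[OF _ q F_one_sided F_cont, of z0 "Z v" "\<lambda>t. (ext v t, u t)" "e / 2"])
            (use r \<open>e > 0\<close> Z[OF v] bounded_pair_input[OF ext_Linf[OF v] u] in auto)
        have "\<forall>\<^sub>F n in sequentially. \<forall>s\<in>{p..q}. dist (vn n s) (v s) < \<delta>'"
          using ul \<delta>'(1) by (auto simp: uniform_limit_iff)
        then show "\<forall>\<^sub>F n in sequentially. dist (hist r (Z (vn n)) s) (hist r (Z v) s) < e"
        proof (rule eventually_mono)
          fix n assume n: "\<forall>s\<in>{p..q}. dist (vn n s) (v s) < \<delta>'"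
          have close: "norm (Z (vn n) t - Z v t) \<le> e / 2" if "t \<in> {-r..q}" for t
          proof (rule \<delta>'(2)[OF Z[OF vn] _ that])
            fix t assume "t \<in> {0<..<q}"
            have "norm (ext (vn n) t - ext v t) \<le> \<delta>'"
              using n \<delta>'(1) \<open>p < q\<close> by (auto simp: ext_def dist_norm less_imp_le)
            then show "norm ((ext (vn n) t, u t) - (ext v t, u t)) \<le> \<delta>'" by (simp add: norm_Pair)
          qed
          have "norm (hist r (Z (vn n)) s - hist r (Z v) s) \<le> e / 2"
            using r s t \<open>0 \<le> p\<close>
            by (intro hist_diff_le delay_sol_cont[OF Z[OF v]] delay_sol_cont[OF Z[OF vn]] close) auto
          then show "dist (hist r (Z (vn n)) s) (hist r (Z v) s) < e" using \<open>e > 0\<close> by (simp add: dist_norm)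
        qed
      qed
      then show ?thesis
        unfolding G_def using s \<open>0 \<le> p\<close> hist_sol_C0[OF Z[OF v], of s] hist_sol_C0[OF Z[OF vn], of s]
        by (intro continuous_on_tendsto_compose[OF R_Psi_cont]) auto
    qed
    have "(\<lambda>n. integral {p..t} (G (vn n))) \<longlonglongrightarrow> integral {p..t} (G v)"
    proof (rule dominated_convergence(2)[where h = "\<lambda>_. K"])
      show "G (vn n) integrable_on {p..t}" for n
        using t by (intro integrable_continuous_real continuous_on_subset[OF G_cont[OF vn]]) auto
      show "norm (G (vn n) s) \<le> K" if "s \<in> {p..t}" for n s
        using that t \<open>0 \<le> p\<close> by (intro G_le[OF vn]) auto
    qed (use lim in auto)
    then show "(\<lambda>n. \<Phi> (vn n) t) \<longlonglongrightarrow> \<Phi> v t" unfolding \<Phi>_def by (intro tendsto_intros)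
  qed
  then obtain v where v: "v \<in> S" "\<And>t. t \<in> {p..q} \<Longrightarrow> \<Phi> v t = v t" by blast
  show ?thesis
  proof (intro bexI[of _ "ext v"] conjI allI impI ballI ext_Linf v)
    show "ext v t = w t" if "t < p" for t using that by (simp add: ext_def)
    fix z t assume z: "observer (ext v) u z0 z" and t: "t \<in> {p..<q}"
    have "hist r z s = hist r (Z v) s" if "s \<in> {p..t}" for s
      using Z_eq[OF v(1) z refl, of s t] that \<open>0 \<le> p\<close> by auto
    then have "integral {p..t} (\<lambda>s. R (\<Psi> (hist r z s), c, 0)) = integral {p..t} (G v)"
      unfolding G_def by (intro integral_cong) auto
    moreover have "ext v t = v t" using t by (simp add: ext_def)
    ultimately show "ext v t = w0 + integral {p..t} (\<lambda>s. R (\<Psi> (hist r z s), c, 0))"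
      using v(2)[of t] t by (simp add: \<Phi>_def)
  qed
qed

text \<open>
  The closed-loop equations on the \<open>i\<close>-th sampling interval, as a property of the inputs alone. The
  trajectories are determined by the inputs, and in integral form the equation for \<open>w\<close> depends only on the
  inputs before \<open>\<tau> (Suc i)\<close>. This is what allows passing to the limit in the construction.
\<close>
definition loop_closed where
  "loop_closed k \<tau> \<xi> d x0 z0 i u w \<longleftrightarrow> (\<forall>x z. plant u d x0 x \<longrightarrow> observer w u z0 z \<longrightarrow>
     (\<forall>t\<in>{\<tau> i..<\<tau> (Suc i)}. u t = k (\<Psi> (hist r z (\<tau> i))) \<and>
        w t = h (hist r x (\<tau> i)) + \<xi> (\<tau> i)
          + integral {\<tau> i..t} (\<lambda>s. R (\<Psi> (hist r z s), k (\<Psi> (hist r z (\<tau> i))), 0))))"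

lemma loop_closed_causal:
  assumes ok: "loop_closed k \<tau> \<xi> d x0 z0 i u w" and \<tau>: "sampling_sequence \<delta> \<tau>"
    and x0: "x0 \<in> C0 r" and z0: "z0 \<in> C0 r" and d: "d \<in> Linf_loc D"
    and u: "u \<in> Linf_loc UNIV" and w: "w \<in> Linf_loc UNIV"
    and eq: "\<And>t. t \<in> {0..<\<tau> (Suc i)} \<Longrightarrow> u t = u' t" "\<And>t. t \<in> {0..<\<tau> (Suc i)} \<Longrightarrow> w t = w' t"
  shows "loop_closed k \<tau> \<xi> d x0 z0 i u' w'"
  unfolding loop_closed_def
proof (intro allI impI ballI)
  fix x' z' t assume x': "plant u' d x0 x'" and z': "observer w' u' z0 z'" and t: "t \<in> {\<tau> i..<\<tau> (Suc i)}"
  obtain x where x: "plant u d x0 x" using forward_complete[OF x0 u d] by blast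
  obtain z where z: "observer w u z0 z" using observer_exists[OF z0 w u] by blast
  have \<tau>i: "0 \<le> \<tau> i" "\<tau> i < \<tau> (Suc i)" using sampling_nonneg[OF \<tau>] sampling_gap[OF \<tau>] by auto
  have hx: "hist r x' s = hist r x s" and hz: "hist r z' s = hist r z s" if "s \<in> {0..\<tau> (Suc i)}" for s
  proof -
    have "x' s' = x s'" "z' s' = z s'" if "s' \<in> {s-r..s}" for s'
      using plant_causal[OF x x' u d eq(1), of s'] observer_causal[OF z z' w u eq(2,1), of s']
        that \<open>s \<in> {0..\<tau> (Suc i)}\<close> by auto
    then show "hist r x' s = hist r x s" "hist r z' s = hist r z s" using r by (auto intro!: hist_cong)
  qed
  have "integral {\<tau> i..t} (\<lambda>s. R (\<Psi> (hist r z' s), c, 0)) = integral {\<tau> i..t} (\<lambda>s. R (\<Psi> (hist r z s), c, 0))" for c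
    using \<tau>i t hz by (intro integral_cong) auto
  then show "u' t = k (\<Psi> (hist r z' (\<tau> i))) \<and> w' t = h (hist r x' (\<tau> i)) + \<xi> (\<tau> i)
          + integral {\<tau> i..t} (\<lambda>s. R (\<Psi> (hist r z' s), k (\<Psi> (hist r z' (\<tau> i))), 0))"
    using ok[unfolded loop_closed_def, rule_format, OF x z t] eq[of t] t \<tau>i hx[of "\<tau> i"] hz[of "\<tau> i"]
    by auto
qed

text \<open>
  The inputs before \<open>\<tau> i\<close> determine both trajectories up to \<open>\<tau> i\<close>, and with them the control to be held
  and the value to which the prediction is reset.
\<close>
lemma close_next_loop:
  assumes \<tau>: "sampling_sequence \<delta> \<tau>" and \<delta>: "\<delta> * L * \<gamma> \<le> 1 / 2"
    and x0: "x0 \<in> C0 r" and z0: "z0 \<in> C0 r" and d: "d \<in> Linf_loc D"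
    and u: "u \<in> Linf_loc UNIV" and w: "w \<in> Linf_loc UNIV"
  shows "\<exists>u'\<in>Linf_loc UNIV. \<exists>w'\<in>Linf_loc UNIV.
    (\<forall>t\<in>{0..<\<tau> i}. u' t = u t \<and> w' t = w t) \<and> loop_closed k \<tau> \<xi> d x0 z0 i u' w'"
proof -
  have \<tau>i: "0 \<le> \<tau> i" "\<tau> i < \<tau> (Suc i)" "\<tau> (Suc i) - \<tau> i \<le> \<delta>"
    using sampling_nonneg[OF \<tau>] sampling_gap[OF \<tau>] by auto
  obtain z where z: "observer w u z0 z" using observer_exists[OF z0 w u] by blast
  define c where "c = k (\<Psi> (hist r z (\<tau> i)))"
  define u' where "u' t = (if t < \<tau> i then u t else c)" for t
  have u': "u' \<in> Linf_loc UNIV"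
    unfolding u'_def[abs_def] by (intro Linf_loc_glue u Linf_loc_continuous continuous_on_const)
  obtain x where x: "plant u' d x0 x" using forward_complete[OF x0 u' d] by blast
  have "(\<tau> (Suc i) - \<tau> i) * L * \<gamma> \<le> \<delta> * L * \<gamma>"
    using \<tau>i L gamma_pos by (intro mult_right_mono) auto
  then have gain: "(\<tau> (Suc i) - \<tau> i) * L * \<gamma> \<le> 1 / 2" using \<delta> by linarith
  obtain w' where w': "w' \<in> Linf_loc UNIV" "\<And>t. t < \<tau> i \<Longrightarrow> w' t = w t"
    "\<And>z t. observer w' u' z0 z \<Longrightarrow> t \<in> {\<tau> i..<\<tau> (Suc i)} \<Longrightarrow>
      w' t = h (hist r x (\<tau> i)) + \<xi> (\<tau> i) + integral {\<tau> i..t} (\<lambda>s. R (\<Psi> (hist r z s), c, 0))"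
    using predictor_exists[OF \<tau>i(1,2) gain z0 u' w, of "h (hist r x (\<tau> i)) + \<xi> (\<tau> i)" c] by blast
  have "loop_closed k \<tau> \<xi> d x0 z0 i u' w'"
    unfolding loop_closed_def
  proof (intro allI impI ballI)
    fix x' z' t assume x': "plant u' d x0 x'" and z': "observer w' u' z0 z'" and t: "t \<in> {\<tau> i..<\<tau> (Suc i)}"
    have "hist r x' (\<tau> i) = hist r x (\<tau> i)"
      using r \<tau>i by (intro hist_cong plant_causal[OF x' x u' d refl, where T = "\<tau> i"]) auto
    moreover have "hist r z' (\<tau> i) = hist r z (\<tau> i)"
      using r \<tau>i w'(2) by (intro hist_cong observer_causal[OF z' z w'(1) u', where T = "\<tau> i"]) (auto simp: u'_def)
    ultimately show "u' t = k (\<Psi> (hist r z' (\<tau> i))) \<and> w' t = h (hist r x' (\<tau> i)) + \<xi> (\<tau> i)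
          + integral {\<tau> i..t} (\<lambda>s. R (\<Psi> (hist r z' s), k (\<Psi> (hist r z' (\<tau> i))), 0))"
      using w'(3)[OF z' t] t by (simp add: u'_def c_def)
  qed
  then show ?thesis using u' w'(1,2) by (intro bexI[of _ u'] bexI[of _ w']) (auto simp: u'_def)
qed

text \<open>
  Each step of the construction changes the inputs only from \<open>\<tau> n\<close> on, so they stabilise on every bounded
  interval. The trajectories need not be pasted together: they are the solutions for the limit inputs.
\<close>
lemma closed_loop_exists:
  assumes \<tau>: "sampling_sequence \<delta> \<tau>" and \<delta>: "\<delta> * L * \<gamma> \<le> 1 / 2"
    and x0: "x0 \<in> C0 r" and z0: "z0 \<in> C0 r" and d: "d \<in> Linf_loc D"
  shows "\<exists>x z w u. closed_loop_sol r f h R k F \<Psi> \<tau> x0 z0 d \<xi> x z w u"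
proof -
  define P where "P = (\<lambda>(n::nat) (u, w). u \<in> (Linf_loc UNIV :: (real \<Rightarrow> real^'m) set) \<and> w \<in> (Linf_loc UNIV :: (real \<Rightarrow> real^'k) set))"
  define Q where "Q = (\<lambda>n (u, w) (u', w'). (\<forall>t\<in>{0..<\<tau> n}. u' t = u t \<and> w' t = w t) \<and> loop_closed k \<tau> \<xi> d x0 z0 n u' w')"
  have "\<exists>s. \<forall>n. P n (s n) \<and> Q n (s n) (s (Suc n))"
  proof (rule dependent_nat_choice)
    show "\<exists>s. P 0 s"
      by (rule exI[of _ "(\<lambda>_. 0, \<lambda>_. 0)"]) (auto simp: P_def intro!: Linf_loc_continuous)
    show "\<exists>s'. P (Suc n) s' \<and> Q n s s'" if "P n s" for s n
      using close_next_loop[OF \<tau> \<delta> x0 z0 d, of "fst s" "snd s" n k \<xi>] that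
      by (auto simp: P_def Q_def split_paired_Ex case_prod_unfold)
  qed
  then obtain s where s: "\<And>n. P n (s n)" "\<And>n. Q n (s n) (s (Suc n))" by blast
  define us where "us n = fst (s n)" for n
  define ws where "ws n = snd (s n)" for n
  have Linf: "us n \<in> Linf_loc UNIV" "ws n \<in> Linf_loc UNIV" for n
    using s(1)[of n] by (auto simp: P_def us_def ws_def case_prod_unfold)
  have step: "us (Suc n) t = us n t" "ws (Suc n) t = ws n t" if "t \<in> {0..<\<tau> n}" for n t
    using s(2)[of n] that by (auto simp: Q_def us_def ws_def case_prod_unfold)
  have closed: "loop_closed k \<tau> \<xi> d x0 z0 n (us (Suc n)) (ws (Suc n))" for n
    using s(2)[of n] by (auto simp: Q_def us_def ws_def case_prod_unfold)
  have stable: "us n t = us m t \<and> ws n t = ws m t" if "m \<le> n" "t \<in> {0..<\<tau> m}" for m n t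
    using that
  proof (induction n rule: dec_induct)
    case (step n)
    have "\<tau> m \<le> \<tau> n" using sampling_mono[OF \<tau>] step(1) by blast
    then show ?case using step \<open>\<And>n t. t \<in> {0..<\<tau> n} \<Longrightarrow> us (Suc n) t = us n t\<close>[of t n]
        \<open>\<And>n t. t \<in> {0..<\<tau> n} \<Longrightarrow> ws (Suc n) t = ws n t\<close>[of t n] by auto
  qed simp
  define ix where "ix t = (LEAST n. t < \<tau> n)" for t
  define u where "u t = us (ix t) t" for t
  define w where "w t = ws (ix t) t" for t
  have limit: "us n t = u t" "ws n t = w t" if "t \<in> {0..<\<tau> n}" for n t
  proof -
    have "t < \<tau> (ix t)" unfolding ix_def by (rule LeastI[of _ n]) (use that in auto)
    moreover have "ix t \<le> n" unfolding ix_def by (rule Least_le) (use that in auto)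
    ultimately show "us n t = u t" "ws n t = w t"
      using stable[of "ix t" n t] that by (auto simp: u_def w_def)
  qed
  have lim: "filterlim \<tau> at_top sequentially" using \<tau> by (simp add: sampling_sequence_def)
  have u_Linf: "u \<in> Linf_loc UNIV"
    by (rule Linf_loc_exhaustion[OF lim]) (metis limit(1) Linf(1))
  have w_Linf: "w \<in> Linf_loc UNIV"
    by (rule Linf_loc_exhaustion[OF lim]) (metis limit(2) Linf(2))
  have ok: "loop_closed k \<tau> \<xi> d x0 z0 i u w" for i
    by (rule loop_closed_causal[OF closed \<tau> x0 z0 d Linf]) (use limit in auto)
  obtain x where x: "plant u d x0 x" using forward_complete[OF x0 u_Linf d] by blast
  obtain z where z: "observer w u z0 z" using observer_exists[OF z0 w_Linf u_Linf] by blast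
  have "w (\<tau> i) = h (hist r x (\<tau> i)) + \<xi> (\<tau> i) \<and>
      ae_ode {\<tau> i..<\<tau> (Suc i)} w (\<lambda>t. R (\<Psi> (hist r z t), u t, 0)) \<and>
      (\<forall>t\<in>{\<tau> i..<\<tau> (Suc i)}. u t = k (\<Psi> (hist r z (\<tau> i))))" for i
  proof -
    define c where "c = k (\<Psi> (hist r z (\<tau> i)))"
    note \<tau>i = sampling_nonneg[OF \<tau>, of i] sampling_gap[OF \<tau>, of i]
    have uw: "u t = c" "w t = h (hist r x (\<tau> i)) + \<xi> (\<tau> i) + integral {\<tau> i..t} (\<lambda>s. R (\<Psi> (hist r z s), c, 0))"
      if "t \<in> {\<tau> i..<\<tau> (Suc i)}" for t
      using ok[unfolded loop_closed_def, rule_format, OF x z that] by (auto simp: c_def)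
    have "ae_ode {\<tau> i..<\<tau> (Suc i)} w (\<lambda>t. R (\<Psi> (hist r z t), c, 0))"
      by (rule ae_ode_integral[OF predictor_cont[OF z \<tau>i(1)] uw(2)])
    moreover have "ae_ode {\<tau> i..<\<tau> (Suc i)} w (\<lambda>t. R (\<Psi> (hist r z t), u t, 0))
        = ae_ode {\<tau> i..<\<tau> (Suc i)} w (\<lambda>t. R (\<Psi> (hist r z t), c, 0))"
      unfolding ae_ode_def using uw(1) by (intro conj_cong AE_cong refl) auto
    ultimately show ?thesis using uw \<tau>i by (auto simp: c_def)
  qed
  then show ?thesis using x z unfolding closed_loop_sol_def by blast
qed

end

theorem corollary2p4:
  fixes r :: real
    and D :: "(real^'q) set"
    and f :: "(real \<Rightarrow>\<^sub>C (real^'n)) \<times> (real^'m) \<times> (real^'q) \<Rightarrow> real^'n"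
    and h :: "(real \<Rightarrow>\<^sub>C (real^'n)) \<Rightarrow> real^'k"
    and R :: "(real \<Rightarrow>\<^sub>C (real^'n)) \<times> (real^'m) \<times> (real^'q) \<Rightarrow> real^'k"
    and k :: "(real \<Rightarrow>\<^sub>C (real^'n)) \<Rightarrow> real^'m"
    and F :: "(real \<Rightarrow>\<^sub>C (real^'l)) \<times> (real^'k) \<times> (real^'m) \<Rightarrow> real^'l"
    and \<Psi> :: "(real \<Rightarrow>\<^sub>C (real^'l)) \<Rightarrow> (real \<Rightarrow>\<^sub>C (real^'n))"
    and \<gamma> \<sigma> :: real
    and g a :: "real \<Rightarrow> real"
  assumes r: "r > 0"
    and D: "convex D" "0 \<in> D"
    and f_cont: "continuous_on (C0 r \<times> UNIV \<times> D) f"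
    and h_cont: "continuous_on (C0 r) h"
    and f_0: "f (0, 0, 0) = 0"
    and h_0: "h 0 = 0"
    and f_bounded: "\<And>S. S \<subseteq> C0 r \<times> UNIV \<times> D \<Longrightarrow> bounded S \<Longrightarrow> bounded (f ` S)"
    and h_bounded: "\<And>S. S \<subseteq> C0 r \<Longrightarrow> bounded S \<Longrightarrow> bounded (h ` S)"
    and f_one_sided_Lipschitz:
      "\<And>S. S \<subseteq> C0 r \<times> UNIV \<times> D \<Longrightarrow> bounded S \<Longrightarrow>
         \<exists>L\<ge>0. \<forall>x x' u d. (x, u, d) \<in> S \<and> (x', u, d) \<in> S \<longrightarrow>
           (apply_bcontfun x 0 - apply_bcontfun x' 0) \<bullet> (f (x, u, d) - f (x', u, d)) \<le> L * (norm (x - x'))\<^sup>2"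
    and forward_complete:
      "\<And>x0 u d. x0 \<in> C0 r \<Longrightarrow> u \<in> Linf_loc UNIV \<Longrightarrow> d \<in> Linf_loc D \<Longrightarrow>
         \<exists>x. delay_sol r x0 (\<lambda>t. f (hist r x t, u t, d t)) x"
    and R_cont: "continuous_on (C0 r \<times> UNIV \<times> D) R"
    and output_derivative:
      "\<And>x0 u d x. x0 \<in> C0 r \<Longrightarrow> u \<in> Linf_loc UNIV \<Longrightarrow> d \<in> Linf_loc D \<Longrightarrow>
         delay_sol r x0 (\<lambda>t. f (hist r x t, u t, d t)) x \<Longrightarrow>
         ae_ode {0..} (\<lambda>t. h (hist r x t)) (\<lambda>t. R (hist r x t, u t, d t))"
    and R_Lipschitz:
      "\<exists>L\<ge>0. \<exists>\<kappa>\<in>class_K. \<forall>x\<in>C0 r. \<forall>x'\<in>C0 r. \<forall>u. \<forall>d\<in>D.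
         norm (R (x', u, 0) - R (x, u, d)) \<le> L * norm (x' - x) + \<kappa> (norm d)"
    and k_0: "k 0 = 0"
    and feedback:
      "\<exists>\<kappa>\<in>class_K. \<exists>\<sigma>>0. \<exists>M>0. \<exists>L>0.
         (\<forall>x\<in>C0 r. \<forall>x'\<in>C0 r. \<forall>u u'.
            norm (k x' - k x) + norm (f (x', u', 0) - f (x, u, 0))
              \<le> L * norm (x' - x) + L * norm (u' - u)) \<and>
         (\<forall>x\<in>C0 r. \<forall>u. \<forall>d\<in>D. norm (f (x, u, d) - f (x, u, 0)) \<le> \<kappa> (norm d)) \<and>
         (\<forall>x0\<in>C0 r.
            (\<exists>x. delay_sol r x0 (\<lambda>t. f (hist r x t, k (hist r x t), 0)) x) \<and>
            (\<forall>x. delay_sol r x0 (\<lambda>t. f (hist r x t, k (hist r x t), 0)) x \<longrightarrow>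
               (\<forall>t\<ge>0. norm (hist r x t) \<le> M * exp (- \<sigma> * t) * norm x0)))"
    and REO: "is_REO r D f h F \<Psi> \<gamma> \<sigma> g a"
    and R_\<Psi>_Lipschitz:
      "\<And>S. S \<subseteq> C0 r \<times> UNIV \<Longrightarrow> bounded S \<Longrightarrow>
         \<exists>L\<ge>0. \<forall>z z' u. (z, u) \<in> S \<and> (z', u) \<in> S \<longrightarrow>
           norm (R (\<Psi> z, u, 0) - R (\<Psi> z', u, 0)) \<le> L * norm (z - z')"
  shows "\<exists>\<delta>>0. \<exists>\<omega>>0. \<exists>\<gamma>'>0. \<exists>g'\<in>class_K. \<exists>a'\<in>class_K.
    (\<forall>\<tau>. sampling_sequence \<delta> \<tau> \<longrightarrow>
      (\<forall>x0\<in>C0 r. \<forall>z0\<in>C0 r. \<forall>\<xi>\<in>Linf_loc UNIV. \<forall>d\<in>Linf_loc D.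
        (\<exists>x z w u. closed_loop_sol r f h R k F \<Psi> \<tau> x0 z0 d \<xi> x z w u) \<and>
        (\<forall>x z w u. closed_loop_sol r f h R k F \<Psi> \<tau> x0 z0 d \<xi> x z w u \<longrightarrow>
          (\<forall>t\<ge>0. norm (hist r x t) + norm (\<Psi> (hist r z t))
             \<le> exp (- \<omega> * t) * a' (norm x0 + norm z0)
                + \<gamma>' * (SUP s\<in>{0..t}. norm (\<xi> s))
                + (SUP s\<in>{0..t}. g' (norm (d s))))))) \<and>
    (linear_on_nonneg a \<longrightarrow> linear_on_nonneg a')"
proof -
  obtain \<kappa>' \<mu> M L' where \<kappa>': "\<kappa>' \<in> class_K" and pos: "\<mu> > 0" "M > 0" "L' > 0"
    and Lip: "\<forall>x\<in>C0 r. \<forall>x'\<in>C0 r. \<forall>u u'. norm (k x' - k x) + norm (f (x', u', 0) - f (x, u, 0))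
        \<le> L' * norm (x' - x) + L' * norm (u' - u)"
    and dist: "\<forall>x\<in>C0 r. \<forall>u. \<forall>d\<in>D. norm (f (x, u, d) - f (x, u, 0)) \<le> \<kappa>' (norm d)"
    and nominal: "\<forall>x0\<in>C0 r. (\<exists>x. delay_sol r x0 (\<lambda>t. f (hist r x t, k (hist r x t), 0)) x) \<and>
        (\<forall>x. delay_sol r x0 (\<lambda>t. f (hist r x t, k (hist r x t), 0)) x \<longrightarrow>
          (\<forall>t\<ge>0. norm (hist r x t) \<le> M * exp (- \<mu> * t) * norm x0))"
    using feedback by blast
  obtain L \<kappa> where L: "L \<ge> 0" and \<kappa>: "\<kappa> \<in> class_K"
    and RL: "\<forall>x\<in>C0 r. \<forall>x'\<in>C0 r. \<forall>u. \<forall>d\<in>D. norm (R (x', u, 0) - R (x, u, d)) \<le> L * norm (x' - x) + \<kappa> (norm d)"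
    using R_Lipschitz by blast
  have one_sided: "one_sided_Lipschitz r (UNIV \<times> D) f"
    unfolding one_sided_Lipschitz_def using f_one_sided_Lipschitz by (simp add: split_paired_All)
  interpret fb: stabilising_feedback r D f k \<kappa>' \<mu> M L'
    by unfold_locales (use r f_0 k_0 pos Lip dist nominal in auto)
  interpret ob: observed_plant r D f h R F \<Psi> \<gamma> \<sigma> g a L \<kappa>
    by unfold_locales (use r D one_sided h_cont forward_complete R_cont output_derivative L \<kappa> RL REO in auto)
  note \<gamma> = ob.gamma_pos and \<sigma> = ob.sigma_pos
  obtain \<delta>0 \<omega> C where \<delta>0: "0 < \<delta>0" "\<delta>0 \<le> 1" and \<omega>: "0 < \<omega>" "\<omega> \<le> \<sigma>" and C: "C \<ge> 1"
    and decay: "\<And>x x0 u d T A N. x0 \<in> C0 r \<Longrightarrow> delay_sol r x0 (\<lambda>t. f (hist r x t, u t, d t)) x \<Longrightarrow>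
      (\<And>t. t \<ge> 0 \<Longrightarrow> d t \<in> D) \<Longrightarrow> T \<ge> 0 \<Longrightarrow> A \<ge> 0 \<Longrightarrow> N \<ge> 0 \<Longrightarrow>
      (\<And>t. t \<in> {0..T} \<Longrightarrow> \<kappa>' (norm (d t)) \<le> N) \<Longrightarrow>
      (\<And>t. t \<in> {0..T} \<Longrightarrow> \<exists>s\<in>{0..t}. t - s \<le> \<delta>0 \<and>
         (\<exists>y\<in>C0 r. u t = k y \<and> norm (y - hist r x s) \<le> exp (- \<sigma> * s) * A + N)) \<Longrightarrow>
      norm (hist r x T) \<le> C * (exp (- \<omega> * T) * (norm x0 + A) + N)"
    by (rule fb.sampled_feedback_decay[OF \<sigma>]) blast
  define q where "q = L * exp \<sigma> * \<gamma>"
  define \<delta> where "\<delta> = min \<delta>0 (1 / (2 * q + 1))"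
  have q: "q \<ge> 0" using L \<gamma> by (simp add: q_def)
  have \<delta>: "\<delta> > 0" "\<delta> \<le> \<delta>0" "\<delta> \<le> 1" using q \<delta>0 by (auto simp: \<delta>_def)
  have "\<delta> * q \<le> 1 / (2 * q + 1) * q" using q by (intro mult_right_mono) (auto simp: \<delta>_def)
  also have "\<dots> \<le> 1 / 2" using q by (simp add: field_simps)
  finally have gain: "\<delta> * L * exp \<sigma> * \<gamma> \<le> 1 / 2" by (simp add: q_def algebra_simps)
  have "\<delta> * L * \<gamma> * 1 \<le> \<delta> * L * \<gamma> * exp \<sigma>"
    using \<delta> L \<gamma> \<sigma> by (intro mult_left_mono) auto
  then have gain': "\<delta> * L * \<gamma> \<le> 1 / 2" using gain by (simp add: algebra_simps)
  define c1 where "c1 = 1 + 2 * \<gamma> * L * exp \<sigma>"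
  define c2 where "c2 = 1 + 2 * \<gamma> * L + 2 * \<gamma>"
  define C' where "C' = 2 * C + 1"
  have pos: "c1 > 0" "c2 > 0" "C' > 0" using \<gamma> L C by (auto simp: c1_def c2_def C'_def add_pos_nonneg)
  define a' where "a' s = C' * (s + c1 * a s)" for s
  \<comment> \<open>The factor 3 in \<open>g'\<close> turns a sum of three suprema into one supremum.\<close>
  define g' where "g' s = 3 * C' * c2 * (g s + \<kappa> s + \<kappa>' s)" for s
  have a': "a' \<in> class_K"
    unfolding a'_def[abs_def] using pos by (intro class_K_scale class_K_add class_K_id ob.a_K) auto
  have g': "g' \<in> class_K"
    unfolding g'_def[abs_def] using pos by (intro class_K_scale class_K_add ob.g_K \<kappa> \<kappa>') auto
  have exists: "\<exists>x z w u. closed_loop_sol r f h R k F \<Psi> \<tau> x0 z0 d \<xi> x z w u"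
    if "sampling_sequence \<delta> \<tau>" "x0 \<in> C0 r" "z0 \<in> C0 r" "d \<in> Linf_loc D" for \<tau> x0 z0 \<xi> d
    by (rule ob.closed_loop_exists[OF that(1) gain' that(2-4)])
  have estimate: "norm (hist r x T) + norm (\<Psi> (hist r z T)) \<le> exp (- \<omega> * T) * a' (norm x0 + norm z0)
      + C' * (2 * \<gamma>) * (SUP s\<in>{0..T}. norm (\<xi> s)) + (SUP s\<in>{0..T}. g' (norm (d s)))"
    if \<tau>: "sampling_sequence \<delta> \<tau>" and x0: "x0 \<in> C0 r" and z0: "z0 \<in> C0 r" and \<xi>: "\<xi> \<in> Linf_loc UNIV"
      and d: "d \<in> Linf_loc D" and sol: "closed_loop_sol r f h R k F \<Psi> \<tau> x0 z0 d \<xi> x z w u" and T: "T \<ge> 0"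
    for \<tau> x0 z0 \<xi> d x z w u T
  proof -
    define sp where "sp \<rho> t = (SUP s\<in>{0..t}. \<rho> (norm (d s)))" for \<rho> :: "real \<Rightarrow> real" and t
    define \<Xi> where "\<Xi> t = (SUP s\<in>{0..t}. norm (\<xi> s))" for t
    define A where "A = c1 * a (norm x0 + norm z0)"
    define N where "N t = sp g t + 2 * \<gamma> * (\<Xi> t + L * sp g t + sp \<kappa> t)" for t
    have A: "A \<ge> 0" using pos ob.a_nonneg[of x0 z0] by (simp add: A_def)
    have sp0: "0 \<le> sp \<rho> t" if "\<rho> \<in> class_K" "t \<ge> 0" for \<rho> t
      unfolding sp_def by (rule class_K_sup_nonneg[OF that(1) d that(2)])
    have sp_mono: "sp \<rho> s \<le> sp \<rho> t" if "\<rho> \<in> class_K" "0 \<le> s" "s \<le> t" for \<rho> s t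
      unfolding sp_def using that by (intro cSUP_subset_mono class_K_sup_bdd[OF that(1) d]) auto
    have \<Xi>_mono: "\<Xi> s \<le> \<Xi> t" if "0 \<le> s" "s \<le> t" for s t
      unfolding \<Xi>_def using that by (intro cSUP_subset_mono class_K_sup_bdd[OF class_K_id \<xi>]) auto
    have \<Xi>0: "0 \<le> \<Xi> T" unfolding \<Xi>_def by (rule class_K_sup_nonneg[OF class_K_id \<xi> T])
    have error: "norm (\<Psi> (hist r z t) - hist r x t) \<le> exp (- \<sigma> * t) * A + N t" if "t \<ge> 0" for t
      unfolding A_def N_def sp_def \<Xi>_def c1_def
      by (rule ob.closed_loop_error[OF \<tau> \<delta>(3) gain x0 z0 \<xi> d sol that])
    have N_mono: "N s \<le> N t" if "0 \<le> s" "s \<le> t" for s t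
      unfolding N_def using that \<gamma> L
      by (intro add_mono mult_left_mono sp_mono ob.g_K \<kappa> \<Xi>_mono) auto
    have N0: "N T \<ge> 0" using sp0[OF ob.g_K T] sp0[OF \<kappa> T] \<Xi>0 \<gamma> L by (simp add: N_def)
    define NT where "NT = N T + sp \<kappa>' T"
    have NT: "NT \<ge> 0" "N T \<le> NT" using N0 sp0[OF \<kappa>' T] by (auto simp: NT_def)
    have x: "delay_sol r x0 (\<lambda>t. f (hist r x t, u t, d t)) x"
      and z: "delay_sol r z0 (\<lambda>t. F (hist r z t, w t, u t)) z"
      and u: "\<And>i t. t \<in> {\<tau> i..<\<tau> (Suc i)} \<Longrightarrow> u t = k (\<Psi> (hist r z (\<tau> i)))"
      using sol by (auto simp: closed_loop_sol_def)
    have state: "norm (hist r x T) \<le> C * (exp (- \<omega> * T) * (norm x0 + A) + NT)"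
    proof (rule decay[OF x0 x _ T A NT(1)])
      show "d t \<in> D" if "t \<ge> 0" for t using d that by (simp add: Linf_loc_def)
      fix t assume t: "t \<in> {0..T}"
      show "\<kappa>' (norm (d t)) \<le> NT"
        using class_K_sup_upper[OF \<kappa>' d T t] N0 by (simp add: NT_def sp_def)
      obtain i where i: "\<tau> i \<le> t" "t < \<tau> (Suc i)" using sampling_interval[OF \<tau>, of t] t by auto
      have \<tau>i: "0 \<le> \<tau> i" "\<tau> (Suc i) - \<tau> i \<le> \<delta>" using sampling_nonneg[OF \<tau>] sampling_gap[OF \<tau>] by auto
      have "norm (\<Psi> (hist r z (\<tau> i)) - hist r x (\<tau> i)) \<le> exp (- \<sigma> * \<tau> i) * A + NT"
        using error[OF \<tau>i(1)] N_mono[of "\<tau> i" T] \<tau>i i t NT(2) by auto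
      then show "\<exists>s\<in>{0..t}. t - s \<le> \<delta>0 \<and>
         (\<exists>y\<in>C0 r. u t = k y \<and> norm (y - hist r x s) \<le> exp (- \<sigma> * s) * A + NT)"
        using i \<tau>i \<delta>(2) u[of t i] ob.Psi_C0[OF ob.hist_sol_C0[OF z \<tau>i(1)]]
        by (intro bexI[of _ "\<tau> i"] conjI bexI[of _ "\<Psi> (hist r z (\<tau> i))"]) auto
    qed
    have "exp (- \<sigma> * T) * A \<le> exp (- \<omega> * T) * (norm x0 + A)"
      using \<omega> T A by (intro mult_mono) (auto simp: mult_right_mono)
    then have "norm (\<Psi> (hist r z T)) \<le> norm (hist r x T) + (exp (- \<omega> * T) * (norm x0 + A) + NT)"
      using error[OF T] NT(2) norm_triangle_sub[of "\<Psi> (hist r z T)" "hist r x T"] by linarith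
    then have "norm (hist r x T) + norm (\<Psi> (hist r z T)) \<le> C' * (exp (- \<omega> * T) * (norm x0 + A) + NT)"
      using state by (simp add: C'_def algebra_simps)
    also have "\<dots> \<le> C' * (exp (- \<omega> * T) * (norm x0 + norm z0 + A) + (c2 * (sp g T + sp \<kappa> T + sp \<kappa>' T) + 2 * \<gamma> * \<Xi> T))"
    proof (intro mult_left_mono add_mono)
      have "0 \<le> 2 * \<gamma> * sp g T" "0 \<le> (1 + 2 * \<gamma> * L) * sp \<kappa> T" "0 \<le> (2 * \<gamma> * L + 2 * \<gamma>) * sp \<kappa>' T"
        using sp0[OF ob.g_K T] sp0[OF \<kappa> T] sp0[OF \<kappa>' T] \<gamma> L by auto
      then show "NT \<le> c2 * (sp g T + sp \<kappa> T + sp \<kappa>' T) + 2 * \<gamma> * \<Xi> T"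
        by (simp add: NT_def N_def c2_def algebra_simps)
    qed (use pos in auto)
    also have "\<dots> = exp (- \<omega> * T) * a' (norm x0 + norm z0) + C' * (2 * \<gamma>) * \<Xi> T
        + C' * c2 * (sp g T + sp \<kappa> T + sp \<kappa>' T)"
      by (simp add: a'_def A_def algebra_simps)
    also have "C' * c2 * (sp g T + sp \<kappa> T + sp \<kappa>' T) \<le> sp g' T"
    proof -
      have part: "3 * C' * c2 * sp \<rho> T \<le> sp g' T"
        if "\<rho> \<in> class_K" "\<And>s. s \<ge> 0 \<Longrightarrow> \<rho> s \<le> g s + \<kappa> s + \<kappa>' s" for \<rho>
      proof -
        have "sp \<rho> T \<le> sp g' T / (3 * C' * c2)"
          unfolding sp_def[of \<rho>]
        proof (rule cSUP_least)
          fix s assume s: "s \<in> {0..T}"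
          have "3 * C' * c2 * \<rho> (norm (d s)) \<le> g' (norm (d s))"
            unfolding g'_def using that(2)[of "norm (d s)"] pos by (intro mult_left_mono) auto
          also have "\<dots> \<le> sp g' T" unfolding sp_def by (rule class_K_sup_upper[OF g' d T s])
          finally show "\<rho> (norm (d s)) \<le> sp g' T / (3 * C' * c2)" using pos by (simp add: field_simps)
        qed (use T in auto)
        then show ?thesis using pos by (simp add: field_simps)
      qed
      have nonneg: "0 \<le> g s" "0 \<le> \<kappa> s" "0 \<le> \<kappa>' s" if "s \<ge> 0" for s
        using that class_K_nonneg ob.g_K \<kappa> \<kappa>' by auto
      have "3 * C' * c2 * sp g T \<le> sp g' T" by (rule part[OF ob.g_K]) (use nonneg in simp)
      moreover have "3 * C' * c2 * sp \<kappa> T \<le> sp g' T" by (rule part[OF \<kappa>]) (use nonneg in simp)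
      moreover have "3 * C' * c2 * sp \<kappa>' T \<le> sp g' T" by (rule part[OF \<kappa>']) (use nonneg in simp)
      ultimately have "3 * (C' * c2 * (sp g T + sp \<kappa> T + sp \<kappa>' T)) \<le> 3 * sp g' T"
        by (simp add: algebra_simps)
      then show ?thesis by linarith
    qed
    finally show ?thesis by (simp add: sp_def \<Xi>_def)
  qed
  have linear: "linear_on_nonneg a \<longrightarrow> linear_on_nonneg a'"
  proof
    assume "linear_on_nonneg a"
    then obtain b where "\<forall>s\<ge>0. a s = b * s" by (auto simp: linear_on_nonneg_def)
    then show "linear_on_nonneg a'"
      unfolding linear_on_nonneg_def a'_def
      by (intro exI[of _ "C' * (1 + c1 * b)"]) (simp add: algebra_simps)
  qed
  have \<gamma>': "C' * (2 * \<gamma>) > 0" using pos \<gamma> by simp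
  show ?thesis
  proof (rule exI[of _ \<delta>], rule conjI[OF \<delta>(1)], rule exI[of _ \<omega>], rule conjI[OF \<omega>(1)],
      rule exI[of _ "C' * (2 * \<gamma>)"], rule conjI[OF \<gamma>'], rule bexI[OF _ g'], rule bexI[OF _ a'],
      rule conjI[OF _ linear], intro allI ballI impI conjI)
  qed (rule exists, assumption+, rule estimate, assumption+)
qed

end
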